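(* Let $k\equiv3\pmod4$ be a positive integer, $N$ an odd square-free positive integer, and $F=\sum_{n\ge1}b_nq^n\in S_{k-1}^{\mathrm{new}}(\Gamma_0(N))$ a newform with $L(F,\frac12)\ne0$. Let $g=\sum_{n\ge1}a_nq^n$ be the non-zero form in the Kohnen subspace of $S_{\frac k2}(\Gamma_0(4N),F)$ and $A_F:\mathbb N^{\mathrm{sf}}\to\mathbb C$ the function of Waldspurger, both described in the context. Then there is a non-zero complex constant $r$, depending only on $F$ (in particular not on $t$), such that for every positive square-free integer $t$ satisfying $\left(\frac{\Delta_{-t}}p\right)=-p^{\frac12}\lambda_p'$ for all primes $p$ with $p\mid N$ and $p\nmid\Delta_{-t}$, we have $$A_F(t)=r\,2^{\frac{\nu_t}2}\,|\Delta_{-t}|^{\frac{2-k}4}\,a_{|\Delta_{-t}|},\qquad\text{where } 2^{\frac{\nu_t}2}=\prod_{p\mid N,\; p\nmid\Delta_{-t}}2^{-\frac12}.$$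
   Context: Notation: $q=e^{2\pi iz}$; newforms are normalized ($b_1=1$) and have trivial character; $p^{1/2}>0$; $\mathbb N^{\mathrm{sf}}$ is the set of positive square-free integers; $n^{\mathrm{sf}}$ is the square-free part of $n$; $\Delta_{-t}$ is the discriminant of $\mathbb Q(\sqrt{-t})$. $L$-function: for a newform $G=\sum b_n(G)q^n$ of weight $k-1$ and level $M$, $L(G,s)=2(2\pi)^{1-s-k/2}M^{\frac{s-1+k/2}2}\Gamma(s-1+k/2)\sum_{n\ge1}b_n(G)n^{1-s-k/2}$ for $\operatorname{Re}s>\frac32$, continued to an entire function. Half-integral weight: $S'_{\frac k2}(\Gamma_0(4N))$ is the space of cusp forms $f$ with $f(\gamma z)=(\theta(\gamma z)/\theta(z))^kf(z)$ for $\gamma\in\Gamma_0(4N)$, $\theta(z)=1+2\sum_{n\ge1}q^{n^2}$. For $k\ge5$ set $S_{\frac k2}=S'_{\frac k2}$; for $k=3$, $S_{\frac32}(\Gamma_0(4N))$ is the Petersson-orthogonal complement in $S'_{\frac32}(\Gamma_0(4N))$ of the subspace spanned by the Shimura theta series $\sum_{n\in\mathbb Z}\psi(n)n\,q^{mn^2}$ ($m\ge1$, $\psi$ odd primitive Dirichlet character) lying in it. For a prime $p\nmid4N$, $T_{p^2}$ sends $\sum a_nq^n$ to the series with $n$-th coefficient $a_{p^2n}+\left(\frac{-n}p\right)p^{\frac{k-3}2}a_n+p^{k-2}a_{n/p^2}$. Put $S_{\frac k2}(\Gamma_0(4N),F)=\{f\in S_{\frac k2}(\Gamma_0(4N)):T_{p^2}f=b_pf\text{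 for almost all }p\nmid4N\}$. Its Kohnen subspace consists of the $f=\sum a_nq^n$ with $a_n=0$ whenever $-n\equiv2,3\pmod4$. The form $g$: Let $w_p$ be the eigenvalue of $F$ under the Atkin–Lehner involution $W_p$ ($p\mid N$) and $S=\{p\mid N:w_p=-1\}$; $|S|$ is odd since $L(F,\frac12)\ne0$ and $k\equiv3\pmod4$. Let $B$ be the definite quaternion algebra over $\mathbb Q$ ramified exactly at $S\cup\{\infty\}$, with reduced norm $N(x)$, and $O\subset B$ an order which is maximal at every $q\in S$ and every $p\nmid N$, and an Eichler order of index $p$ in a maximal order at the remaining $p\mid N$. A left $O$-ideal is a lattice $I$ with $I_p=O_pa_p$, $a_p\in B_p^*$, for all $p$; $I\sim J$ iff $I=Ja$ with $a\in B^*$. Let $[I_1],\dots,[I_H]$ be the classes, $O_i=O_r(I_i)=\{a\in B:I_ia\subseteq I_i\}$, and let $R_i$ be the group of trace-zero elements of $\mathbb Z+2O_i$. On $X(\mathbb R)=\bigoplus_i\mathbb R[I_i]$ the Hecke operators are $t_n[I_i]=\sum_jB(n)_{ij}[I_j]$, $B(n)_{ij}=\frac1{\#O_j^*}\#\{x\in I_j^{-1}I_i:N(x)=n\,N(I_j^{-1}I_i)\}$, where the norm of an ideal is the positive generator of the fractional ideal generated by the norms of its elements. For $k=3$: $g([I_i])=\frac12\sum_{x\in R_i}q^{N(x)}$, extended linearly to $X(\mathbb R)$, and $g=g(I_F)$, with $I_F\ne0$ in the $F$-isotypical component of $X(\mathbb R)$ ($t_pI_F=b_pI_F$ for all $p\nmid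 N$). For general $k\equiv3\pmod4$: $g$ is a fixed non-zero element of the Kohnen subspace of $S_{\frac k2}(\Gamma_0(4N),F)$ obtained as a linear combination of generalized theta series $\sum_{x\in R_i}P(x)q^{N(x)}$, $P$ a homogeneous harmonic polynomial (with respect to $N$) of degree $\frac{k-3}2$ in three variables. (By Böcherer and Schulze-Pillot, such a $g$ exists; in the case $k=3$, $g(I_F)$ is non-zero and lies in the Kohnen subspace, because $L(F,\frac12)\neq0$.) Parameters: for $p\nmid N$, $\lambda_p=b_pp^{1-\frac k2}$, and $\alpha_p,\alpha_p'$ are defined by $\alpha_p+\alpha_p'=\lambda_p$, $\alpha_p\alpha_p'=1$. For $p\mid N$, $\lambda_p'=b_pp^{1-\frac k2}$. Local functions: for a prime $p$ write $n=up^{2h}$ with $v_p(u)\in\{0,1\}$. Let $(\cdot,\cdot)_2$ be the Hilbert symbol over $\mathbb Q_2$. Then - $c_2'[\delta](n)=\delta^h(\delta-2^{-\frac12}(2,u)_2)$ if $v_2(u)=0$ and $(u,-1)_2=-1$; $=\delta^h$ otherwise. - $c_2''[\delta](n)=\delta$ if $v_2(n)=0$ and $(n,-1)_2=-1$; $=0$ if $v_2(n)=1$, or if $v_2(n)=0$ and $(n,-1)_2=1$; $=\delta\left(c_2''[\delta](\frac n4)+c_2'[\delta](\frac n4)\right)$ otherwise. - for $p\mid N$: $c_p^s[\delta](n)=\delta^h$ if $v_p(u)=1$; $=2^{\frac12}\delta^h$ if $v_p(u)=0$ and $\left(\frac{-u}p\right)=-p^{\frac12}\delta$; $=0$ otherwise.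 - for $p\nmid2N$: $c_p^0[\delta](n)=1$ if $v_p(u)=0$ and $h=0$; $=\beta_h-\beta_{h-1}\left(\frac{-u}p\right)p^{-\frac12}$ if $v_p(u)=0$ and $h\ge1$; $=\beta_h$ otherwise, where $\beta_h=\frac1{2^h}\sum_{i=0}^{\lfloor h/2\rfloor}\binom{h+1}{2i+1}\delta^{h-2i}(\delta^2-4)^i$. Put $C(n)=\prod_{p\mid N}c_p^s[\lambda_p'](n)\prod_{p\nmid2N}c_p^0[\lambda_p](n)$, and for a function $A:\mathbb N^{\mathrm{sf}}\to\mathbb C$ let $a_n(\mathbf{c_1},A)=A(n^{\mathrm{sf}})n^{\frac{k-2}4}c_2'[\alpha_2](n)C(n)$, $a_n(\mathbf{c_2},A)=A(n^{\mathrm{sf}})n^{\frac{k-2}4}c_2'[\alpha_2'](n)C(n)$, $a_n(\mathbf{c_2'},A)=A(n^{\mathrm{sf}})n^{\frac{k-2}4}c_2''[\alpha_2](n)C(n)$, and $f(\mathbf c,A)=\sum_{n\ge1}a_n(\mathbf c,A)q^n$ for $\mathbf c\in\{\mathbf{c_1},\mathbf{c_2},\mathbf{c_2'}\}$. The function $A_F$ (Waldspurger's theorem in this setting): $A_F:\mathbb N^{\mathrm{sf}}\to\mathbb C$ is a fixed function, whose existence is Waldspurger's theorem, such that (1) $A_F(t)^2=L(F\otimes\chi_0^{-1}\chi_t,\frac12)\,\epsilon(\chi_0^{-1}\chi_t,\frac12)$ for all $t\in\mathbb N^{\mathrm{sf}}$, and (2) $S_{\frac k2}(\Gamma_0(4N),F)$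 has as a basis $f(\mathbf{c_1},A_F),f(\mathbf{c_2},A_F)$ if $\alpha_2\ne\alpha_2'$, and $f(\mathbf{c_1},A_F),f(\mathbf{c_2'},A_F)$ if $\alpha_2=\alpha_2'$. Here $\chi_0(n)=\left(\frac{-1}n\right)^{\frac{k-1}2}$; $\chi_t$ is the quadratic character of $\mathbb Q(\sqrt t)/\mathbb Q$; $F\otimes\nu$ is the newform with $p$-th Hecke eigenvalue $\nu(p)b_p$ for almost all $p$; and $\epsilon(\nu,s)$ is defined by $L(\nu^{-1},1-s)=\epsilon(\nu,s)L(\nu,s)$ where $L(\nu,s)=\pi^{-\frac{s+\delta}2}\Gamma(\frac{s+\delta}2)\sum_{n\ge1}\hat\nu(n)n^{-s}$, $\nu(-1)=(-1)^\delta$, $\delta\in\{0,1\}$, $\hat\nu$ the primitive character attached to $\nu$. *)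

theory Defs
  imports
    "HOL-Complex_Analysis.Complex_Analysis"
    "HOL-Number_Theory.Residues"
    "HOL-Computational_Algebra.Squarefree"
    "HOL-Library.Product_Plus"
begin

section \<open>Quadratic symbols and Dirichlet characters\<close>

text \<open>The Kronecker symbol. The library's \<open>Legendre\<close> is the usual symbol at odd primes only.\<close>

definition kronecker_prime :: "int \<Rightarrow> nat \<Rightarrow> int" where
  "kronecker_prime a p =
     (if p = 2 then (if even a then 0 else if a mod 8 \<in> {1, 7} then 1 else -1)
      else Legendre a (int p))"

definition kronecker :: "int \<Rightarrow> int \<Rightarrow> int" where
  "kronecker a n =
     (if n = 0 then (if \<bar>a\<bar> = 1 then 1 else 0)
      else (if n < 0 \<and> a < 0 then -1 else 1) *
        (\<Prod>p\<in>prime_factors (nat \<bar>n\<bar>). kronecker_prime a p ^ multiplicity p (nat \<bar>n\<bar>)))"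

text \<open>The discriminant of \<open>\<rat>(\<surd>d)\<close> for square-free \<open>d\<close>; it is \<open>1\<close> for \<open>d = 1\<close>.\<close>

definition quadratic_disc :: "int \<Rightarrow> int" where
  "quadratic_disc d = (if d mod 4 = 1 then d else 4 * d)"

definition quadratic_char :: "nat \<Rightarrow> int \<Rightarrow> complex" where
  "quadratic_char t n = of_int (kronecker (quadratic_disc (int t)) n)"

text \<open>\<open>(-1/n)\<^bsup>(k-1)/2\<^esup>\<close> as a Dirichlet character modulo \<open>4\<close>, hence \<open>0\<close> at even \<open>n\<close>.\<close>

definition chi0 :: "nat \<Rightarrow> int \<Rightarrow> complex" where
  "chi0 k n = (if even n then 0 else of_int (kronecker (-1) n) ^ ((k - 1) div 2))"

definition dirichlet_character :: "nat \<Rightarrow> (int \<Rightarrow> complex) \<Rightarrow> bool" where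
  "dirichlet_character m \<psi> \<longleftrightarrow> m > 0 \<and>
     (\<forall>n. \<psi> n \<noteq> 0 \<longleftrightarrow> coprime n (int m)) \<and>
     (\<forall>n. \<psi> (n + int m) = \<psi> n) \<and> (\<forall>x y. \<psi> (x * y) = \<psi> x * \<psi> y)"

definition primitive_character :: "nat \<Rightarrow> (int \<Rightarrow> complex) \<Rightarrow> bool" where
  "primitive_character m \<psi> \<longleftrightarrow> dirichlet_character m \<psi> \<and>
     (\<forall>d. d dvd m \<and> d < m \<longrightarrow>
       (\<exists>n. coprime n (int m) \<and> [n = 1] (mod int d) \<and> \<psi> n \<noteq> 1))"

definition primitive_attached :: "(int \<Rightarrow> complex) \<Rightarrow> int \<Rightarrow> complex" where
  "primitive_attached \<nu> =
     (THE \<psi>. (\<exists>m. primitive_character m \<psi>) \<and> (\<forall>n. \<nu> n \<noteq> 0 \<longrightarrow> \<psi> n = \<nu> n))"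

text \<open>The completed L-function (without conductor factor) of a primitive character, as an entire
  function; it is used for nontrivial characters only.\<close>

definition dirichlet_Lambda :: "(int \<Rightarrow> complex) \<Rightarrow> complex \<Rightarrow> complex" where
  "dirichlet_Lambda \<psi> =
     (let \<delta> = (if \<psi> (-1) = 1 then 0 else 1) in
      THE L. L holomorphic_on UNIV \<and>
        (\<forall>s. Re s > 1 \<longrightarrow>
          L s = of_real pi powr (- (s + \<delta>) / 2) * Gamma ((s + \<delta>) / 2) *
                (\<Sum>n. \<psi> (int (Suc n)) * of_nat (Suc n) powr (- s))))"

definition epsilon_factor :: "(int \<Rightarrow> complex) \<Rightarrow> complex \<Rightarrow> complex" where
  "epsilon_factor \<nu> =
     (THE e. e holomorphic_on UNIV \<and>
        (\<forall>s. dirichlet_Lambda (primitive_attached (\<lambda>n. inverse (\<nu> n))) (1 - s) =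
              e s * dirichlet_Lambda (primitive_attached \<nu>) s))"

section \<open>Modular forms\<close>

text \<open>Cusp forms are represented by their sequences of \<open>q\<close>-expansion coefficients at infinity; all
  groups and multipliers below are such that forms have period \<open>1\<close>. Convergence of the series on
  the upper half-plane makes \<open>qser a\<close> holomorphic there.\<close>

definition upper_half_plane :: "complex set" where
  "upper_half_plane = {z. Im z > 0}"

definition qpow :: "nat \<Rightarrow> complex \<Rightarrow> complex" where
  "qpow n z = exp (2 * of_real pi * \<i> * of_nat n * z)"

definition qser :: "(nat \<Rightarrow> complex) \<Rightarrow> complex \<Rightarrow> complex" where
  "qser a z = (\<Sum>n. a n * qpow n z)"

definition q_convergent :: "(nat \<Rightarrow> complex) \<Rightarrow> bool" where
  "q_convergent a \<longleftrightarrow> (\<forall>z\<in>upper_half_plane. summable (\<lambda>n. a n * qpow n z))"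

text \<open>A matrix with rows \<open>(a, b)\<close> and \<open>(c, d)\<close> is written \<open>(a, b, c, d)\<close>.\<close>

type_synonym mat2 = "int \<times> int \<times> int \<times> int"

definition Gamma0 :: "nat \<Rightarrow> mat2 set" where
  "Gamma0 M = {(a, b, c, d). a * d - b * c = 1 \<and> int M dvd c}"

definition moebius :: "mat2 \<Rightarrow> complex \<Rightarrow> complex" where
  "moebius = (\<lambda>(a, b, c, d) z. (of_int a * z + of_int b) / (of_int c * z + of_int d))"

definition autfactor :: "mat2 \<Rightarrow> complex \<Rightarrow> complex" where
  "autfactor = (\<lambda>(a, b, c, d) z. of_int c * z + of_int d)"

text \<open>Vanishing at the cusps for weight \<open>w \<in> \<int>/2\<close>: for every \<open>\<gamma> \<in> SL\<^sub>2(\<int>)\<close> the form slashed with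
  \<open>\<gamma>\<close> tends to \<open>0\<close> as \<open>Im z\<close> tends to infinity. Only absolute values matter, so no branch of
  the root in the half-integral slash operator has to be fixed.\<close>

definition vanishes_at_cusps :: "real \<Rightarrow> (complex \<Rightarrow> complex) \<Rightarrow> bool" where
  "vanishes_at_cusps w f \<longleftrightarrow> (\<forall>\<gamma>\<in>Gamma0 1.
     ((\<lambda>z. norm (f (moebius \<gamma> z)) / norm (autfactor \<gamma> z) powr w) \<longlongrightarrow> 0)
       (filtercomap Im at_top))"

definition cusp_forms :: "nat \<Rightarrow> nat \<Rightarrow> (nat \<Rightarrow> complex) set" where
  "cusp_forms M \<kappa> = {a. q_convergent a \<and>
     (\<forall>\<gamma>\<in>Gamma0 M. \<forall>z\<in>upper_half_plane.
        qser a (moebius \<gamma> z) = autfactor \<gamma> z ^ \<kappa> * qser a z) \<and>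
     vanishes_at_cusps (real \<kappa>) (qser a)}"

text \<open>A fundamental domain here is a Borel set of representatives of the orbits, so that the
  Petersson product (unnormalised) does not depend on the choice made below.\<close>

definition fundamental_domain :: "nat \<Rightarrow> complex set \<Rightarrow> bool" where
  "fundamental_domain M D \<longleftrightarrow> D \<in> sets borel \<and> D \<subseteq> upper_half_plane \<and>
     (\<forall>z\<in>upper_half_plane. \<exists>!w. w \<in> D \<and> (\<exists>\<gamma>\<in>Gamma0 M. w = moebius \<gamma> z))"

definition petersson ::
  "nat \<Rightarrow> real \<Rightarrow> (complex \<Rightarrow> complex) \<Rightarrow> (complex \<Rightarrow> complex) \<Rightarrow> complex" where
  "petersson M w f g =
     (LINT z:(SOME D. fundamental_domain M D)|lborel.
        f z * cnj (g z) * of_real (Im z powr (w - 2)))"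

definition new_cusp_forms :: "nat \<Rightarrow> nat \<Rightarrow> (nat \<Rightarrow> complex) set" where
  "new_cusp_forms N \<kappa> = {a \<in> cusp_forms N \<kappa>.
     \<forall>M d. M dvd N \<and> M < N \<and> d dvd N div M \<longrightarrow>
       (\<forall>c\<in>cusp_forms M \<kappa>. petersson N (real \<kappa>) (qser a) (\<lambda>z. qser c (of_nat d * z)) = 0)}"

definition hecke :: "nat \<Rightarrow> nat \<Rightarrow> nat \<Rightarrow> (nat \<Rightarrow> complex) \<Rightarrow> nat \<Rightarrow> complex" where
  "hecke N \<kappa> p a n = a (p * n) +
     (if \<not> p dvd N \<and> p dvd n then of_nat p ^ (\<kappa> - 1) * a (n div p) else 0)"

definition newform :: "nat \<Rightarrow> nat \<Rightarrow> (nat \<Rightarrow> complex) \<Rightarrow> bool" where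
  "newform N \<kappa> b \<longleftrightarrow> N > 0 \<and> b \<in> new_cusp_forms N \<kappa> \<and> b 1 = 1 \<and>
     (\<forall>p. prime p \<longrightarrow> (\<exists>c. \<forall>n. hecke N \<kappa> p b n = c * b n))"

text \<open>The completed L-function of a newform of weight \<open>k - 1\<close> and level \<open>M\<close>, with centre \<open>1/2\<close>.\<close>

definition newform_L :: "nat \<Rightarrow> nat \<Rightarrow> (nat \<Rightarrow> complex) \<Rightarrow> complex \<Rightarrow> complex" where
  "newform_L k M b =
     (THE L. L holomorphic_on UNIV \<and>
       (\<forall>s. Re s > 3 / 2 \<longrightarrow>
         L s = 2 * of_real (2 * pi) powr (1 - s - of_nat k / 2) *
               of_nat M powr ((s - 1 + of_nat k / 2) / 2) *
               Gamma (s - 1 + of_nat k / 2) *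
               (\<Sum>n. b (Suc n) * of_nat (Suc n) powr (1 - s - of_nat k / 2))))"

text \<open>\<open>c\<close> is the newform \<open>F \<otimes> \<nu>\<close>, of level \<open>M\<close>, where \<open>F\<close> has coefficients \<open>b\<close> and weight \<open>\<kappa>\<close>.\<close>

definition twisted_newform ::
  "nat \<Rightarrow> (nat \<Rightarrow> complex) \<Rightarrow> (int \<Rightarrow> complex) \<Rightarrow> nat \<Rightarrow> (nat \<Rightarrow> complex) \<Rightarrow> bool" where
  "twisted_newform \<kappa> b \<nu> M c \<longleftrightarrow> newform M \<kappa> c \<and>
     finite {p. prime p \<and> c p \<noteq> \<nu> (int p) * b p}"

text \<open>\<open>w\<close> is the eigenvalue of the Atkin--Lehner involution \<open>W\<^sub>p\<close>, given by the matrices with rows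
  \<open>(p x, y)\<close>, \<open>(N z, p t)\<close> of determinant \<open>p\<close>, on a form of even weight \<open>\<kappa>\<close> and square-free
  level \<open>N\<close>.\<close>

definition atkin_lehner_eigenvalue ::
  "nat \<Rightarrow> nat \<Rightarrow> (nat \<Rightarrow> complex) \<Rightarrow> nat \<Rightarrow> complex \<Rightarrow> bool" where
  "atkin_lehner_eigenvalue N \<kappa> b p w \<longleftrightarrow>
     (\<forall>x y z t. (int p * x) * (int p * t) - y * (int N * z) = int p \<longrightarrow>
       (\<forall>\<tau>\<in>upper_half_plane.
         of_nat p ^ (\<kappa> div 2) * qser b (moebius (int p * x, y, int N * z, int p * t) \<tau>) /
           autfactor (int p * x, y, int N * z, int p * t) \<tau> ^ \<kappa> = w * qser b \<tau>))"

section \<open>Half-integral weight\<close>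

definition theta :: "complex \<Rightarrow> complex" where
  "theta z = 1 + 2 * (\<Sum>n. qpow ((Suc n)\<^sup>2) z)"

definition half_cusp_forms' :: "nat \<Rightarrow> nat \<Rightarrow> (nat \<Rightarrow> complex) set" where
  "half_cusp_forms' M k = {a. q_convergent a \<and>
     (\<forall>\<gamma>\<in>Gamma0 M. \<forall>z\<in>upper_half_plane.
        qser a (moebius \<gamma> z) = (theta (moebius \<gamma> z) / theta z) ^ k * qser a z) \<and>
     vanishes_at_cusps (real k / 2) (qser a)}"

definition shimura_theta :: "(int \<Rightarrow> complex) \<Rightarrow> nat \<Rightarrow> nat \<Rightarrow> complex" where
  "shimura_theta \<psi> m j = (\<Sum>n\<in>{n::int. int m * n\<^sup>2 = int j}. \<psi> n * of_int n)"

definition half_cusp_forms :: "nat \<Rightarrow> nat \<Rightarrow> (nat \<Rightarrow> complex) set" where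
  "half_cusp_forms M k =
     (if k = 3
      then {a \<in> half_cusp_forms' M 3.
             \<forall>m r \<psi>. m \<ge> 1 \<and> primitive_character r \<psi> \<and> \<psi> (-1) = -1 \<and>
               shimura_theta \<psi> m \<in> half_cusp_forms' M 3 \<longrightarrow>
               petersson M (3 / 2) (qser a) (qser (shimura_theta \<psi> m)) = 0}
      else half_cusp_forms' M k)"

text \<open>The character \<open>(-n/p)\<close> is the one for \<open>k \<equiv> 3 (mod 4)\<close>.\<close>

definition hecke_sq :: "nat \<Rightarrow> nat \<Rightarrow> (nat \<Rightarrow> complex) \<Rightarrow> nat \<Rightarrow> complex" where
  "hecke_sq k p a n = a (p\<^sup>2 * n) +
     of_int (Legendre (- int n) (int p)) * of_nat p ^ ((k - 3) div 2) * a n +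
     (if p\<^sup>2 dvd n then of_nat p ^ (k - 2) * a (n div p\<^sup>2) else 0)"

definition shimura_space :: "nat \<Rightarrow> nat \<Rightarrow> (nat \<Rightarrow> complex) \<Rightarrow> (nat \<Rightarrow> complex) set" where
  "shimura_space k N b = {a \<in> half_cusp_forms (4 * N) k.
     finite {p. prime p \<and> \<not> p dvd 4 * N \<and> hecke_sq k p a \<noteq> (\<lambda>n. b p * a n)}}"

definition kohnen_subspace :: "nat \<Rightarrow> nat \<Rightarrow> (nat \<Rightarrow> complex) \<Rightarrow> (nat \<Rightarrow> complex) set" where
  "kohnen_subspace k N b =
     {a \<in> shimura_space k N b. \<forall>n. (- int n) mod 4 \<in> {2, 3} \<longrightarrow> a n = 0}"

section \<open>The p-adic numbers and the Hilbert symbol\<close>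

text \<open>Elements of \<open>\<rat>\<^sub>p\<close> are represented by \<open>p\<close>-adic Cauchy sequences of rationals, two of them being
  equal in \<open>\<rat>\<^sub>p\<close> iff their difference is a null sequence. \<open>padic_small p m r\<close> says that \<open>r\<close> has
  \<open>p\<close>-adic valuation at least \<open>m\<close>.\<close>

definition padic_small :: "nat \<Rightarrow> nat \<Rightarrow> rat \<Rightarrow> bool" where
  "padic_small p m r \<longleftrightarrow>
     (\<exists>u v :: int. \<not> int p dvd v \<and> r = of_int (int p ^ m * u) / of_int v)"

definition padic_null :: "nat \<Rightarrow> (nat \<Rightarrow> rat) \<Rightarrow> bool" where
  "padic_null p s \<longleftrightarrow> (\<forall>m. eventually (\<lambda>i. padic_small p m (s i)) sequentially)"

definition padic_Cauchy :: "nat \<Rightarrow> (nat \<Rightarrow> rat) \<Rightarrow> bool" where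
  "padic_Cauchy p s \<longleftrightarrow> (\<forall>m. \<exists>K. \<forall>i\<ge>K. \<forall>j\<ge>K. padic_small p m (s i - s j))"

definition hilbert_symbol :: "nat \<Rightarrow> rat \<Rightarrow> rat \<Rightarrow> int" where
  "hilbert_symbol p a b =
     (if \<exists>x y z. padic_Cauchy p x \<and> padic_Cauchy p y \<and> padic_Cauchy p z \<and>
           \<not> (padic_null p x \<and> padic_null p y \<and> padic_null p z) \<and>
           padic_null p (\<lambda>i. (z i)\<^sup>2 - a * (x i)\<^sup>2 - b * (y i)\<^sup>2)
      then 1 else -1)"

section \<open>Quaternion algebras\<close>

text \<open>\<open>(x\<^sub>0, x\<^sub>1, x\<^sub>2, x\<^sub>3)\<close> stands for \<open>x\<^sub>0 + x\<^sub>1 i + x\<^sub>2 j + x\<^sub>3 i j\<close> in the algebra \<open>(u, v)\<close> with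
  \<open>i\<^sup>2 = u\<close>, \<open>j\<^sup>2 = v\<close>, \<open>j i = - i j\<close>. Every quaternion algebra over \<open>\<rat>\<close> is of this form with
  nonzero rational \<open>u\<close>, \<open>v\<close>.\<close>

type_synonym 'a quat = "'a \<times> 'a \<times> 'a \<times> 'a"

definition qmul :: "'a::comm_ring_1 \<Rightarrow> 'a \<Rightarrow> 'a quat \<Rightarrow> 'a quat \<Rightarrow> 'a quat" where
  "qmul u v = (\<lambda>(x0, x1, x2, x3) (y0, y1, y2, y3).
     (x0 * y0 + u * x1 * y1 + v * x2 * y2 - u * v * x3 * y3,
      x0 * y1 + x1 * y0 - v * x2 * y3 + v * x3 * y2,
      x0 * y2 + x2 * y0 + u * x1 * y3 - u * x3 * y1,
      x0 * y3 + x3 * y0 + x1 * y2 - x2 * y1))"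

definition qone :: "'a::comm_ring_1 quat" where
  "qone = (1, 0, 0, 0)"

definition qscale :: "'a::comm_ring_1 \<Rightarrow> 'a quat \<Rightarrow> 'a quat" where
  "qscale c = (\<lambda>(x0, x1, x2, x3). (c * x0, c * x1, c * x2, c * x3))"

definition qnorm :: "'a::comm_ring_1 \<Rightarrow> 'a \<Rightarrow> 'a quat \<Rightarrow> 'a" where
  "qnorm u v = (\<lambda>(x0, x1, x2, x3). x0\<^sup>2 - u * x1\<^sup>2 - v * x2\<^sup>2 + u * v * x3\<^sup>2)"

definition qtrace :: "'a::comm_ring_1 quat \<Rightarrow> 'a" where
  "qtrace = (\<lambda>(x0, x1, x2, x3). 2 * x0)"

subsection \<open>Completions\<close>

text \<open>As for \<open>\<rat>\<^sub>p\<close>, elements of \<open>B\<^sub>p\<close> are represented by \<open>p\<close>-adic Cauchy sequences in \<open>B\<close>, and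
  \<open>Bp_eq p\<close> is equality in \<open>B\<^sub>p\<close>. Subsets of \<open>B\<^sub>p\<close> are sets of Cauchy sequences saturated under
  \<open>Bp_eq p\<close>.\<close>

definition quat_small :: "nat \<Rightarrow> nat \<Rightarrow> rat quat \<Rightarrow> bool" where
  "quat_small p m = (\<lambda>(x0, x1, x2, x3).
     padic_small p m x0 \<and> padic_small p m x1 \<and> padic_small p m x2 \<and> padic_small p m x3)"

definition Bp :: "nat \<Rightarrow> (nat \<Rightarrow> rat quat) set" where
  "Bp p = {s. \<forall>m. \<exists>K. \<forall>i\<ge>K. \<forall>j\<ge>K. quat_small p m (s i - s j)}"

definition Bp_eq :: "nat \<Rightarrow> (nat \<Rightarrow> rat quat) \<Rightarrow> (nat \<Rightarrow> rat quat) \<Rightarrow> bool" where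
  "Bp_eq p s t \<longleftrightarrow> (\<forall>m. eventually (\<lambda>i. quat_small p m (s i - t i)) sequentially)"

text \<open>\<open>L\<^sub>p\<close> for a lattice \<open>L \<subseteq> B\<close>, that is, the closure of \<open>L\<close> in \<open>B\<^sub>p\<close>.\<close>

definition localization :: "nat \<Rightarrow> rat quat set \<Rightarrow> (nat \<Rightarrow> rat quat) set" where
  "localization p L = {s \<in> Bp p. \<exists>t\<in>Bp p. range t \<subseteq> L \<and> Bp_eq p s t}"

definition Zp :: "nat \<Rightarrow> (nat \<Rightarrow> rat) set" where
  "Zp p = {c. padic_Cauchy p c \<and> (\<forall>i. padic_small p 0 (c i))}"

definition Bp_lattice :: "nat \<Rightarrow> (nat \<Rightarrow> rat quat) set \<Rightarrow> bool" where
  "Bp_lattice p X \<longleftrightarrow>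
     (\<exists>E. finite E \<and> E \<subseteq> Bp p \<and>
        X = {s \<in> Bp p. \<exists>c. (\<forall>e\<in>E. c e \<in> Zp p) \<and>
                           Bp_eq p s (\<lambda>i. \<Sum>e\<in>E. qscale (c e i) (e i))}) \<and>
     (\<forall>s\<in>Bp p. \<exists>m. (\<lambda>i. qscale (of_nat p ^ m) (s i)) \<in> X)"

definition quat_lattice :: "rat quat set \<Rightarrow> bool" where
  "quat_lattice L \<longleftrightarrow>
     (\<exists>E. finite E \<and> L = {\<Sum>e\<in>E. qscale (of_int (c e)) e | c :: rat quat \<Rightarrow> int. True}) \<and>
     (\<forall>x. \<exists>m::int. m \<noteq> 0 \<and> qscale (of_int m) x \<in> L)"

context
  fixes u v :: rat
begin

definition Bp_mul :: "(nat \<Rightarrow> rat quat) \<Rightarrow> (nat \<Rightarrow> rat quat) \<Rightarrow> nat \<Rightarrow> rat quat" where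
  "Bp_mul s t i = qmul u v (s i) (t i)"

definition Bp_unit :: "nat \<Rightarrow> (nat \<Rightarrow> rat quat) \<Rightarrow> bool" where
  "Bp_unit p s \<longleftrightarrow> s \<in> Bp p \<and>
     (\<exists>t\<in>Bp p. Bp_eq p (Bp_mul s t) (\<lambda>_. qone) \<and> Bp_eq p (Bp_mul t s) (\<lambda>_. qone))"

definition ramified_at :: "nat \<Rightarrow> bool" where
  "ramified_at p \<longleftrightarrow> (\<forall>s\<in>Bp p. \<not> Bp_eq p s (\<lambda>_. 0) \<longrightarrow> Bp_unit p s)"

definition ramified_at_infinity :: bool where
  "ramified_at_infinity \<longleftrightarrow>
     (\<forall>x. x \<noteq> 0 \<longrightarrow>
       (\<exists>y. qmul (of_rat u :: real) (of_rat v) x y = qone \<and>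
            qmul (of_rat u) (of_rat v) y x = qone))"

definition Bp_order :: "nat \<Rightarrow> (nat \<Rightarrow> rat quat) set \<Rightarrow> bool" where
  "Bp_order p X \<longleftrightarrow> Bp_lattice p X \<and> (\<lambda>_. qone) \<in> X \<and> (\<forall>s\<in>X. \<forall>t\<in>X. Bp_mul s t \<in> X)"

definition Bp_maximal_order :: "nat \<Rightarrow> (nat \<Rightarrow> rat quat) set \<Rightarrow> bool" where
  "Bp_maximal_order p X \<longleftrightarrow> Bp_order p X \<and> (\<forall>Y. Bp_order p Y \<and> X \<subseteq> Y \<longrightarrow> Y = X)"

text \<open>An Eichler order in \<open>B\<^sub>p\<close> (an intersection of two maximal orders) of index \<open>p\<close> in a maximal
  order.\<close>

definition Bp_eichler_order :: "nat \<Rightarrow> (nat \<Rightarrow> rat quat) set \<Rightarrow> bool" where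
  "Bp_eichler_order p X \<longleftrightarrow>
     (\<exists>Y Z. Bp_maximal_order p Y \<and> Bp_maximal_order p Z \<and> X = Y \<inter> Z \<and>
        card ((\<lambda>s. {t \<in> Y. (\<lambda>i. t i - s i) \<in> X}) ` Y) = p)"

definition quat_order :: "rat quat set \<Rightarrow> bool" where
  "quat_order R \<longleftrightarrow> quat_lattice R \<and> qone \<in> R \<and> (\<forall>x\<in>R. \<forall>y\<in>R. qmul u v x y \<in> R)"

definition left_ideal :: "rat quat set \<Rightarrow> rat quat set \<Rightarrow> bool" where
  "left_ideal R I \<longleftrightarrow> quat_lattice I \<and>
     (\<forall>p. prime p \<longrightarrow> (\<exists>a. Bp_unit p a \<and>
        localization p I = {s \<in> Bp p. \<exists>t\<in>localization p R. Bp_eq p s (Bp_mul t a)}))"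

definition ideal_equiv :: "rat quat set \<Rightarrow> rat quat set \<Rightarrow> bool" where
  "ideal_equiv I J \<longleftrightarrow>
     (\<exists>a. (\<exists>a'. qmul u v a a' = qone \<and> qmul u v a' a = qone) \<and> I = (\<lambda>x. qmul u v x a) ` J)"

definition right_order :: "rat quat set \<Rightarrow> rat quat set" where
  "right_order I = {a. \<forall>x\<in>I. qmul u v x a \<in> I}"

definition quat_units :: "rat quat set \<Rightarrow> rat quat set" where
  "quat_units R = {x \<in> R. \<exists>y\<in>R. qmul u v x y = qone \<and> qmul u v y x = qone}"

definition ideal_inverse :: "rat quat set \<Rightarrow> rat quat set" where
  "ideal_inverse I = {a. \<forall>x\<in>I. \<forall>y\<in>I. qmul u v (qmul u v x a) y \<in> I}"

definition ideal_mult :: "rat quat set \<Rightarrow> rat quat set \<Rightarrow> rat quat set" where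
  "ideal_mult I J = {\<Sum>w\<leftarrow>ws. qmul u v (fst w) (snd w) | ws. set ws \<subseteq> I \<times> J}"

definition ideal_norm :: "rat quat set \<Rightarrow> rat" where
  "ideal_norm I = (THE r. r > 0 \<and>
     range (\<lambda>m::int. of_int m * r) =
     {\<Sum>x\<leftarrow>xs. of_int (fst x) * qnorm u v (snd x) | xs :: (int \<times> rat quat) list. snd ` set xs \<subseteq> I})"

text \<open>\<open>B\<close> is definite and ramified exactly at \<open>S\<close> and infinity, \<open>R\<close> is an order of the required
  type, and \<open>I 0, \<dots>, I (H - 1)\<close> represent the left \<open>R\<close>-ideal classes.\<close>

definition quaternion_setup ::
  "nat \<Rightarrow> nat set \<Rightarrow> rat quat set \<Rightarrow> nat \<Rightarrow> (nat \<Rightarrow> rat quat set) \<Rightarrow> bool" where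
  "quaternion_setup N S R H I \<longleftrightarrow>
     u \<noteq> 0 \<and> v \<noteq> 0 \<and>
     ramified_at_infinity \<and> (\<forall>p. prime p \<longrightarrow> (ramified_at p \<longleftrightarrow> p \<in> S)) \<and>
     quat_order R \<and>
     (\<forall>p. prime p \<longrightarrow>
        (if p \<in> S \<or> \<not> p dvd N then Bp_maximal_order p (localization p R)
         else Bp_eichler_order p (localization p R))) \<and>
     (\<forall>i<H. left_ideal R (I i)) \<and>
     (\<forall>J. left_ideal R J \<longrightarrow> (\<exists>!i. i < H \<and> ideal_equiv J (I i)))"

text \<open>\<open>B(n)\<^sub>i\<^sub>j\<close>, so that \<open>t\<^sub>n [I\<^sub>i] = \<Sum>\<^sub>j B(n)\<^sub>i\<^sub>j [I\<^sub>j]\<close>.\<close>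

definition brandt :: "(nat \<Rightarrow> rat quat set) \<Rightarrow> nat \<Rightarrow> nat \<Rightarrow> nat \<Rightarrow> real" where
  "brandt I n i j =
     (let K = ideal_mult (ideal_inverse (I j)) (I i) in
      real (card {x \<in> K. qnorm u v x = of_nat n * ideal_norm K}) /
      real (card (quat_units (right_order (I j)))))"

text \<open>The vector \<open>\<Sum>\<^sub>i x\<^sub>i [I\<^sub>i]\<close> is nonzero and lies in the \<open>F\<close>-isotypical component.\<close>

definition isotypical ::
  "nat \<Rightarrow> (nat \<Rightarrow> complex) \<Rightarrow> nat \<Rightarrow> (nat \<Rightarrow> rat quat set) \<Rightarrow> (nat \<Rightarrow> real) \<Rightarrow> bool" where
  "isotypical N b H I x \<longleftrightarrow> (\<exists>i<H. x i \<noteq> 0) \<and>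
     (\<forall>p. prime p \<and> \<not> p dvd N \<longrightarrow>
        (\<forall>j<H. of_real (\<Sum>i<H. x i * brandt I p i j) = b p * of_real (x j)))"

definition ternary_lattice :: "rat quat set \<Rightarrow> rat quat set" where
  "ternary_lattice I =
     {qscale (of_int m) qone + qscale 2 y | (m::int) y. y \<in> right_order I} \<inter> {x. qtrace x = 0}"

definition ternary_theta :: "rat quat set \<Rightarrow> (rat quat \<Rightarrow> complex) \<Rightarrow> nat \<Rightarrow> complex" where
  "ternary_theta I P n = (\<Sum>x\<in>{x \<in> ternary_lattice I. qnorm u v x = of_nat n}. P x)"

text \<open>\<open>P\<close> is a homogeneous polynomial of degree \<open>l\<close> in the coordinates of trace-zero quaternions,
  on which \<open>N = - u x\<^sub>1\<^sup>2 - v x\<^sub>2\<^sup>2 + u v x\<^sub>3\<^sup>2\<close>; \<open>c e\<^sub>1 e\<^sub>2 e\<^sub>3\<close> is the coefficient of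
  \<open>x\<^sub>1\<^bsup>e\<^sub>1\<^esup> x\<^sub>2\<^bsup>e\<^sub>2\<^esup> x\<^sub>3\<^bsup>e\<^sub>3\<^esup>\<close>. The last condition says, coefficient by coefficient, that \<open>P\<close> is killed by
  the Laplacian \<open>-u\<^sup>-\<^sup>1 \<partial>\<^sub>1\<^sup>2 - v\<^sup>-\<^sup>1 \<partial>\<^sub>2\<^sup>2 + (u v)\<^sup>-\<^sup>1 \<partial>\<^sub>3\<^sup>2\<close> of \<open>N\<close>.\<close>

definition harmonic_polynomial :: "nat \<Rightarrow> (rat quat \<Rightarrow> complex) \<Rightarrow> bool" where
  "harmonic_polynomial l P \<longleftrightarrow> (\<exists>c :: nat \<Rightarrow> nat \<Rightarrow> nat \<Rightarrow> complex.
     (\<forall>x0 x1 x2 x3. P (x0, x1, x2, x3) =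
        (\<Sum>(e1, e2, e3)\<in>{(e1, e2, e3). e1 + e2 + e3 = l}.
           c e1 e2 e3 * of_rat x1 ^ e1 * of_rat x2 ^ e2 * of_rat x3 ^ e3)) \<and>
     (\<forall>e1 e2 e3. e1 + e2 + e3 + 2 = l \<longrightarrow>
        - of_nat ((e1 + 2) * (e1 + 1)) * c (e1 + 2) e2 e3 / of_rat u
        - of_nat ((e2 + 2) * (e2 + 1)) * c e1 (e2 + 2) e3 / of_rat v
        + of_nat ((e3 + 2) * (e3 + 1)) * c e1 e2 (e3 + 2) / of_rat (u * v) = 0))"

text \<open>How \<open>g\<close> arises. For \<open>k = 3\<close> it is \<open>g(I\<^sub>F)\<close>. In general, harmonic polynomials form a vector
  space, so a linear combination needs only one polynomial for each \<open>I\<^sub>i\<close>.\<close>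

definition theta_construction ::
  "nat \<Rightarrow> nat \<Rightarrow> (nat \<Rightarrow> complex) \<Rightarrow> nat \<Rightarrow> (nat \<Rightarrow> rat quat set) \<Rightarrow> (nat \<Rightarrow> complex) \<Rightarrow> bool" where
  "theta_construction k N b H I g \<longleftrightarrow>
     (if k = 3 then
        (\<exists>x. isotypical N b H I x \<and>
             g = (\<lambda>n. \<Sum>i<H. of_real (x i) * (1 / 2 * ternary_theta (I i) (\<lambda>_. 1) n)))
      else
        (\<exists>P. (\<forall>i<H. harmonic_polynomial ((k - 3) div 2) (P i)) \<and>
             g = (\<lambda>n. \<Sum>i<H. ternary_theta (I i) (P i) n)))"

end

section \<open>Waldspurger's function\<close>

text \<open>In the local functions \<open>n = w p\<^bsup>2h\<^esup>\<close> with \<open>v\<^sub>p(w) \<in> {0, 1}\<close>.\<close>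

definition loc_h :: "nat \<Rightarrow> nat \<Rightarrow> nat" where
  "loc_h p n = multiplicity p n div 2"

definition loc_u :: "nat \<Rightarrow> nat \<Rightarrow> nat" where
  "loc_u p n = n div p ^ (2 * loc_h p n)"

definition c2' :: "complex \<Rightarrow> nat \<Rightarrow> complex" where
  "c2' \<delta> n =
     (let h = loc_h 2 n; w = loc_u 2 n in
      if multiplicity 2 w = 0 \<and> hilbert_symbol 2 (of_nat w) (-1) = -1
      then \<delta> ^ h * (\<delta> - of_real (2 powr (-1 / 2)) * of_int (hilbert_symbol 2 2 (of_nat w)))
      else \<delta> ^ h)"

fun c2'' :: "complex \<Rightarrow> nat \<Rightarrow> complex" where
  "c2'' \<delta> n =
     (if n = 0 then 0
      else if multiplicity 2 n = 0 then
        (if hilbert_symbol 2 (of_nat n) (-1) = -1 then \<delta> else 0)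
      else if multiplicity 2 n = 1 then 0
      else \<delta> * (c2'' \<delta> (n div 4) + c2' \<delta> (n div 4)))"

declare c2''.simps [simp del]

definition cs :: "nat \<Rightarrow> complex \<Rightarrow> nat \<Rightarrow> complex" where
  "cs p \<delta> n =
     (let h = loc_h p n; w = loc_u p n in
      if multiplicity p w = 1 then \<delta> ^ h
      else if of_int (Legendre (- int w) (int p)) = - of_real (sqrt (real p)) * \<delta>
      then of_real (sqrt 2) * \<delta> ^ h
      else 0)"

definition loc_beta :: "complex \<Rightarrow> nat \<Rightarrow> complex" where
  "loc_beta \<delta> h = 1 / 2 ^ h *
     (\<Sum>i=0..h div 2. of_nat ((h + 1) choose (2 * i + 1)) * \<delta> ^ (h - 2 * i) * (\<delta>\<^sup>2 - 4) ^ i)"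

definition c0 :: "nat \<Rightarrow> complex \<Rightarrow> nat \<Rightarrow> complex" where
  "c0 p \<delta> n =
     (let h = loc_h p n; w = loc_u p n in
      if multiplicity p w = 0 \<and> h = 0 then 1
      else if multiplicity p w = 0 then
        loc_beta \<delta> h -
        loc_beta \<delta> (h - 1) * of_int (Legendre (- int w) (int p)) * of_real (real p powr (-1 / 2))
      else loc_beta \<delta> h)"

text \<open>\<open>\<lambda>\<^sub>p\<close> for \<open>p \<nmid> N\<close> and \<open>\<lambda>\<^sub>p'\<close> for \<open>p | N\<close>.\<close>

definition hecke_param :: "nat \<Rightarrow> (nat \<Rightarrow> complex) \<Rightarrow> nat \<Rightarrow> complex" where
  "hecke_param k b p = b p * of_real (real p powr (1 - real k / 2))"

text \<open>The second product runs over \<open>p | n\<close> only; all other factors are \<open>1\<close>.\<close>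

definition C_product :: "nat \<Rightarrow> nat \<Rightarrow> (nat \<Rightarrow> complex) \<Rightarrow> nat \<Rightarrow> complex" where
  "C_product k N b n =
     (\<Prod>p\<in>{p. prime p \<and> p dvd N}. cs p (hecke_param k b p) n) *
     (\<Prod>p\<in>{p. prime p \<and> \<not> p dvd 2 * N \<and> p dvd n}. c0 p (hecke_param k b p) n)"

text \<open>The coefficients of \<open>f(c, A)\<close>, where \<open>c\<close> has component \<open>c2\<close> at \<open>2\<close>.\<close>

definition wald_form ::
  "nat \<Rightarrow> nat \<Rightarrow> (nat \<Rightarrow> complex) \<Rightarrow> (nat \<Rightarrow> complex) \<Rightarrow> (nat \<Rightarrow> complex) \<Rightarrow> nat \<Rightarrow> complex" where
  "wald_form k N b c2 A n =
     (if n = 0 then 0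
      else A (squarefree_part n) * of_real (real n powr ((real k - 2) / 4)) * c2 n *
           C_product k N b n)"

definition is_basis_pair ::
  "(nat \<Rightarrow> complex) set \<Rightarrow> (nat \<Rightarrow> complex) \<Rightarrow> (nat \<Rightarrow> complex) \<Rightarrow> bool" where
  "is_basis_pair V f1 f2 \<longleftrightarrow> f1 \<in> V \<and> f2 \<in> V \<and>
     (\<forall>x y. (\<forall>n. x * f1 n + y * f2 n = 0) \<longrightarrow> x = 0 \<and> y = 0) \<and>
     (\<forall>f\<in>V. \<exists>x y. \<forall>n. f n = x * f1 n + y * f2 n)"

text \<open>Here \<open>\<alpha>\<close>, \<open>\<alpha>'\<close> are \<open>\<alpha>\<^sub>2\<close>, \<open>\<alpha>\<^sub>2'\<close>. Only the values of \<open>A\<close> at square-free numbers matter.\<close>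

definition waldspurger_function ::
  "nat \<Rightarrow> nat \<Rightarrow> (nat \<Rightarrow> complex) \<Rightarrow> complex \<Rightarrow> complex \<Rightarrow> (nat \<Rightarrow> complex) \<Rightarrow> bool" where
  "waldspurger_function k N b \<alpha> \<alpha>' A \<longleftrightarrow>
     (\<forall>t. t > 0 \<and> squarefree t \<longrightarrow>
        (let \<nu> = (\<lambda>n. inverse (chi0 k n) * quadratic_char t n) in
         \<exists>M c. twisted_newform (k - 1) b \<nu> M c \<and>
               (A t)\<^sup>2 = newform_L k M c (1 / 2) * epsilon_factor \<nu> (1 / 2))) \<and>
     (if \<alpha> \<noteq> \<alpha>'
      then is_basis_pair (shimura_space k N b)
             (wald_form k N b (c2' \<alpha>) A) (wald_form k N b (c2' \<alpha>') A)
      else is_basis_pair (shimura_space k N b)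
             (wald_form k N b (c2' \<alpha>) A) (wald_form k N b (c2'' \<alpha>) A))"

end

theory Submission
  imports Defs "HOL-Real_Asymp.Real_Asymp"
begin

text \<open>
  Let \<open>f\<^sub>1, f\<^sub>2\<close> be Waldspurger's basis and \<open>g = x f\<^sub>1 + y f\<^sub>2\<close>. At \<open>n \<equiv> 1, 2 (mod 4)\<close> the local
  functions at \<open>2\<close> are \<open>1, 1\<close> if \<open>\<alpha> \<noteq> \<alpha>'\<close> and \<open>1, 0\<close> if \<open>\<alpha> = \<alpha>'\<close>, so if some such coefficient
  \<open>f\<^sub>1(n)\<close> is nonzero, the Kohnen condition gives \<open>y = -x\<close>, respectively \<open>x = 0\<close>. At \<open>n = |\<Delta>\<^bsub>-t\<^esub>|\<close> the
  remaining combination of local functions is the constant \<open>x (\<alpha> - \<alpha>')\<close>, respectively \<open>y \<alpha>\<close>.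

  Otherwise \<open>f\<^sub>1\<close> (and \<open>f\<^sub>2\<close> if \<open>\<alpha> \<noteq> \<alpha>'\<close>) is a \<open>U\<^sub>4\<close>-eigenform whose exponents are all
  \<open>0, 3 (mod 4)\<close>. Then the span of \<open>f(z)\<close> and \<open>f(z/4)\<close> is stable under translations and under the
  weight \<open>k/2\<close> action of the matrix with rows \<open>(1, 0)\<close>, \<open>(N, 1)\<close>. Comparing norms in the action on
  this plane of an element of \<open>\<Gamma>\<^sub>0(N)\<close> which behaves at \<open>2\<close> like \<open>z \<mapsto> -1/z\<close> gives \<open>|\<alpha>| = \<surd>2\<close>,
  and likewise \<open>|\<alpha>'| = \<surd>2\<close>. This contradicts \<open>\<alpha> \<alpha>' = 1\<close>.

  The multiplier of \<open>\<theta>\<close> is needed only up to a constant. Its source \<open>\<theta>(-1/4z)\<^sup>2 = K z \<theta>(z)\<^sup>2\<close> is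
  obtained on the imaginary axis by Polya's method: sum the even powers of \<open>2 cos(\<pi>j/l)\<close> over
  \<open>j mod l\<close> and let the exponent \<open>2m\<close> and \<open>l \<approx> \<surd>(mt)\<close> tend to infinity together.
\<close>

section \<open>The Hilbert symbol at 2\<close>

text \<open>Modulo 4 the form is the sum of three squares, since \<open>- t\<close> is 1 there, and
  squares are 0 or 1; the sum vanishes only if all three variables are even. Dividing them by 2
  divides the form by 4.\<close>

lemma ternary_descent:
  fixes x y z t :: int
  assumes t: "t mod 4 = 3" and "4 ^ m dvd y\<^sup>2 + z\<^sup>2 - t * x\<^sup>2"
  shows "2 ^ m dvd x \<and> 2 ^ m dvd y \<and> 2 ^ m dvd z"
  using assms(2)
proof (induction m arbitrary: x y z)
  case 0
  then show ?case by simp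
next
  case (Suc m)
  have sq: "w\<^sup>2 mod 4 = (if even w then 0 else 1)" for w :: int
  proof (cases "even w")
    case True
    then show ?thesis by (auto elim!: evenE simp: power2_eq_square)
  next
    case False
    then obtain v where "w = 2 * v + 1" by (elim oddE)
    then have "w\<^sup>2 = 4 * (v\<^sup>2 + v) + 1" by (simp add: power2_eq_square algebra_simps)
    with False show ?thesis by presburger
  qed
  have "4 dvd y\<^sup>2 + z\<^sup>2 - t * x\<^sup>2" using Suc.prems by (metis dvd_mult_left power_Suc)
  then have "(y\<^sup>2 + z\<^sup>2 - t * x\<^sup>2) mod 4 = 0" by presburger
  moreover have "(y\<^sup>2 + z\<^sup>2 - t * x\<^sup>2) mod 4 =
      ((y\<^sup>2 mod 4 + z\<^sup>2 mod 4) mod 4 - ((t mod 4) * (x\<^sup>2 mod 4)) mod 4) mod 4"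
    by (simp only: mod_add_eq mod_diff_eq mod_mult_eq)
  ultimately have "((y\<^sup>2 mod 4 + z\<^sup>2 mod 4) mod 4 - ((t mod 4) * (x\<^sup>2 mod 4)) mod 4) mod 4 = 0"
    by (simp only:)
  then have "even x \<and> even y \<and> even z"
    unfolding sq t by (cases "even x"; cases "even y"; cases "even z") simp_all
  then obtain x' y' z' where e: "x = 2 * x'" "y = 2 * y'" "z = 2 * z'"
    by (metis dvdE)
  have "y\<^sup>2 + z\<^sup>2 - t * x\<^sup>2 = 4 * (y'\<^sup>2 + z'\<^sup>2 - t * x'\<^sup>2)"
    by (simp add: e power2_eq_square algebra_simps)
  then have "4 ^ m dvd y'\<^sup>2 + z'\<^sup>2 - t * x'\<^sup>2"
    using Suc.prems by (simp only: power_Suc dvd_times_left_cancel_iff)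
  from Suc.IH[OF this] show ?case by (simp add: e)
qed

lemma rat_common_denominator:
  fixes x y z :: rat
  obtains d X Y Z :: int
  where "d > 0" "x = of_int X / of_int d" "y = of_int Y / of_int d" "z = of_int Z / of_int d"
proof -
  obtain a b where x: "x = of_int a / of_int b" "b > 0"
    by (metis Fract_of_int_quotient Rat_cases)
  obtain c d where y: "y = of_int c / of_int d" "d > 0"
    by (metis Fract_of_int_quotient Rat_cases)
  obtain e f where z: "z = of_int e / of_int f" "f > 0"
    by (metis Fract_of_int_quotient Rat_cases)
  show ?thesis
    by (rule that[of "b * d * f" "a * d * f" "c * b * f" "e * b * d"]) (use x y z in auto)
qed

text \<open>This is the anisotropy of the form over the 2-adic numbers in quantitative shape: a
  value of valuation at least \<open>2 * m\<close> forces coordinates of valuation at least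
  \<open>m\<close>.\<close>

lemma padic_small_ternary:
  fixes x y z :: rat and t :: int
  assumes t: "t mod 4 = 3" and sm: "padic_small 2 (2 * m) (y\<^sup>2 + z\<^sup>2 - of_int t * x\<^sup>2)"
  shows "padic_small 2 m x \<and> padic_small 2 m y \<and> padic_small 2 m z"
proof -
  obtain d X Y Z where d: "d > 0" and xyz: "x = of_int X / of_int d" "y = of_int Y / of_int d"
      "z = of_int Z / of_int d"
    using rat_common_denominator by blast
  \<comment> \<open>The 2-part \<open>2 ^ e\<close> of the common denominator may be nontrivial.
    Clearing it raises the exponent in the descent to \<open>m + e\<close>, and dividing by it
    afterwards leaves \<open>m\<close>.\<close>
  define e where "e = multiplicity 2 d"
  have dz: "of_int d \<noteq> (0::rat)" using d by simp
  obtain d' where d': "d = 2 ^ e * d'" "odd d'"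
    by (rule multiplicity_decompose'[of d 2]) (use d in \<open>auto simp: e_def\<close>)
  obtain u v :: int where uv: "odd v"
      "y\<^sup>2 + z\<^sup>2 - of_int t * x\<^sup>2 = of_int (2 ^ (2 * m) * u) / of_int v"
    using sm unfolding padic_small_def by auto
  have vz: "of_int v \<noteq> (0::rat)" using uv(1) by auto
  have a: "(y\<^sup>2 + z\<^sup>2 - of_int t * x\<^sup>2) * (of_int d)\<^sup>2 = of_int (Y\<^sup>2 + Z\<^sup>2 - t * X\<^sup>2)"
    using dz by (simp add: xyz field_simps power2_eq_square)
  have b: "(y\<^sup>2 + z\<^sup>2 - of_int t * x\<^sup>2) * of_int v = of_int (2 ^ (2 * m) * u)"
    using vz uv(2) by simp
  have "of_int v * of_int (Y\<^sup>2 + Z\<^sup>2 - t * X\<^sup>2) =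
      (of_int (2 ^ (2 * m) * u) * (of_int d)\<^sup>2 :: rat)"
    unfolding a[symmetric] b[symmetric] by (simp only: mult_ac)
  then have "of_int (v * (Y\<^sup>2 + Z\<^sup>2 - t * X\<^sup>2)) = (of_int (2 ^ (2 * m) * u * d\<^sup>2) :: rat)"
    by (simp only: of_int_mult of_int_power)
  then have eq: "v * (Y\<^sup>2 + Z\<^sup>2 - t * X\<^sup>2) = 2 ^ (2 * m) * u * d\<^sup>2"
    using of_int_eq_iff by blast
  have "(2::int) ^ (2 * m) * u * d\<^sup>2 = 4 ^ (m + e) * (u * d'\<^sup>2)"
  proof -
    have "(2::int) ^ (2 * m) = 4 ^ m" by (simp add: power_mult)
    moreover have "((2::int) ^ e)\<^sup>2 = 4 ^ e" by (simp add: power2_eq_square flip: power_mult_distrib)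
    ultimately show ?thesis by (simp add: d' power_mult_distrib power_add)
  qed
  then have "4 ^ (m + e) dvd v * (Y\<^sup>2 + Z\<^sup>2 - t * X\<^sup>2)"
    unfolding eq by (rule ssubst) (rule dvd_triv_left)
  moreover have "coprime (4 ^ (m + e)) v"
  proof -
    have "coprime (2 ^ (2 * (m + e))) v" using uv(1) by simp
    then show ?thesis unfolding power_mult by simp
  qed
  ultimately have "4 ^ (m + e) dvd Y\<^sup>2 + Z\<^sup>2 - t * X\<^sup>2"
    using coprime_dvd_mult_right_iff by blast
  then have dv: "2 ^ (m + e) dvd X" "2 ^ (m + e) dvd Y" "2 ^ (m + e) dvd Z"
    using ternary_descent[OF t] by auto
  have "padic_small 2 m (of_int W / of_int d)" if W: "2 ^ (m + e) dvd W" for W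
  proof -
    from W obtain W' where "W = 2 ^ (m + e) * W'" by blast
    then have "(of_int W :: rat) / of_int d = of_int (int 2 ^ m * W') / of_int d'"
      by (simp add: d' power_add)
    then show ?thesis unfolding padic_small_def using d'(2) by force
  qed
  with dv show ?thesis by (simp add: xyz)
qed

text \<open>If the values of the form tend to 0, so do all three coordinates, so no nontrivial zero
  exists.\<close>

lemma hilbert_symbol_3_mod_4:
  fixes w :: nat
  assumes "w mod 4 = 3"
  shows "hilbert_symbol 2 (of_nat w) (-1) = -1"
proof -
  have t: "int w mod 4 = 3" using assms by presburger
  have "padic_null 2 x \<and> padic_null 2 y \<and> padic_null 2 z"
    if "padic_null 2 (\<lambda>i. (z i)\<^sup>2 - of_nat w * (x i)\<^sup>2 - (-1) * (y i)\<^sup>2)" for x y z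
  proof -
    have "eventually (\<lambda>i. padic_small 2 m (x i) \<and> padic_small 2 m (y i) \<and> padic_small 2 m (z i))
        sequentially" for m
    proof -
      have "eventually (\<lambda>i. padic_small 2 (2 * m) ((z i)\<^sup>2 - of_nat w * (x i)\<^sup>2 - (-1) * (y i)\<^sup>2))
          sequentially"
        using that unfolding padic_null_def by blast
      then show ?thesis
      proof (rule eventually_mono)
        fix i
        assume "padic_small 2 (2 * m) ((z i)\<^sup>2 - of_nat w * (x i)\<^sup>2 - (-1) * (y i)\<^sup>2)"
        then have "padic_small 2 (2 * m) ((y i)\<^sup>2 + (z i)\<^sup>2 - of_int (int w) * (x i)\<^sup>2)"
          by (simp add: algebra_simps)
        from padic_small_ternary[OF t this]
        show "padic_small 2 m (x i) \<and> padic_small 2 m (y i) \<and> padic_small 2 m (z i)" .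
      qed
    qed
    then show ?thesis unfolding padic_null_def by (auto simp: eventually_conj_iff)
  qed
  then have "\<not> (\<exists>x y z. padic_Cauchy 2 x \<and> padic_Cauchy 2 y \<and> padic_Cauchy 2 z \<and>
      \<not> (padic_null 2 x \<and> padic_null 2 y \<and> padic_null 2 z) \<and>
      padic_null 2 (\<lambda>i. (z i)\<^sup>2 - of_nat w * (x i)\<^sup>2 - (-1) * (y i)\<^sup>2))"
    by blast
  then show ?thesis unfolding hilbert_symbol_def by (rule if_not_P)
qed

text \<open>Hensel lifting at the prime 2, where the derivative of the square is even: an
  approximation modulo \<open>2 ^ (i + 2)\<close> already fixes the square modulo
  \<open>2 ^ (i + 3)\<close>. The construction starts with 1, as \<open>t\<close> is 1 modulo
  8.\<close>

lemma two_adic_sqrt: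
  fixes t :: int
  assumes "t mod 8 = 1"
  obtains s :: "nat \<Rightarrow> int"
  where "\<And>i. 2 ^ i dvd (s i)\<^sup>2 - t" "\<And>i. 2 ^ i dvd s (Suc i) - s i"
proof -
  have "\<exists>s. \<forall>i. (odd (s i) \<and> 2 ^ (i + 3) dvd (s i)\<^sup>2 - t) \<and> 2 ^ (i + 2) dvd s (Suc i) - s i"
  proof (rule dependent_nat_choice)
    have "8 dvd 1 - t" using assms by presburger
    then show "\<exists>s. odd s \<and> 2 ^ (0 + 3) dvd s\<^sup>2 - t"
      by (intro exI[of _ 1]) auto
  next
    fix s :: int and i
    assume s: "odd s \<and> 2 ^ (i + 3) dvd s\<^sup>2 - t"
    then obtain c where c: "s\<^sup>2 - t = 2 ^ (i + 3) * c" by blast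
    show "\<exists>s'. (odd s' \<and> 2 ^ (Suc i + 3) dvd s'\<^sup>2 - t) \<and> 2 ^ (i + 2) dvd s' - s"
    proof (cases "even c")
      case True
      then have "2 ^ (Suc i + 3) dvd s\<^sup>2 - t" using c by (auto elim!: evenE simp: power_add)
      then show ?thesis using s by (intro exI[of _ s]) auto
    next
      case False
      \<comment> \<open>The correction changes the square by \<open>2 ^ (i + 3) * s\<close> up to
        higher powers. Since \<open>s\<close> and \<open>c\<close> are odd, \<open>c + s\<close> is
        even and one more power of 2 is gained.\<close>
      have "(s + 2 ^ (i + 2))\<^sup>2 - t = 2 ^ (i + 3) * (c + s) + 2 ^ (Suc i + 3) * 2 ^ i"
        using c by (simp add: power2_eq_square algebra_simps power_add)
      moreover have "2 ^ (Suc i + 3) dvd 2 ^ (i + 3) * (c + s)"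
      proof -
        have "even (c + s)" using False s by simp
        then obtain r where "c + s = 2 * r" by (elim evenE)
        then show ?thesis by (simp add: power_add)
      qed
      ultimately have "2 ^ (Suc i + 3) dvd (s + 2 ^ (i + 2))\<^sup>2 - t" by simp
      then show ?thesis using s by (intro exI[of _ "s + 2 ^ (i + 2)"]) auto
    qed
  qed
  then obtain s where s: "\<And>i. 2 ^ (i + 3) dvd (s i)\<^sup>2 - t" "\<And>i. 2 ^ (i + 2) dvd s (Suc i) - s i"
    by blast
  show ?thesis
    by (rule that[of s]) (metis s le_imp_power_dvd dvd_trans le_add1)+
qed

lemma padic_small_of_int:
  assumes "p > 1" and "int p ^ m dvd a"
  shows "padic_small p m (of_int a)"
proof -
  from assms obtain c where "a = int p ^ m * c" by blast
  moreover have "\<not> int p dvd 1" using assms(1) by simp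
  ultimately show ?thesis unfolding padic_small_def by (intro exI[of _ c] exI[of _ 1]) auto
qed

lemma padic_Cauchy_const: "p > 1 \<Longrightarrow> padic_Cauchy p (\<lambda>_. c)"
  unfolding padic_Cauchy_def using padic_small_of_int[of p _ 0] by simp

lemma not_padic_null_1: "p > 1 \<Longrightarrow> \<not> padic_null p (\<lambda>_. 1)"
proof
  assume p: "p > 1" and "padic_null p (\<lambda>_. 1)"
  then have "padic_small p 1 1" unfolding padic_null_def by (auto dest!: spec[of _ 1])
  then obtain u v :: int where "\<not> int p dvd v" "(1::rat) = of_int (int p * u) / of_int v"
    unfolding padic_small_def by auto
  moreover then have "v \<noteq> 0" by auto
  ultimately have "(of_int v :: rat) = of_int (int p * u)" by (simp add: field_simps)
  then have "v = int p * u" using of_int_eq_iff by blast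
  with \<open>\<not> int p dvd v\<close> show False by simp
qed

lemma hilbert_symbol_1_mod_4:
  fixes w :: nat
  assumes "w mod 4 = 1"
  shows "hilbert_symbol 2 (of_nat w) (-1) = 1"
proof -
  \<comment> \<open>The zero has first coordinate 1, so \<open>w - y\<^sup>2\<close> must be a
    2-adic square. Subtracting 0 or 4 brings \<open>w\<close> to 1 modulo 8.\<close>
  define y :: int where "y = (if w mod 8 = 1 then 0 else 2)"
  have "(int w - y\<^sup>2) mod 8 = 1"
  proof -
    have "w mod 8 = 1 \<or> w mod 8 = 5" using assms by presburger
    then show ?thesis unfolding y_def by (auto; presburger)
  qed
  then obtain s :: "nat \<Rightarrow> int" where s: "\<And>i. 2 ^ i dvd (s i)\<^sup>2 - (int w - y\<^sup>2)"
      "\<And>i. 2 ^ i dvd s (Suc i) - s i"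
    using two_adic_sqrt by blast
  have step: "2 ^ m dvd s (m + j) - s m" for m j
  proof (induction j)
    case (Suc j)
    have "2 ^ m dvd s (Suc (m + j)) - s (m + j)"
      using s(2)[of "m + j"] by (metis dvd_trans le_add1 le_imp_power_dvd)
    from dvd_add[OF this Suc] show ?case by simp
  qed simp
  have "padic_Cauchy 2 (\<lambda>i. of_int (s i))"
    unfolding padic_Cauchy_def
  proof (intro allI exI impI)
    fix m i j :: nat
    assume "m \<le> i" "m \<le> j"
    then have "2 ^ m dvd (s i - s m) - (s j - s m)"
      using step[of m "i - m"] step[of m "j - m"] by (metis dvd_diff le_add_diff_inverse)
    then show "padic_small 2 m (of_int (s i) - of_int (s j))"
      using padic_small_of_int[of 2 m "s i - s j"] by simp
  qed
  moreover have "padic_null 2 (\<lambda>i. (of_int (s i))\<^sup>2 - of_nat w * 1\<^sup>2 - (-1) * (of_int y)\<^sup>2)"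
    unfolding padic_null_def
  proof
    fix m
    show "eventually (\<lambda>i. padic_small 2 m ((of_int (s i))\<^sup>2 - of_nat w * 1\<^sup>2 - (-1) * (of_int y)\<^sup>2))
        sequentially"
      using eventually_ge_at_top[of m]
    proof eventually_elim
      case (elim i)
      have "2 ^ m dvd (s i)\<^sup>2 - (int w - y\<^sup>2)"
        using s(1)[of i] elim by (metis dvd_trans le_imp_power_dvd)
      then show ?case
        using padic_small_of_int[of 2 m "(s i)\<^sup>2 - (int w - y\<^sup>2)"] by (simp add: algebra_simps)
    qed
  qed
  ultimately have "\<exists>x y z. padic_Cauchy 2 x \<and> padic_Cauchy 2 y \<and> padic_Cauchy 2 z \<and>
      \<not> (padic_null 2 x \<and> padic_null 2 y \<and> padic_null 2 z) \<and>
      padic_null 2 (\<lambda>i. (z i)\<^sup>2 - of_nat w * (x i)\<^sup>2 - (-1) * (y i)\<^sup>2)"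
    using not_padic_null_1[of 2] padic_Cauchy_const[of 2]
    by (intro exI[of _ "\<lambda>_. 1"] exI[of _ "\<lambda>_. of_int y"] exI[of _ "\<lambda>i. of_int (s i)"]) auto
  then show ?thesis unfolding hilbert_symbol_def by simp
qed

section \<open>Inversion of the theta function on the imaginary axis\<close>

lemma sum_roots_of_unity:
  fixes l :: nat and k :: int
  assumes "l > 0"
  shows "(\<Sum>j<l. cis (2 * pi * of_int k * real j / real l)) = (if int l dvd k then of_nat l else 0)"
proof -
  define w where "w = cis (2 * pi * of_int k / real l)"
  have pw: "cis (2 * pi * of_int k * real j / real l) = w ^ j" for j
    unfolding w_def Complex.DeMoivre by (rule arg_cong[where f = cis]) simp
  have w1: "w ^ l = 1"
    proof -
    have "w ^ l = cis (2 * pi * of_int k)"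
      using assms unfolding w_def Complex.DeMoivre by (intro arg_cong[where f = cis]) simp
    then show ?thesis by (simp add: cis_multiple_2pi)
  qed
  have "w = 1 \<longleftrightarrow> int l dvd k"
  proof
    assume "w = 1"
    then have "cos (2 * pi * of_int k / real l) = 1"
      unfolding w_def by (simp add: complex_eq_iff)
    then obtain n :: int where "2 * pi * of_int k / real l = of_int n * 2 * pi"
      using cos_one_2pi_int by blast
    then have "real_of_int k = of_int (n * int l)" using assms by (simp add: field_simps)
    then have "k = n * int l" using of_int_eq_iff by blast
    then show "int l dvd k" by simp
  next
    assume "int l dvd k"
    then obtain n where "k = int l * n" by blast
    then have "w = cis (2 * pi * of_int n)"
      using assms unfolding w_def by (intro arg_cong[where f = cis]) simp
    then show "w = 1" by (simp add: cis_multiple_2pi)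
  qed
  moreover have "(\<Sum>j<l. w ^ j) = (if w = 1 then of_nat l else 0)"
    using w1 by (simp add: geometric_sum)
  ultimately show ?thesis by (simp add: pw)
qed

text \<open>Writing the cosine by exponentials, the binomial expansion has the frequencies
  \<open>2 * (r - m)\<close>. Summation over \<open>j\<close> is a roots-of-unity filter that keeps
  the \<open>r\<close> congruent to \<open>m\<close> modulo \<open>l\<close>.\<close>

lemma sum_cos_power:
  assumes "l > 0"
  shows "(\<Sum>j<l. (2 * cos (pi * real j / real l)) ^ (2 * m)) =
    real l * (\<Sum>r\<le>2 * m. if int l dvd int r - int m then real (2 * m choose r) else 0)"
proof -
  have "complex_of_real ((2 * cos x) ^ (2 * m)) =
      (\<Sum>r\<le>2 * m. of_nat (2 * m choose r) * cis (2 * (real r - real m) * x))" for x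
  proof -
    have "complex_of_real (2 * cos x) = cis x + cis (- x)"
      by (simp add: complex_eq_iff)
    then have "complex_of_real ((2 * cos x) ^ (2 * m)) = (cis x + cis (- x)) ^ (2 * m)"
      by (simp only: of_real_power)
    also have "\<dots> = (\<Sum>r\<le>2 * m. of_nat (2 * m choose r) * cis x ^ r * cis (- x) ^ (2 * m - r))"
      by (rule binomial_ring)
    also have "\<dots> = (\<Sum>r\<le>2 * m. of_nat (2 * m choose r) * cis (2 * (real r - real m) * x))"
    proof (rule sum.cong[OF refl])
      fix r assume "r \<in> {..2 * m}"
      then have "real (2 * m - r) = 2 * real m - real r" by simp
      then have "cis x ^ r * cis (- x) ^ (2 * m - r) = cis (2 * (real r - real m) * x)"
        unfolding Complex.DeMoivre cis_mult by (intro arg_cong[where f = cis]) (simp add: algebra_simps)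
      then show "of_nat (2 * m choose r) * cis x ^ r * cis (- x) ^ (2 * m - r) =
          of_nat (2 * m choose r) * cis (2 * (real r - real m) * x)"
        by (simp add: mult.assoc)
    qed
    finally show ?thesis .
  qed
  then have "complex_of_real (\<Sum>j<l. (2 * cos (pi * real j / real l)) ^ (2 * m)) =
      (\<Sum>j<l. \<Sum>r\<le>2 * m. of_nat (2 * m choose r) * cis (2 * (real r - real m) * (pi * real j / real l)))"
    by (simp only: of_real_sum)
  also have "\<dots> = (\<Sum>r\<le>2 * m. of_nat (2 * m choose r) *
      (\<Sum>j<l. cis (2 * pi * of_int (int r - int m) * real j / real l)))"
    by (subst sum.swap) (simp add: sum_distrib_left mult_ac)
  also have "\<dots> = complex_of_real (real l *
      (\<Sum>r\<le>2 * m. if int l dvd int r - int m then real (2 * m choose r) else 0))"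
    unfolding sum_roots_of_unity[OF assms]
    by (simp add: sum_distrib_left if_distrib mult_ac cong: if_cong)
  finally show ?thesis using of_real_eq_iff by blast
qed

lemma sum_symmetric_interval:
  fixes h :: "nat \<Rightarrow> real"
  assumes "\<And>k. k \<le> m \<Longrightarrow> h (m - k) = h (m + k)"
  shows "(\<Sum>r\<le>2 * m. h r) = h m + 2 * (\<Sum>k<m. h (m + Suc k))"
proof -
  have eq: "{..2 * m} = {..<m} \<union> {m} \<union> {m<..2 * m}" by auto
  have "(\<Sum>r\<le>2 * m. h r) = (\<Sum>r<m. h r) + h m + (\<Sum>r\<in>{m<..2 * m}. h r)"
    unfolding eq by (subst sum.union_disjoint; (subst sum.union_disjoint)?) auto
  moreover have "(\<Sum>r<m. h r) = (\<Sum>k<m. h (m + Suc k))"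
  proof -
    have "(\<Sum>r<m. h r) = (\<Sum>k<m. h (m - Suc k))"
      by (rule sum.nat_diff_reindex[symmetric])
    also have "\<dots> = (\<Sum>k<m. h (m + Suc k))" 
    proof (rule sum.cong[OF refl])
      fix k assume "k \<in> {..<m}"
      then show "h (m - Suc k) = h (m + Suc k)" by (intro assms) simp
    qed
    finally show ?thesis .
  qed
  moreover have "(\<Sum>r\<in>{m<..2 * m}. h r) = (\<Sum>k<m. h (m + Suc k))"
    by (rule sum.reindex_bij_witness[of _ "\<lambda>k. m + Suc k" "\<lambda>r. r - Suc m"]) auto
  ultimately show ?thesis by simp
qed

text \<open>Both sides of \<open>sum_cos_power\<close> are folded: \<open>j\<close> and
  \<open>l - j\<close> have opposite cosines, and as \<open>l\<close> is odd only
  \<open>j = 0\<close> is left single; the binomials are symmetric about \<open>m\<close>. The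
  finite sums are written as infinite ones so that Tannery's theorem applies to them.\<close>

lemma polya_identity:
  fixes L m :: nat
  defines "l \<equiv> 2 * L + 1"
  shows "4 ^ m * (1 + 2 * (\<Sum>j. if j < L then cos (pi * real (Suc j) / real l) ^ (2 * m) else 0)) =
    real l * (real (2 * m choose m) + 2 * (\<Sum>\<nu>. real (2 * m choose (m + l * Suc \<nu>))))"
proof -
  have l: "l > 0" by (simp add: l_def)
  have fin: "(\<Sum>j. if j < L then cos (pi * real (Suc j) / real l) ^ (2 * m) else 0) =
      (\<Sum>j<L. cos (pi * real (Suc j) / real l) ^ (2 * m))"
    by (subst suminf_finite[of "{..<L}"]) auto
  have split: "{..<l} = {0} \<union> {1..L} \<union> {L + 1..2 * L}" by (auto simp: l_def)
  have refl_sum: "(\<Sum>j\<in>{L + 1..2 * L}. (2 * cos (pi * real j / real l)) ^ (2 * m)) =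
      (\<Sum>j\<in>{1..L}. (2 * cos (pi * real j / real l)) ^ (2 * m))"
  proof (rule sum.reindex_bij_witness[of _ "\<lambda>j. l - j" "\<lambda>j. l - j"])
    fix j assume "j \<in> {L + 1..2 * L}"
    then have "pi * real (l - j) / real l = pi - pi * real j / real l"
      by (auto simp: l_def of_nat_diff field_simps)
    then have c: "cos (pi * real (l - j) / real l) = - cos (pi * real j / real l)"
      by simp
    show "(2 * cos (pi * real (l - j) / real l)) ^ (2 * m) = (2 * cos (pi * real j / real l)) ^ (2 * m)"
      unfolding c by (simp add: power_mult)
  qed (auto simp: l_def)
  have "(\<Sum>j<l. (2 * cos (pi * real j / real l)) ^ (2 * m)) =
      (\<Sum>j\<in>{0}. (2 * cos (pi * real j / real l)) ^ (2 * m)) +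
      (\<Sum>j\<in>{1..L}. (2 * cos (pi * real j / real l)) ^ (2 * m)) +
      (\<Sum>j\<in>{L + 1..2 * L}. (2 * cos (pi * real j / real l)) ^ (2 * m))"
    unfolding split by (subst sum.union_disjoint; (subst sum.union_disjoint)?) auto
  also have "\<dots> = 4 ^ m + 2 * (\<Sum>j\<in>{1..L}. (2 * cos (pi * real j / real l)) ^ (2 * m))"
    unfolding refl_sum by (simp add: power_mult)
  also have "(\<Sum>j\<in>{1..L}. (2 * cos (pi * real j / real l)) ^ (2 * m)) =
      (\<Sum>j<L. 4 ^ m * cos (pi * real (Suc j) / real l) ^ (2 * m))"
    by (rule sum.reindex_bij_witness[of _ Suc "\<lambda>j. j - 1"]) (auto simp: power_mult power_mult_distrib)
  finally have lhs: "(\<Sum>j<l. (2 * cos (pi * real j / real l)) ^ (2 * m)) =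
      4 ^ m * (1 + 2 * (\<Sum>j<L. cos (pi * real (Suc j) / real l) ^ (2 * m)))"
    by (simp add: sum_distrib_left algebra_simps)
  define h where "h r = (if int l dvd int r - int m then real (2 * m choose r) else 0)" for r
  have "h (m - k) = h (m + k)" if "k \<le> m" for k
  proof -
    have "2 * m choose (m - k) = 2 * m choose (m + k)"
      using binomial_symmetric[of "m - k" "2 * m"] that by simp
    then show ?thesis using that by (simp add: h_def of_nat_diff)
  qed
  then have "(\<Sum>r\<le>2 * m. h r) = h m + 2 * (\<Sum>k<m. h (m + Suc k))"
    by (rule sum_symmetric_interval)
  also have "(\<Sum>k<m. h (m + Suc k)) = (\<Sum>k. h (m + Suc k))"
    by (rule suminf_finite[symmetric]) (auto simp: h_def)
  \<comment> \<open>Only those \<open>k\<close> contribute for which \<open>Suc k\<close> is a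
    positive multiple \<open>l * Suc \<nu>\<close>; the subtraction is exact because
    \<open>l > 0\<close>.\<close>
  also have "\<dots> = (\<Sum>\<nu>. h (m + Suc (l * Suc \<nu> - 1)))"
  proof (rule suminf_mono_reindex[symmetric])
    show "strict_mono (\<lambda>\<nu>. l * Suc \<nu> - 1)"
      by (rule strict_monoI_Suc) (use l in auto)
    fix k assume k: "k \<notin> range (\<lambda>\<nu>. l * Suc \<nu> - 1)"
    have "\<not> l dvd Suc k"
    proof
      assume "l dvd Suc k"
      then obtain c where c: "Suc k = l * c" by blast
      then obtain c' where "c = Suc c'" by (cases c) auto
      then have "k = l * Suc c' - 1" using c by simp
      with k show False by blast
    qed
    moreover have "int (m + Suc k) - int m = int (Suc k)" by simp
    ultimately have "\<not> int l dvd int (m + Suc k) - int m" by (simp only: int_dvd_int_iff not_False_eq_True)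
    then show "h (m + Suc k) = 0" by (simp add: h_def)
  qed
  also have "(\<lambda>\<nu>. h (m + Suc (l * Suc \<nu> - 1))) = (\<lambda>\<nu>. real (2 * m choose (m + l * Suc \<nu>)))"
  proof
    fix \<nu>
    have "Suc (l * Suc \<nu> - 1) = l * Suc \<nu>" using l by simp
    then show "h (m + Suc (l * Suc \<nu> - 1)) = real (2 * m choose (m + l * Suc \<nu>))"
      by (simp only: h_def) simp
  qed
  also have "h m = real (2 * m choose m)" by (simp add: h_def)
  finally show ?thesis
    unfolding fin using lhs sum_cos_power[OF l, of m] by (simp only: h_def)
qed

section \<open>Gaussian bounds for binomial coefficients and cosine powers\<close>

lemma central_binomial_step:
  assumes "k < m"
  shows "real (2 * m choose (m + Suc k)) = (real m - real k) / (real m + real k + 1) * real (2 * m choose (m + k))"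
proof -
  have "Suc (m + k) * (2 * m choose Suc (m + k)) = (2 * m - (m + k)) * (2 * m choose (m + k))"
    using binomial_absorption[of "m + k" "2 * m"] binomial_absorb_comp[of "2 * m" "m + k"] by simp
  moreover have "2 * m - (m + k) = m - k" by simp
  ultimately have "real (Suc (m + k)) * real (2 * m choose Suc (m + k)) = real (m - k) * real (2 * m choose (m + k))"
    by (simp only: flip: of_nat_mult)
  then show ?thesis using assms by (simp add: of_nat_diff field_simps)
qed

text \<open>Each quotient of neighbours is 1 minus \<open>(2 * k + 1) / (m + k + 1)\<close>, hence
  at most an exponential. With the common denominator \<open>m + K\<close> the odd numbers add up to
  \<open>k\<^sup>2\<close>.\<close>

lemma central_binomial_upper:
  assumes "k \<le> K" "K \<le> m" "m > 0"
  shows "real (2 * m choose (m + k)) \<le> real (2 * m choose m) * exp (- ((real k)\<^sup>2 / (real m + real K)))"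
  using assms(1)
proof (induction k)
  case 0
  then show ?case by simp
next
  case (Suc k)
  have "(real m - real k) / (real m + real k + 1) = 1 + - ((2 * real k + 1) / (real m + real k + 1))"
    by (simp add: field_simps)
  also have "\<dots> \<le> exp (- ((2 * real k + 1) / (real m + real k + 1)))"
    by (rule exp_ge_add_one_self)
  also have "\<dots> \<le> exp (- ((2 * real k + 1) / (real m + real K)))"
    using Suc.prems assms by (auto intro!: divide_left_mono)
  finally have "(real m - real k) / (real m + real k + 1) \<le> exp (- ((2 * real k + 1) / (real m + real K)))" .
  then have "real (2 * m choose (m + Suc k)) \<le> exp (- ((2 * real k + 1) / (real m + real K))) *
      (real (2 * m choose m) * exp (- ((real k)\<^sup>2 / (real m + real K))))"
    using Suc assms central_binomial_step[of k m] by (simp only:) (intro mult_mono; simp)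
  also have "\<dots> = real (2 * m choose m) * exp (- ((real (Suc k))\<^sup>2 / (real m + real K)))"
    by (simp add: mult_ac power2_eq_square algebra_simps add_divide_distrib flip: exp_add)
  finally show ?case .
qed

text \<open>The same telescoping for reciprocals: the inverse quotient is 1 plus
  \<open>(2 * k + 1) / (m - k)\<close>, and \<open>m - k\<close> is at least
  \<open>m + 1 - K\<close>.\<close>

lemma central_binomial_lower:
  assumes "k \<le> K" "K \<le> m" "m > 0"
  shows "real (2 * m choose (m + k)) \<ge> real (2 * m choose m) * exp (- ((real k)\<^sup>2 / (real m + 1 - real K)))"
  using assms(1)
proof (induction k)
  case 0
  then show ?case by simp
next
  case (Suc k)
  have pos: "real m - real k > 0" using Suc.prems assms by simp
  have "exp (- ((2 * real k + 1) / (real m + 1 - real K))) \<le> exp (- ((2 * real k + 1) / (real m - real k)))"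
    using Suc.prems assms by (auto intro!: divide_left_mono)
  also have "\<dots> = inverse (exp ((2 * real k + 1) / (real m - real k)))"
    by (rule exp_minus)
  also have "\<dots> \<le> inverse (1 + (2 * real k + 1) / (real m - real k))"
    using pos by (intro le_imp_inverse_le exp_ge_add_one_self) (simp add: add_pos_nonneg)
  also have "\<dots> = (real m - real k) / (real m + real k + 1)"
    using pos by (simp add: field_simps)
  finally have "exp (- ((2 * real k + 1) / (real m + 1 - real K))) \<le> (real m - real k) / (real m + real k + 1)" .
  then have "real (2 * m choose (m + Suc k)) \<ge> exp (- ((2 * real k + 1) / (real m + 1 - real K))) *
      (real (2 * m choose m) * exp (- ((real k)\<^sup>2 / (real m + 1 - real K))))"
    using Suc assms central_binomial_step[of k m] pos by (simp only:) (intro mult_mono; simp)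
  also have "exp (- ((2 * real k + 1) / (real m + 1 - real K))) *
      (real (2 * m choose m) * exp (- ((real k)\<^sup>2 / (real m + 1 - real K)))) =
      real (2 * m choose m) * exp (- ((real (Suc k))\<^sup>2 / (real m + 1 - real K)))"
    by (simp add: mult_ac power2_eq_square algebra_simps add_divide_distrib flip: exp_add)
  finally show ?case .
qed

text \<open>Taylor's bound gives an error of at most one sixth of the cube of \<open>x\<close>, and
  the square of \<open>x\<close> is below 3 on this interval.\<close>

lemma sin_ge_half:
  fixes x :: real
  assumes "0 \<le> x" "x \<le> pi / 2"
  shows "sin x \<ge> x / 2"
proof -
  have "x\<^sup>2 \<le> (pi / 2)\<^sup>2" using assms by (intro power_mono)
  also have "\<dots> \<le> (8 / 5)\<^sup>2" by (rule power_mono) (use pi_less_4 pi_approx in simp_all)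
  finally have x2: "x\<^sup>2 \<le> 3" by (simp add: power2_eq_square)
  have "\<bar>sin x - (\<Sum>m<3. sin_coeff m * x ^ m)\<bar> \<le> inverse (fact 3) * \<bar>x\<bar> ^ 3"
    by (rule Maclaurin_sin_bound)
  moreover have "(\<Sum>m<3. sin_coeff m * x ^ m) = x"
    by (simp add: sin_coeff_def numeral_eq_Suc)
  moreover have "\<bar>x\<bar> ^ 3 = x\<^sup>2 * x" using assms by (simp add: power2_eq_square numeral_eq_Suc)
  moreover have "inverse (fact 3) = (1 / 6 :: real)" by (simp add: fact_numeral)
  ultimately have "\<bar>sin x - x\<bar> \<le> 1 / 6 * (x\<^sup>2 * x)" by (simp only:)
  moreover have "x\<^sup>2 * x \<le> 3 * x" using x2 assms by (intro mult_right_mono)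
  ultimately show ?thesis by linarith
qed

text \<open>By \<open>sin_ge_half\<close> the squared cosine is at most
  \<open>1 - x\<^sup>2 / 4\<close>. The estimate supplies the dominating series for the cosine
  side.\<close>

lemma cos_power_le_exp:
  fixes x :: real
  assumes "0 \<le> x" "x \<le> pi / 2"
  shows "cos x ^ (2 * m) \<le> exp (- (real m * x\<^sup>2 / 4))"
proof -
  have "(x / 2)\<^sup>2 \<le> (sin x)\<^sup>2" using sin_ge_half[OF assms] assms by (intro power_mono) auto
  then have "(cos x)\<^sup>2 \<le> 1 + - (x\<^sup>2 / 4)" by (simp add: cos_squared_eq power_divide)
  also have "\<dots> \<le> exp (- (x\<^sup>2 / 4))" by (rule exp_ge_add_one_self)
  finally have "((cos x)\<^sup>2) ^ m \<le> exp (- (x\<^sup>2 / 4)) ^ m" by (intro power_mono) auto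
  moreover have "exp (- (x\<^sup>2 / 4)) ^ m = exp (- (real m * x\<^sup>2 / 4))"
    by (simp flip: exp_of_nat_mult)
  ultimately show ?thesis unfolding power_mult by simp
qed

text \<open>The sum of exp(-t n^2) over all integers n, that is, \<open>theta\<close> on the
  imaginary axis; see \<open>theta_imaginary_axis\<close>.\<close>

definition gauss_theta :: "real \<Rightarrow> real" where
  "gauss_theta t = 1 + 2 * (\<Sum>n. exp (- (t * (real (Suc n))\<^sup>2)))"

lemma summable_exp_neg_mult: "c > 0 \<Longrightarrow> summable (\<lambda>n. exp (- (c * real (Suc n))))"
proof -
  assume "c > 0"
  then have "summable (\<lambda>n. exp (- c) * exp (- c) ^ n)" by (intro summable_mult summable_geometric) simp
  moreover have "exp (- c) * exp (- c) ^ n = exp (- (c * real (Suc n)))" for n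
    by (simp add: algebra_simps flip: exp_of_nat_mult exp_add)
  ultimately show ?thesis by simp
qed

lemma exp_neg_square_le: "c > 0 \<Longrightarrow> exp (- (c * (real (Suc n))\<^sup>2)) \<le> exp (- (c * real (Suc n)))"
  by (simp add: power2_eq_square del: of_nat_Suc)

lemma summable_exp_neg_square: "c > 0 \<Longrightarrow> summable (\<lambda>n. exp (- (c * (real (Suc n))\<^sup>2)))"
  by (rule summable_comparison_test'[OF summable_exp_neg_mult[of c]]) (use exp_neg_square_le in auto)

lemma gauss_theta_ge_1: "t > 0 \<Longrightarrow> gauss_theta t \<ge> 1"
  unfolding gauss_theta_def using summable_exp_neg_square[of t] by (simp add: suminf_nonneg)

lemma nearest_odd:
  fixes s :: real
  assumes "s \<ge> 0"
  defines "L \<equiv> nat \<lfloor>s / 2\<rfloor>"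
  shows "real (2 * L + 1) \<le> s + 1" "s - 1 \<le> real (2 * L + 1)"
proof -
  have "real L = of_int \<lfloor>s / 2\<rfloor>" using assms by simp
  then show "real (2 * L + 1) \<le> s + 1" "s - 1 \<le> real (2 * L + 1)" by linarith+
qed

section \<open>Passage to the limit in Polya's identity\<close>

text \<open>\<open>l m\<close> is an odd integer within distance 1 of \<open>sqrt (m * t)\<close>,
  so that \<open>l\<^sup>2 / m\<close> tends to \<open>t\<close>; both sides of the identity then
  converge to theta series.\<close>

context
  fixes t :: real and L l :: "nat \<Rightarrow> nat"
  assumes t: "t > 0"
  defines "L \<equiv> \<lambda>m. nat \<lfloor>sqrt (real m * t) / 2\<rfloor>"
  defines "l \<equiv> \<lambda>m. 2 * L m + 1"
begin

lemma l_bounds: "real (l m) \<le> sqrt (real m * t) + 1" "sqrt (real m * t) - 1 \<le> real (l m)"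
  using nearest_odd[of "sqrt (real m * t)"] t unfolding l_def L_def by simp_all

lemma l_pos: "real (l m) \<ge> 1"
  by (simp add: l_def)

lemma tendsto_l_over_sqrt: "(\<lambda>m. real (l m) / sqrt (real m)) \<longlonglongrightarrow> sqrt t"
proof -
  have "(\<lambda>m. 1 / sqrt (real m)) \<longlonglongrightarrow> 0" by real_asymp
  moreover have "eventually (\<lambda>m. norm (real (l m) / sqrt (real m) - sqrt t) \<le> 1 / sqrt (real m)) sequentially"
    using eventually_gt_at_top[of 0]
  proof eventually_elim
    case (elim m)
    have "real (l m) / sqrt (real m) - sqrt t = (real (l m) - sqrt (real m * t)) / sqrt (real m)"
      using elim by (simp add: real_sqrt_mult field_simps)
    moreover have "\<bar>real (l m) - sqrt (real m * t)\<bar> \<le> 1" using l_bounds[of m] by linarith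
    ultimately show ?case using elim by (simp add: divide_right_mono)
  qed
  ultimately have "(\<lambda>m. real (l m) / sqrt (real m) - sqrt t) \<longlonglongrightarrow> 0"
    by (rule Lim_null_comparison[rotated])
  then show ?thesis by (simp add: LIM_zero_iff)
qed

lemma tendsto_l_square_over: "(\<lambda>m. (real (l m))\<^sup>2 / real m) \<longlonglongrightarrow> t"
proof -
  have "(\<lambda>m. (real (l m) / sqrt (real m))\<^sup>2) \<longlonglongrightarrow> (sqrt t)\<^sup>2"
    by (intro tendsto_intros tendsto_l_over_sqrt)
  then show ?thesis using t by (simp add: power_divide)
qed

lemma tendsto_l_over: "(\<lambda>m. real (l m) / real m) \<longlonglongrightarrow> 0"
proof -
  have "(\<lambda>m. 1 / sqrt (real m)) \<longlonglongrightarrow> 0" by real_asymp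
  from tendsto_mult[OF tendsto_l_over_sqrt this]
  show ?thesis by (simp flip: real_sqrt_mult)
qed

lemma tendsto_inverse_l: "(\<lambda>m. 1 / real (l m)) \<longlonglongrightarrow> 0"
proof -
  have "(\<lambda>m. 1 / sqrt (real m)) \<longlonglongrightarrow> 0" by real_asymp
  from tendsto_divide[OF this tendsto_l_over_sqrt] have "(\<lambda>m. 1 / sqrt (real m) / (real (l m) / sqrt (real m))) \<longlonglongrightarrow> 0"
    using t by simp
  moreover have "eventually (\<lambda>m. 1 / sqrt (real m) / (real (l m) / sqrt (real m)) = 1 / real (l m)) sequentially"
    using eventually_gt_at_top[of 0] by eventually_elim (simp add: field_simps)
  ultimately show ?thesis by (rule Lim_transform_eventually)
qed

lemma l_square_lower: "(real (l m))\<^sup>2 \<ge> real m * t / 4"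
proof -
  have "real (l m) \<ge> sqrt (real m * t) / 2" using l_bounds[of m] l_pos[of m] by linarith
  then have "(real (l m))\<^sup>2 \<ge> (sqrt (real m * t) / 2)\<^sup>2" using t by (intro power_mono) auto
  then show ?thesis using t by (simp add: power_divide)
qed

lemma l_square_upper: "m > 0 \<Longrightarrow> (real (l m))\<^sup>2 \<le> real m * (2 * t + 2)"
proof -
  assume m: "m > 0"
  have "(real (l m))\<^sup>2 \<le> (sqrt (real m * t) + 1)\<^sup>2" using l_bounds[of m] by (intro power_mono) auto
  also have "\<dots> \<le> 2 * (sqrt (real m * t))\<^sup>2 + 2"
    using zero_le_power2[of "sqrt (real m * t) - 1"] by (simp add: power2_eq_square algebra_simps)
  also have "\<dots> \<le> real m * (2 * t + 2)" using t m by (simp add: algebra_simps)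
  finally show ?thesis .
qed

text \<open>With \<open>k = l * Suc \<nu>\<close> the quotient \<open>k\<^sup>2 / m\<close> tends to
  \<open>t * (Suc \<nu>)\<^sup>2\<close> while \<open>k / m\<close> tends to 0, so the two Gaussian
  bounds squeeze each term. Tannery's theorem exchanges limit and sum.\<close>

lemma tendsto_binomial_side:
  "(\<lambda>m. \<Sum>\<nu>. real (2 * m choose (m + l m * Suc \<nu>)) / real (2 * m choose m)) \<longlonglongrightarrow>
    (\<Sum>\<nu>. exp (- (t * (real (Suc \<nu>))\<^sup>2)))"
proof -
  define k where "k m \<nu> = l m * Suc \<nu>" for m \<nu>
  define a where "a \<nu> m = real (2 * m choose (m + k m \<nu>)) / real (2 * m choose m)" for \<nu> m
  have b0: "real (2 * m choose m) > 0" for m by simp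
  have lim: "(\<lambda>m. a \<nu> m) \<longlonglongrightarrow> exp (- (t * (real (Suc \<nu>))\<^sup>2))" for \<nu>
  proof -
    have q: "(\<lambda>m. real (k m \<nu>) / real m) \<longlonglongrightarrow> 0"
      using tendsto_mult_right[OF tendsto_l_over, of "real (Suc \<nu>)"] by (simp only: k_def of_nat_mult times_divide_eq_left mult_zero_left)
    have i: "(\<lambda>m. 1 / real m) \<longlonglongrightarrow> 0" by real_asymp
    have kk: "(\<lambda>m. (real (k m \<nu>))\<^sup>2 / real m) \<longlonglongrightarrow> t * (real (Suc \<nu>))\<^sup>2"
      using tendsto_mult_right[OF tendsto_l_square_over, of "(real (Suc \<nu>))\<^sup>2"]
      by (simp only: k_def power_mult_distrib of_nat_mult times_divide_eq_left)
    have ev: "eventually (\<lambda>m. m > 0 \<and> k m \<nu> \<le> m) sequentially"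
    proof -
      have "eventually (\<lambda>m. real (k m \<nu>) / real m < 1) sequentially"
        by (rule order_tendstoD(2)[OF q]) simp
      then show ?thesis using eventually_gt_at_top[of 0]
        by eventually_elim (simp add: field_simps)
    qed
    show ?thesis
    proof (rule tendsto_sandwich)
      show "eventually (\<lambda>m. exp (- ((real (k m \<nu>))\<^sup>2 / real m / (1 + 1 / real m - real (k m \<nu>) / real m))) \<le> a \<nu> m) sequentially"
        using ev
      proof eventually_elim
        case (elim m)
        have eq: "(real (k m \<nu>))\<^sup>2 / real m / (1 + 1 / real m - real (k m \<nu>) / real m) =
            (real (k m \<nu>))\<^sup>2 / (real m + 1 - real (k m \<nu>))"
        proof -
          have "1 + 1 / real m - real (k m \<nu>) / real m = (real m + 1 - real (k m \<nu>)) / real m"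
            using elim by (simp add: diff_divide_distrib add_divide_distrib)
          then show ?thesis using elim by simp
        qed
        show ?case
          unfolding eq a_def pos_le_divide_eq[OF b0]
          using central_binomial_lower[of "k m \<nu>" "k m \<nu>" m] elim by (simp add: mult.commute)
      qed
      show "eventually (\<lambda>m. a \<nu> m \<le> exp (- ((real (k m \<nu>))\<^sup>2 / real m / (1 + real (k m \<nu>) / real m)))) sequentially"
        using ev
      proof eventually_elim
        case (elim m)
        have "(real (k m \<nu>))\<^sup>2 / real m / (1 + real (k m \<nu>) / real m) =
            (real (k m \<nu>))\<^sup>2 / (real m + real (k m \<nu>))"
          using elim by (simp add: field_simps)
        then show ?case
          using central_binomial_upper[of "k m \<nu>" "k m \<nu>" m] elim by (simp add: a_def field_simps)
      qed
      have "(\<lambda>m. exp (- ((real (k m \<nu>))\<^sup>2 / real m / (1 + 1 / real m - real (k m \<nu>) / real m)))) \<longlonglongrightarrow>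
          exp (- (t * (real (Suc \<nu>))\<^sup>2 / (1 + 0 - 0)))"
        by (intro tendsto_intros kk q i) simp
      then show "(\<lambda>m. exp (- ((real (k m \<nu>))\<^sup>2 / real m / (1 + 1 / real m - real (k m \<nu>) / real m)))) \<longlonglongrightarrow>
          exp (- (t * (real (Suc \<nu>))\<^sup>2))" by simp
      have "(\<lambda>m. exp (- ((real (k m \<nu>))\<^sup>2 / real m / (1 + real (k m \<nu>) / real m)))) \<longlonglongrightarrow>
          exp (- (t * (real (Suc \<nu>))\<^sup>2 / (1 + 0)))"
        by (intro tendsto_intros kk q i) simp
      then show "(\<lambda>m. exp (- ((real (k m \<nu>))\<^sup>2 / real m / (1 + real (k m \<nu>) / real m)))) \<longlonglongrightarrow>
          exp (- (t * (real (Suc \<nu>))\<^sup>2))" by simp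
    qed
  qed
  \<comment> \<open>The constant \<open>t / 8\<close> comes from
    \<open>l\<^sup>2 \<ge> m * t / 4\<close> together with \<open>m + k \<le> 2 * m\<close>. For
    \<open>k > m\<close> the binomial coefficient is 0.\<close>
  have bnd: "norm (a \<nu> m) \<le> exp (- (t / 8 * real (Suc \<nu>)))" if m: "m > 0" for \<nu> m
  proof (cases "k m \<nu> \<le> m")
    case True
    have "t / 8 * (real (Suc \<nu>))\<^sup>2 \<le> (real (k m \<nu>))\<^sup>2 / (2 * real m)"
    proof -
      have "real m * t / 4 * (real (Suc \<nu>))\<^sup>2 \<le> (real (l m))\<^sup>2 * (real (Suc \<nu>))\<^sup>2"
        by (intro mult_right_mono l_square_lower) simp
      moreover have "(real (k m \<nu>))\<^sup>2 = (real (l m))\<^sup>2 * (real (Suc \<nu>))\<^sup>2"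
        by (simp only: k_def of_nat_mult power_mult_distrib)
      ultimately show ?thesis using m by (simp add: field_simps del: of_nat_Suc)
    qed
    also have "\<dots> \<le> (real (k m \<nu>))\<^sup>2 / (real m + real (k m \<nu>))"
      using True m by (intro divide_left_mono) auto
    finally have "exp (- ((real (k m \<nu>))\<^sup>2 / (real m + real (k m \<nu>)))) \<le> exp (- (t / 8 * (real (Suc \<nu>))\<^sup>2))"
      by simp
    also have "\<dots> \<le> exp (- (t / 8 * real (Suc \<nu>)))" using t by (intro exp_neg_square_le) simp
    finally have e: "exp (- ((real (k m \<nu>))\<^sup>2 / (real m + real (k m \<nu>)))) \<le> exp (- (t / 8 * real (Suc \<nu>)))" .
    have "a \<nu> m \<le> exp (- ((real (k m \<nu>))\<^sup>2 / (real m + real (k m \<nu>))))"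
      using central_binomial_upper[of "k m \<nu>" "k m \<nu>" m] True m b0[of m] by (simp add: a_def field_simps)
    with e have "a \<nu> m \<le> exp (- (t / 8 * real (Suc \<nu>)))" by (rule order_trans[rotated])
    moreover have "norm (a \<nu> m) = a \<nu> m" by (simp add: a_def)
    ultimately show ?thesis by simp
  qed (simp add: a_def binomial_eq_0)
  have "eventually (\<lambda>(\<nu>, m). norm (a \<nu> m) \<le> exp (- (t / 8 * real (Suc \<nu>)))) (at_top \<times>\<^sub>F sequentially)"
    unfolding eventually_prod_filter
    by (rule exI[of _ "\<lambda>_. True"], rule exI[of _ "\<lambda>m. m > 0"]) (use bnd eventually_gt_at_top[of "0::nat"] in auto)
  then have "(\<lambda>m. \<Sum>\<nu>. a \<nu> m) \<longlonglongrightarrow> (\<Sum>\<nu>. exp (- (t * (real (Suc \<nu>))\<^sup>2)))"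
    using tannerys_theorem[OF lim, where M = "\<lambda>\<nu>. exp (- (t / 8 * real (Suc \<nu>)))"]
      summable_exp_neg_mult[of "t / 8"] t by simp
  then show ?thesis by (simp add: a_def k_def)
qed

text \<open>Near 0 the logarithm of the cosine behaves like minus half the square, and the squared
  angle times \<open>m\<close> tends to \<open>(pi * Suc j)\<^sup>2 / t\<close>. Again Tannery's
  theorem applies.\<close>

lemma tendsto_cosine_side:
  "(\<lambda>m. \<Sum>j. if j < L m then cos (pi * real (Suc j) / real (l m)) ^ (2 * m) else 0) \<longlonglongrightarrow>
    (\<Sum>j. exp (- (pi\<^sup>2 / t * (real (Suc j))\<^sup>2)))"
proof -
  define a where "a j m = (if j < L m then cos (pi * real (Suc j) / real (l m)) ^ (2 * m) else 0)" for j m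
  \<comment> \<open>\<open>cos_power_le_exp\<close> has the exponent
    \<open>m * x\<^sup>2 / 4\<close>, and \<open>l\<^sup>2 \<le> m * (2 * t + 2)\<close> bounds it
    from below by \<open>c * (Suc j)\<^sup>2\<close>.\<close>
  define c where "c = pi\<^sup>2 / (8 * t + 8)"
  have c: "c > 0" using t by (simp add: c_def)
  have lim: "(\<lambda>m. a j m) \<longlonglongrightarrow> exp (- (pi\<^sup>2 / t * (real (Suc j))\<^sup>2))" for j
  proof -
    define x where "x m = pi * real (Suc j) / real (l m)" for m
    have x0: "x \<longlonglongrightarrow> 0"
      using tendsto_mult_right[OF tendsto_inverse_l, of "pi * real (Suc j)"] by (simp add: x_def[abs_def] del: of_nat_Suc)
    have xpos: "x m > 0" for m using l_pos[of m] by (simp add: x_def)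
    have "filterlim x (at_right 0) sequentially"
      using x0 less_imp_neq[OF xpos] xpos by (auto simp: filterlim_at intro!: always_eventually)
    moreover have "((\<lambda>y::real. ln (cos y) / y\<^sup>2) \<longlongrightarrow> -1 / 2) (at_right 0)" by real_asymp
    ultimately have 1: "(\<lambda>m. ln (cos (x m)) / (x m)\<^sup>2) \<longlonglongrightarrow> -1 / 2"
      by (rule filterlim_compose[rotated])
    have "(\<lambda>m. (pi * real (Suc j))\<^sup>2 / ((real (l m))\<^sup>2 / real m)) \<longlonglongrightarrow> (pi * real (Suc j))\<^sup>2 / t"
      using t by (intro tendsto_intros tendsto_l_square_over) simp
    then have 2: "(\<lambda>m. real m * (x m)\<^sup>2) \<longlonglongrightarrow> (pi * real (Suc j))\<^sup>2 / t"
      by (simp add: x_def power_divide mult_ac)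
    have "(\<lambda>m. exp (2 * (real m * (x m)\<^sup>2) * (ln (cos (x m)) / (x m)\<^sup>2))) \<longlonglongrightarrow>
        exp (2 * ((pi * real (Suc j))\<^sup>2 / t) * (-1 / 2))"
      by (intro tendsto_intros 1 2)
    also have "exp (2 * ((pi * real (Suc j))\<^sup>2 / t) * (-1 / 2)) = exp (- (pi\<^sup>2 / t * (real (Suc j))\<^sup>2))"
      by (simp add: power_mult_distrib)
    finally have 3: "(\<lambda>m. exp (2 * (real m * (x m)\<^sup>2) * (ln (cos (x m)) / (x m)\<^sup>2))) \<longlonglongrightarrow>
        exp (- (pi\<^sup>2 / t * (real (Suc j))\<^sup>2))" .
    have "eventually (\<lambda>m. x m < pi / 4) sequentially" by (rule order_tendstoD(2)[OF x0]) simp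
    \<comment> \<open>This makes \<open>l\<close> larger than \<open>2 * j + 4\<close>, hence
      \<open>j < L\<close>, so that the term is a cosine power and not 0.\<close>
    moreover have "eventually (\<lambda>m. 1 / real (l m) < 1 / (2 * real j + 4)) sequentially"
      by (rule order_tendstoD(2)[OF tendsto_inverse_l]) simp
    ultimately have "eventually (\<lambda>m. exp (2 * (real m * (x m)\<^sup>2) * (ln (cos (x m)) / (x m)\<^sup>2)) = a j m) sequentially"
    proof eventually_elim
      case (elim m)
      have "2 * real j + 4 < real (l m)" using elim(2) l_pos[of m] by (simp add: field_simps)
      then have "j < L m" by (simp add: l_def)
      moreover have "cos (x m) > 0" using elim(1) xpos[of m] by (intro cos_gt_zero) auto
      moreover have "2 * (real m * (x m)\<^sup>2) * (ln (cos (x m)) / (x m)\<^sup>2) = real (2 * m) * ln (cos (x m))"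
        using xpos[of m] by simp
      ultimately show ?case by (simp only: a_def x_def[symmetric] exp_of_nat_mult exp_ln if_True)
    qed
    with 3 show ?thesis by (rule Lim_transform_eventually)
  qed
  have bnd: "norm (a j m) \<le> exp (- (c * real (Suc j)))" if m: "m > 0" for j m
  proof (cases "j < L m")
    case True
    define x where "x = pi * real (Suc j) / real (l m)"
    have "real (Suc j) * 2 \<le> real (l m)" using True by (simp add: l_def)
    then have "pi * (real (Suc j) * 2) \<le> pi * real (l m)" by (intro mult_left_mono) auto
    then have x: "0 \<le> x" "x \<le> pi / 2"
      using l_pos[of m] by (simp_all add: x_def field_simps del: of_nat_Suc)
    have "c * (real (Suc j))\<^sup>2 \<le> real m * x\<^sup>2 / 4"
    proof -
      have "pi\<^sup>2 * (real (Suc j))\<^sup>2 * (real (l m))\<^sup>2 \<le> pi\<^sup>2 * (real (Suc j))\<^sup>2 * (real m * (2 * t + 2))"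
        by (intro mult_left_mono l_square_upper m) simp
      then have le: "pi\<^sup>2 * (real (Suc j))\<^sup>2 / (2 * t + 2) \<le> pi\<^sup>2 * (real (Suc j))\<^sup>2 * real m / (real (l m))\<^sup>2"
        using t l_pos[of m] by (simp add: divide_le_eq le_divide_eq mult_ac del: of_nat_Suc)
      have "c * (real (Suc j))\<^sup>2 = pi\<^sup>2 * (real (Suc j))\<^sup>2 / (2 * t + 2) / 4"
        using t by (simp add: c_def field_simps del: of_nat_Suc)
      moreover have "real m * x\<^sup>2 / 4 = pi\<^sup>2 * (real (Suc j))\<^sup>2 * real m / (real (l m))\<^sup>2 / 4"
        by (simp add: x_def power_divide power_mult_distrib mult_ac)
      ultimately show ?thesis using divide_right_mono[OF le, of 4] by (simp only: zero_le_numeral)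
    qed
    then have "exp (- (real m * x\<^sup>2 / 4)) \<le> exp (- (c * (real (Suc j))\<^sup>2))" by simp
    also have "\<dots> \<le> exp (- (c * real (Suc j)))" using c by (rule exp_neg_square_le)
    finally have "cos x ^ (2 * m) \<le> exp (- (c * real (Suc j)))"
      using cos_power_le_exp[OF x, of m] by linarith
    moreover have "cos x ^ (2 * m) \<ge> 0" by (simp add: power_mult)
    ultimately show ?thesis using True by (simp add: a_def x_def)
  qed (simp add: a_def)
  have "eventually (\<lambda>(j, m). norm (a j m) \<le> exp (- (c * real (Suc j)))) (at_top \<times>\<^sub>F sequentially)"
    unfolding eventually_prod_filter
    by (rule exI[of _ "\<lambda>_. True"], rule exI[of _ "\<lambda>m. m > 0"]) (use bnd eventually_gt_at_top[of "0::nat"] in auto)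
  then have "(\<lambda>m. \<Sum>j. a j m) \<longlonglongrightarrow> (\<Sum>j. exp (- (pi\<^sup>2 / t * (real (Suc j))\<^sup>2)))"
    using tannerys_theorem[OF lim, where M = "\<lambda>j. exp (- (c * real (Suc j)))"]
      summable_exp_neg_mult[OF c] by simp
  then show ?thesis by (simp add: a_def)
qed

text \<open>Polya's identity is solved for the central binomial coefficient. The sequence does not
  involve \<open>t\<close>, although the limit is expressed by \<open>t\<close>.\<close>

lemma tendsto_central_binomial:
  "(\<lambda>m. sqrt (real m) * real (2 * m choose m) / 4 ^ m) \<longlonglongrightarrow>
    gauss_theta (pi\<^sup>2 / t) / gauss_theta t / sqrt t"
proof -
  define U where "U m = 1 + 2 * (\<Sum>j. if j < L m then cos (pi * real (Suc j) / real (l m)) ^ (2 * m) else 0)" for m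
  define V where "V m = 1 + 2 * (\<Sum>\<nu>. real (2 * m choose (m + l m * Suc \<nu>)) / real (2 * m choose m))" for m
  have U: "U \<longlonglongrightarrow> gauss_theta (pi\<^sup>2 / t)"
    unfolding U_def gauss_theta_def by (intro tendsto_intros tendsto_cosine_side)
  have V: "V \<longlonglongrightarrow> gauss_theta t"
    unfolding V_def gauss_theta_def by (intro tendsto_intros tendsto_binomial_side)
  have g: "gauss_theta t \<noteq> 0" using gauss_theta_ge_1[OF t] by simp
  have "(\<lambda>m. U m / V m / (real (l m) / sqrt (real m))) \<longlonglongrightarrow>
      gauss_theta (pi\<^sup>2 / t) / gauss_theta t / sqrt t"
    using t g by (intro tendsto_divide U V tendsto_l_over_sqrt) auto
  moreover have "U m / V m / (real (l m) / sqrt (real m)) = sqrt (real m) * real (2 * m choose m) / 4 ^ m" for m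
  proof -
    have s: "summable (\<lambda>\<nu>. real (2 * m choose (m + l m * Suc \<nu>)))"
      by (rule summable_finite[of "{..m}"]) (auto simp: l_def)
    have "real (2 * m choose m) * V m = real (2 * m choose m) + 2 * (\<Sum>\<nu>. real (2 * m choose (m + l m * Suc \<nu>)))"
      unfolding V_def suminf_divide[OF s] by (simp add: algebra_simps)
    then have eq: "4 ^ m * U m = real (l m) * (real (2 * m choose m) * V m)"
      using polya_identity[of m "L m"] by (simp only: U_def l_def)
    have "V m \<ge> 1"
      unfolding V_def using summable_divide[OF s, of "real (2 * m choose m)"]
      by (simp add: suminf_nonneg)
    then have "U m / V m = real (l m) * real (2 * m choose m) / 4 ^ m"
      using eq by (simp add: field_simps)
    then show ?thesis using l_pos[of m] by simp
  qed
  ultimately show ?thesis by simp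
qed

end

text \<open>The limit in \<open>tendsto_central_binomial\<close> is the same for \<open>t\<close>
  and for 1. The constant is left unevaluated.\<close>

lemma gauss_theta_inversion:
  assumes "t > 0"
  shows "gauss_theta (pi\<^sup>2 / t) = gauss_theta (pi\<^sup>2) / gauss_theta 1 * sqrt t * gauss_theta t"
proof -
  have "gauss_theta (pi\<^sup>2 / t) / gauss_theta t / sqrt t = gauss_theta (pi\<^sup>2 / 1) / gauss_theta 1 / sqrt 1"
    by (rule LIMSEQ_unique[OF tendsto_central_binomial[OF assms] tendsto_central_binomial]) simp
  then show ?thesis using assms gauss_theta_ge_1[OF assms] by (simp add: field_simps)
qed

section \<open>The theta multiplier\<close>

definition nome :: "complex \<Rightarrow> complex" where
  "nome z = exp (2 * of_real pi * \<i> * z)"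

lemma qpow_power: "qpow n z = nome z ^ n"
  by (simp add: qpow_def nome_def mult_ac flip: exp_of_nat_mult)

lemma norm_nome: "norm (nome z) = exp (- (2 * pi * Im z))"
  by (simp add: nome_def)

lemma norm_nome_less: "z \<in> upper_half_plane \<Longrightarrow> norm (nome z) < 1"
  by (simp add: norm_nome upper_half_plane_def)

lemma qpow_add_of_int: "qpow n (z + of_int m) = qpow n z"
proof -
  have "2 * of_real pi * \<i> * of_nat n * (z + of_int m) =
      2 * of_real pi * \<i> * of_nat n * z + 2 * of_int (int n * m) * of_real pi * \<i>"
    by (simp add: algebra_simps)
  moreover have "exp (2 * of_int (int n * m) * of_real pi * \<i>) = 1"
    using exp_integer_2pi[of "of_int (int n * m)"] by simp
  ultimately show ?thesis by (simp only: qpow_def exp_add mult_1_right)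
qed

lemma upper_half_plane_simps:
  "open upper_half_plane" "connected upper_half_plane" "\<i> \<in> upper_half_plane"
proof -
  have eq: "upper_half_plane = {z. Im z > 0}" by (simp add: upper_half_plane_def)
  show "open upper_half_plane" unfolding eq by (rule open_halfspace_Im_gt)
  show "connected upper_half_plane" unfolding eq
    by (intro convex_connected convex_halfspace_Im_gt)
  show "\<i> \<in> upper_half_plane" by (simp add: eq)
qed

lemma nome_surj:
  assumes "norm w < 1" "w \<noteq> 0"
  obtains z where "z \<in> upper_half_plane" "nome z = w"
proof -
  define z where "z = Ln w / (2 * of_real pi * \<i>)"
  have "Im z = - ln (norm w) / (2 * pi)"
    using assms by (simp add: z_def Im_divide power2_eq_square)
  moreover have "ln (norm w) < 0" using assms by simp
  ultimately have "z \<in> upper_half_plane" by (simp add: upper_half_plane_def divide_neg_pos)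
  moreover have "nome z = w" using assms by (simp add: nome_def z_def)
  ultimately show ?thesis by (rule that)
qed

text \<open>Every real number strictly between 0 and 1 is a value of \<open>nome\<close>, so
  convergence on the half-plane gives convergence at radii arbitrarily close to 1.\<close>

lemma qser_conv_radius:
  assumes "q_convergent a"
  shows "conv_radius a \<ge> 1"
proof (rule conv_radius_geI_ex')
  fix r :: real assume r: "0 < r" "ereal r < 1"
  then obtain z where z: "z \<in> upper_half_plane" "nome z = of_real r"
    using nome_surj[of "of_real r"] by auto
  then have "summable (\<lambda>n. a n * qpow n z)" using assms by (simp add: q_convergent_def)
  moreover have "qpow n z = of_real r ^ n" for n
    unfolding qpow_power[of n] z(2) by (rule refl)
  ultimately show "summable (\<lambda>n. a n * of_real r ^ n)" by simp
qed

lemma qser_eval_fps: "qser a z = eval_fps (Abs_fps a) (nome z)"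
  unfolding qser_def eval_fps_def by (subst qpow_power) simp

lemma holomorphic_qser [holomorphic_intros]:
  assumes "q_convergent a"
  shows "qser a holomorphic_on upper_half_plane"
proof -
  have "ball (0::complex) 1 \<subseteq> eball 0 (fps_conv_radius (Abs_fps a))"
  proof (rule subsetI)
    fix x :: complex assume "x \<in> ball 0 1"
    then have "ereal (dist 0 x) < 1" by (simp add: one_ereal_def)
    also have "1 \<le> fps_conv_radius (Abs_fps a)"
      using qser_conv_radius[OF assms] by (simp add: fps_conv_radius_def)
    finally show "x \<in> eball 0 (fps_conv_radius (Abs_fps a))" by simp
  qed
  then have "eval_fps (Abs_fps a) holomorphic_on ball 0 1" by (rule holomorphic_on_eval_fps)
  moreover have "nome holomorphic_on upper_half_plane"
    unfolding nome_def by (intro holomorphic_intros)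
  moreover have "nome ` upper_half_plane \<subseteq> ball 0 1" using norm_nome_less by auto
  ultimately have "(eval_fps (Abs_fps a) \<circ> nome) holomorphic_on upper_half_plane"
    by (intro holomorphic_on_compose_gen)
  moreover have "eval_fps (Abs_fps a) \<circ> nome = qser a" by (auto simp: qser_eval_fps)
  ultimately show ?thesis by simp
qed

text \<open>The power series vanishes on the punctured disc, because \<open>nome\<close> takes every
  value there, and at 0 by continuity. Hence all its coefficients are 0.\<close>

lemma qser_eq_0_imp:
  assumes "q_convergent a" and zero: "\<And>z. z \<in> upper_half_plane \<Longrightarrow> qser a z = 0"
  shows "a n = 0"
proof -
  let ?F = "eval_fps (Abs_fps a)"
  have rad: "fps_conv_radius (Abs_fps a) > 0"
    using qser_conv_radius[OF assms(1)] unfolding fps_conv_radius_def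
    by (auto intro: less_le_trans[of 0 1])
  have z: "?F w = 0" if w: "norm w < 1" "w \<noteq> 0" for w
  proof -
    obtain z where "z \<in> upper_half_plane" "nome z = w" using nome_surj[OF w] .
    with zero[of z] show ?thesis by (simp add: qser_eval_fps)
  qed
  have ev: "eventually (\<lambda>w. ?F w = 0) (at 0)"
    unfolding eventually_at by (rule exI[of _ 1]) (simp add: z)
  have "isCont ?F 0" using rad by (intro continuous_eval_fps) (simp add: zero_ereal_def)
  then have "?F \<midarrow>0\<rightarrow> ?F 0" by (simp add: isCont_def)
  moreover have "?F \<midarrow>0\<rightarrow> 0" using ev by (rule tendsto_eventually)
  ultimately have "?F 0 = 0" by (rule LIM_unique)
  with ev have "eventually (\<lambda>w. ?F w = eval_fps 0 w) (nhds 0)"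
    by (simp add: eventually_nhds_conv_at)
  then have "Abs_fps a = 0" by (intro eval_fps_eqD rad) simp_all
  then show ?thesis by (metis fps_nth_Abs_fps fps_zero_nth)
qed

lemma qser_add_of_int: "qser a (z + of_int m) = qser a z"
  by (simp add: qser_def qpow_add_of_int)

definition theta_coeff :: "nat \<Rightarrow> complex" where
  "theta_coeff n = (if n = 0 then 1 else if \<exists>m. n = m\<^sup>2 then 2 else 0)"

lemma q_convergent_theta_coeff: "q_convergent theta_coeff"
  unfolding q_convergent_def
proof
  fix z assume z: "z \<in> upper_half_plane"
  show "summable (\<lambda>n. theta_coeff n * qpow n z)"
  proof (rule summable_comparison_test')
    show "summable (\<lambda>n. 2 * norm (nome z) ^ n)"
      using norm_nome_less[OF z] by (intro summable_mult summable_geometric) simp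
    show "norm (theta_coeff n * qpow n z) \<le> 2 * norm (nome z) ^ n" for n
    proof -
      have "norm (theta_coeff n) \<le> 2" by (simp add: theta_coeff_def)
      then show ?thesis
        by (subst qpow_power) (simp add: norm_mult norm_power mult_right_mono)
    qed
  qed
qed

lemma theta_eq_qser:
  assumes "z \<in> upper_half_plane"
  shows "theta z = qser theta_coeff z"
proof -
  let ?f = "\<lambda>n. theta_coeff (Suc n) * qpow (Suc n) z"
  have s: "summable (\<lambda>n. theta_coeff n * qpow n z)"
    using q_convergent_theta_coeff assms by (simp add: q_convergent_def)
  have "theta_coeff 0 * qpow 0 z = 1" by (simp add: theta_coeff_def qpow_def)
  then have "qser theta_coeff z = 1 + (\<Sum>n. ?f n)"
    unfolding qser_def using suminf_split_head[OF s] by simp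
  \<comment> \<open>The head term has been split off, so the index of \<open>?f\<close> is one below
    the exponent; \<open>(Suc n)\<^sup>2 - 1\<close> stands for the exponent
    \<open>(Suc n)\<^sup>2\<close>.\<close>
  also have "(\<Sum>n. ?f n) = (\<Sum>n. ?f ((Suc n)\<^sup>2 - 1))"
  proof (rule suminf_mono_reindex[symmetric])
    show "strict_mono (\<lambda>n. (Suc n)\<^sup>2 - 1)"
      by (rule strict_monoI_Suc) (simp add: power2_eq_square)
    fix n assume n: "n \<notin> range (\<lambda>n. (Suc n)\<^sup>2 - 1)"
    have "\<not> (\<exists>m. Suc n = m\<^sup>2)"
    proof
      assume "\<exists>m. Suc n = m\<^sup>2"
      then obtain m where m: "Suc n = m\<^sup>2" by blast
      then obtain m' where "m = Suc m'" by (cases m) auto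
      with m have "n = (Suc m')\<^sup>2 - 1" by simp
      with n show False by blast
    qed
    then show "?f n = 0" by (simp add: theta_coeff_def)
  qed
  also have "(\<lambda>n. ?f ((Suc n)\<^sup>2 - 1)) = (\<lambda>n. 2 * qpow ((Suc n)\<^sup>2) z)"
  proof
    fix n
    have "Suc ((Suc n)\<^sup>2 - 1) = (Suc n)\<^sup>2" by simp
    then show "?f ((Suc n)\<^sup>2 - 1) = 2 * qpow ((Suc n)\<^sup>2) z"
      by (simp only: theta_coeff_def) auto
  qed
  also have "(\<Sum>n. 2 * qpow ((Suc n)\<^sup>2) z) = 2 * (\<Sum>n. qpow ((Suc n)\<^sup>2) z)"
  proof (rule suminf_mult)
    have "summable (\<lambda>n. norm (nome z) ^ (Suc n))"
      using norm_nome_less[OF assms] by (simp only: power_Suc) (intro summable_mult summable_geometric, simp)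
    then show "summable (\<lambda>n. qpow ((Suc n)\<^sup>2) z)"
    proof (rule summable_comparison_test')
      show "norm (qpow ((Suc n)\<^sup>2) z) \<le> norm (nome z) ^ Suc n" for n
        by (subst qpow_power) (use norm_nome_less[OF assms] in
          \<open>simp add: norm_power power_decreasing power2_eq_square del: power_Suc\<close>)
    qed
  qed
  finally show ?thesis by (simp add: theta_def)
qed

lemma holomorphic_theta [holomorphic_intros]: "theta holomorphic_on upper_half_plane"
  using holomorphic_qser[OF q_convergent_theta_coeff]
  by (rule holomorphic_transform) (simp add: theta_eq_qser)

lemma theta_add_of_int: "theta (z + of_int m) = theta z"
  by (simp add: theta_def qpow_add_of_int)

lemma theta_imaginary_axis:
  assumes "y > 0"
  shows "theta (\<i> * of_real y) = of_real (gauss_theta (2 * pi * y))"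
proof -
  have "qpow ((Suc n)\<^sup>2) (\<i> * of_real y) = of_real (exp (- (2 * pi * y * (real (Suc n))\<^sup>2)))" for n
  proof -
    have "2 * of_real pi * \<i> * of_nat ((Suc n)\<^sup>2) * (\<i> * of_real y) =
        complex_of_real (- (2 * pi * y * (real (Suc n))\<^sup>2))"
      by (simp add: algebra_simps)
    then show ?thesis unfolding qpow_def by (simp only: exp_of_real)
  qed
  moreover have "summable (\<lambda>n. exp (- (2 * pi * y * (real (Suc n))\<^sup>2)))"
    using assms by (intro summable_exp_neg_square) simp
  ultimately show ?thesis
    by (simp add: theta_def gauss_theta_def suminf_of_real del: of_nat_Suc)
qed

section \<open>Moebius transformations\<close>

definition mat_mult :: "mat2 \<Rightarrow> mat2 \<Rightarrow> mat2" where
  "mat_mult = (\<lambda>(a, b, c, d) (a', b', c', d').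
     (a * a' + b * c', a * b' + b * d', c * a' + d * c', c * b' + d * d'))"

definition mat_det :: "mat2 \<Rightarrow> int" where
  "mat_det = (\<lambda>(a, b, c, d). a * d - b * c)"

lemma mat_det_mult: "mat_det (mat_mult M M') = mat_det M * mat_det M'"
  by (cases M; cases M') (simp add: mat_mult_def mat_det_def algebra_simps)

lemma autfactor_nonzero:
  assumes "mat_det M > 0" "z \<in> upper_half_plane"
  shows "autfactor M z \<noteq> 0"
proof
  obtain a b c d where M: "M = (a, b, c, d)" by (cases M)
  assume "autfactor M z = 0"
  then have "of_int c * z + of_int d = 0" by (simp add: M autfactor_def)
  then have "real_of_int c * Im z = 0" "real_of_int c * Re z + of_int d = 0"
    by (simp_all add: complex_eq_iff)
  then have "c = 0" "d = 0" using assms(2) by (auto simp: upper_half_plane_def)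
  then show False using assms(1) by (simp add: M mat_det_def)
qed

lemma Im_moebius:
  "Im (moebius M z) = of_int (mat_det M) * Im z / (norm (autfactor M z))\<^sup>2"
proof -
  obtain a b c d where M: "M = (a, b, c, d)" by (cases M)
  define w where "w = of_int c * z + of_int d"
  have "moebius M z = (of_int a * z + of_int b) * cnj w / of_real ((norm w)\<^sup>2)"
    using complex_div_cnj[of "of_int a * z + of_int b" w] by (simp add: M moebius_def w_def)
  then have "Im (moebius M z) = Im ((of_int a * z + of_int b) * cnj w) / (norm w)\<^sup>2"
    by (simp only: Im_divide_of_real)
  also have "Im ((of_int a * z + of_int b) * cnj w) = of_int (mat_det M) * Im z"
    by (simp add: M w_def mat_det_def algebra_simps)
  finally show ?thesis by (simp add: M w_def autfactor_def)
qed

lemma moebius_upper_half_plane: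
  assumes "mat_det M > 0" "z \<in> upper_half_plane"
  shows "moebius M z \<in> upper_half_plane"
  using assms autfactor_nonzero[OF assms] by (simp add: upper_half_plane_def Im_moebius)

lemma moebius_mat_mult:
  assumes "mat_det M > 0" "mat_det M' > 0" "z \<in> upper_half_plane"
  shows "moebius (mat_mult M M') z = moebius M (moebius M' z)"
    and "autfactor (mat_mult M M') z = autfactor M (moebius M' z) * autfactor M' z"
proof -
  obtain a b c d where M: "M = (a, b, c, d)" by (cases M)
  obtain a' b' c' d' where M': "M' = (a', b', c', d')" by (cases M')
  have n': "of_int c' * z + of_int d' \<noteq> 0"
    using autfactor_nonzero[OF assms(2,3)] by (simp add: M' autfactor_def)
  then show 1: "autfactor (mat_mult M M') z = autfactor M (moebius M' z) * autfactor M' z"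
    by (simp add: M M' autfactor_def moebius_def mat_mult_def field_simps)
  have n: "autfactor M (moebius M' z) \<noteq> 0"
    using assms by (intro autfactor_nonzero moebius_upper_half_plane)
  have "moebius (mat_mult M M') z =
      (of_int a * (of_int a' * z + of_int b') + of_int b * (of_int c' * z + of_int d')) /
      autfactor (mat_mult M M') z"
    by (simp add: M M' moebius_def autfactor_def mat_mult_def algebra_simps)
  also have "\<dots> = (of_int a * moebius M' z + of_int b) / autfactor M (moebius M' z)"
    unfolding 1 using n n' by (simp add: M' moebius_def autfactor_def field_simps)
  also have "\<dots> = moebius M (moebius M' z)" by (simp add: M moebius_def autfactor_def)
  finally show "moebius (mat_mult M M') z = moebius M (moebius M' z)" .
qed

lemma uminus_inverse_upper_half_plane:
  "z \<in> upper_half_plane \<Longrightarrow> - 1 / (4 * z) \<in> upper_half_plane"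
  using moebius_upper_half_plane[of "(0, -1, 4, 0)" z] by (simp add: moebius_def mat_det_def)

section \<open>The transformation law of the square of theta\<close>

text \<open>On the imaginary axis this is \<open>gauss_theta_inversion\<close> with parameter
  \<open>2 * pi * y\<close>. Squaring removes the root, so both sides are holomorphic and analytic
  continuation from the axis suffices.\<close>

lemma theta_inversion:
  obtains K where "K \<noteq> 0"
    "\<And>z. z \<in> upper_half_plane \<Longrightarrow> (theta (- 1 / (4 * z)))\<^sup>2 = K * z * (theta z)\<^sup>2"
proof -
  define \<kappa> where "\<kappa> = gauss_theta (pi\<^sup>2) / gauss_theta 1"
  \<comment> \<open>The factor \<open>- \<i>\<close> cancels the \<open>\<i>\<close> in
    \<open>z = \<i> * y\<close>, which leaves the square of the real factor
    \<open>\<kappa> * sqrt (2 * pi * y)\<close>.\<close>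
  define K where "K = - \<i> * of_real (2 * pi * \<kappa>\<^sup>2)"
  have "\<kappa> \<noteq> 0" unfolding \<kappa>_def using gauss_theta_ge_1[of 1] gauss_theta_ge_1[of "pi\<^sup>2"] by auto
  then have "K \<noteq> 0" by (simp add: K_def)
  moreover have "(theta (- 1 / (4 * z)))\<^sup>2 = K * z * (theta z)\<^sup>2" if z: "z \<in> upper_half_plane" for z
  proof -
    define f where "f z = (theta (- 1 / (4 * z)))\<^sup>2 - K * z * (theta z)\<^sup>2" for z
    have "f z = 0"
    proof (rule analytic_continuation[of f upper_half_plane "(\<lambda>y. \<i> * of_real y) ` {0<..}" \<i>])
      have "(\<lambda>z. theta (- 1 / (4 * z))) holomorphic_on upper_half_plane"
      proof -
        have "(\<lambda>z::complex. - 1 / (4 * z)) holomorphic_on upper_half_plane"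
          by (intro holomorphic_intros) (auto simp: upper_half_plane_def)
        then have "(theta \<circ> (\<lambda>z. - 1 / (4 * z))) holomorphic_on upper_half_plane"
          by (rule holomorphic_on_compose_gen[OF _ holomorphic_theta])
            (use uminus_inverse_upper_half_plane in auto)
        then show ?thesis by (simp add: o_def)
      qed
      then show "f holomorphic_on upper_half_plane"
        unfolding f_def by (intro holomorphic_intros)
      show "(\<lambda>y. \<i> * of_real y) ` {0<..} \<subseteq> upper_half_plane"
        by (auto simp: upper_half_plane_def)
      show "\<i> islimpt (\<lambda>y. \<i> * complex_of_real y) ` {0<..}"
        unfolding islimpt_approachable
      proof (intro allI impI)
        fix e :: real assume "e > 0"
        then show "\<exists>x'\<in>(\<lambda>y. \<i> * complex_of_real y) ` {0<..}. x' \<noteq> \<i> \<and> dist x' \<i> < e"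
          by (intro bexI[of _ "\<i> * of_real (1 + e / 2)"] imageI)
            (auto simp: dist_norm algebra_simps norm_mult complex_eq_iff)
      qed
    next
      fix w assume "w \<in> (\<lambda>y. \<i> * complex_of_real y) ` {0<..}"
      then obtain y where y: "y > 0" "w = \<i> * of_real y" by auto
      have "- 1 / (4 * w) = \<i> * of_real (1 / (4 * y))" using y by (simp add: field_simps)
      then have "theta (- 1 / (4 * w)) = of_real (gauss_theta (2 * pi * (1 / (4 * y))))"
        using theta_imaginary_axis[of "1 / (4 * y)"] y by simp
      also have "2 * pi * (1 / (4 * y)) = pi\<^sup>2 / (2 * pi * y)"
        using y by (simp add: power2_eq_square)
      also have "gauss_theta (pi\<^sup>2 / (2 * pi * y)) = \<kappa> * sqrt (2 * pi * y) * gauss_theta (2 * pi * y)"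
        unfolding \<kappa>_def by (rule gauss_theta_inversion) (use y in simp)
      finally have "(theta (- 1 / (4 * w)))\<^sup>2 =
          of_real ((\<kappa> * sqrt (2 * pi * y) * gauss_theta (2 * pi * y))\<^sup>2)"
        by simp
      also have "(\<kappa> * sqrt (2 * pi * y) * gauss_theta (2 * pi * y))\<^sup>2 =
          2 * pi * \<kappa>\<^sup>2 * y * (gauss_theta (2 * pi * y))\<^sup>2"
        using y by (simp add: power_mult_distrib)
      also have "complex_of_real \<dots> = K * w * (theta w)\<^sup>2"
        using theta_imaginary_axis[OF y(1)] by (simp add: K_def y(2))
      finally show "f w = 0" by (simp add: f_def)
    qed (use z upper_half_plane_simps in auto)
    then show ?thesis by (simp add: f_def)
  qed
  ultimately show ?thesis by (rule that)
qed

text \<open>The inversion conjugates this map into the translation by \<open>- m\<close>, under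
  which theta is invariant. The unknown constant occurs on both sides and cancels.\<close>

lemma theta_square_lower_triangular:
  fixes m :: int
  assumes z: "z \<in> upper_half_plane"
  defines "w \<equiv> z / (4 * of_int m * z + 1)"
  shows "(theta w)\<^sup>2 = (4 * of_int m * z + 1) * (theta z)\<^sup>2"
proof -
  have w: "w = moebius (1, 0, 4 * m, 1) z" by (simp add: w_def moebius_def)
  have wH: "w \<in> upper_half_plane" unfolding w by (rule moebius_upper_half_plane[OF _ z]) (simp add: mat_det_def)
  have nz: "4 * of_int m * z + 1 \<noteq> 0"
    using autfactor_nonzero[OF _ z, of "(1, 0, 4 * m, 1)"] by (simp add: autfactor_def mat_det_def)
  have z0: "z \<noteq> 0" using z by (auto simp: upper_half_plane_def)
  obtain K where K: "K \<noteq> 0"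
    "\<And>z. z \<in> upper_half_plane \<Longrightarrow> (theta (- 1 / (4 * z)))\<^sup>2 = K * z * (theta z)\<^sup>2"
    using theta_inversion by blast
  have "- 1 / (4 * w) = - 1 / (4 * z) + of_int (- m)"
    using nz z0 by (simp add: w_def field_simps)
  then have "theta (- 1 / (4 * w)) = theta (- 1 / (4 * z))"
    by (simp only: theta_add_of_int)
  then have "K * w * (theta w)\<^sup>2 = K * z * (theta z)\<^sup>2"
    using K(2)[OF z] K(2)[OF wH] by (simp only:)
  then have "w * (theta w)\<^sup>2 = z * (theta z)\<^sup>2" using K(1) by (simp add: mult.assoc)
  moreover have "z = (4 * of_int m * z + 1) * w" using nz by (simp add: w_def)
  ultimately have "w * (theta w)\<^sup>2 = w * ((4 * of_int m * z + 1) * (theta z)\<^sup>2)"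
    by (metis mult.assoc mult.commute)
  moreover have "w \<noteq> 0" using z0 nz by (simp add: w_def)
  ultimately show ?thesis using mult_left_cancel by blast
qed

lemma nearest_multiple:
  fixes c d :: int
  assumes "c \<noteq> 0"
  obtains n where "2 * \<bar>d + n * c\<bar> \<le> \<bar>c\<bar>"
proof -
  define q r where "q = d div c" and "r = d mod c"
  have d: "d = q * c + r" by (simp add: q_def r_def)
  have r: "c > 0 \<Longrightarrow> 0 \<le> r \<and> r < c" "c < 0 \<Longrightarrow> c < r \<and> r \<le> 0"
    by (simp_all add: r_def)
  show ?thesis
  proof (cases "2 * \<bar>r\<bar> \<le> \<bar>c\<bar>")
    case True
    then show ?thesis by (intro that[of "- q"]) (simp add: d)
  next
    case False
    have "d + (- q - 1) * c = r - c" by (simp add: d algebra_simps)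
    moreover have "2 * \<bar>r - c\<bar> \<le> \<bar>c\<bar>" using False r assms by (cases "c > 0") auto
    ultimately show ?thesis by (intro that[of "- q - 1"]) simp
  qed
qed

text \<open>A Euclidean algorithm on the bottom row: translations reduce \<open>d\<close> modulo
  \<open>c\<close>, lower triangular matrices reduce \<open>c\<close> modulo \<open>4 * d\<close>.
  The sign \<eta> arises at the end, where \<open>c = 0\<close> and \<open>d\<close> is 1 or
  -1.\<close>

lemma theta_square_Gamma0:
  assumes "\<gamma> \<in> Gamma0 4"
  shows "\<exists>\<eta>\<in>{1, - 1}. \<forall>z\<in>upper_half_plane. (theta (moebius \<gamma> z))\<^sup>2 = \<eta> * autfactor \<gamma> z * (theta z)\<^sup>2"
proof -
  have "\<exists>\<eta>\<in>{1, - 1}. \<forall>z\<in>upper_half_plane.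
      (theta (moebius (a, b, c, d) z))\<^sup>2 = \<eta> * autfactor (a, b, c, d) z * (theta z)\<^sup>2"
    if "a * d - b * c = 1" "4 dvd c" for a b c d
    using that
  proof (induction "nat \<bar>c\<bar>" arbitrary: a b c d rule: less_induct)
    case less
    show ?case
    proof (cases "c = 0")
      case True
      then have ad: "a = d" "d = 1 \<or> d = -1"
        using less.prems by (auto simp: zmult_eq_1_iff)
      have "moebius (a, b, c, d) z = z + of_int (b * d)" for z
        using ad True by (auto simp: moebius_def)
      then have "theta (moebius (a, b, c, d) z) = theta z" for z
        by (simp only: theta_add_of_int)
      moreover have "1 = of_int d * autfactor (a, b, c, d) z" for z
        using ad True by (auto simp: autfactor_def)
      ultimately show ?thesis using ad by (intro bexI[of _ "of_int d"]) auto
    next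
      case False
      obtain n where n: "2 * \<bar>d + n * c\<bar> \<le> \<bar>c\<bar>" using nearest_multiple[OF False] .
      define d1 b1 where "d1 = d + n * c" and "b1 = b + n * a"
      have det1: "a * d1 - b1 * c = 1" using less.prems(1) by (simp add: d1_def b1_def algebra_simps)
      have odd: "odd d1"
      proof -
        have "even c" using less.prems(2) by presburger
        moreover have "odd (a * d1 - b1 * c)" using det1 by simp
        ultimately show ?thesis by auto
      qed
      \<comment> \<open>Equality would make \<open>d1\<close> even because 4 divides
        \<open>c\<close>. The strict inequality is what makes the induction descend.\<close>
      have "2 * \<bar>d1\<bar> \<noteq> \<bar>c\<bar>"
      proof
        assume "2 * \<bar>d1\<bar> = \<bar>c\<bar>"
        then have "4 dvd 2 * \<bar>d1\<bar>" using less.prems(2) by simp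
        then have "even d1" by presburger
        with odd show False by simp
      qed
      with n have lt: "2 * \<bar>d1\<bar> < \<bar>c\<bar>" by (simp add: d1_def)
      \<comment> \<open>Lower triangular matrices change \<open>c\<close> only by multiples of
        \<open>4 * d1\<close>, which leaves twice \<open>\<bar>d1\<bar>\<close> as the bound; this
        is still below \<open>\<bar>c\<bar>\<close>.\<close>
      have "4 * d1 \<noteq> 0" using odd by auto
      then obtain m where m: "2 * \<bar>c + m * (4 * d1)\<bar> \<le> \<bar>4 * d1\<bar>" using nearest_multiple by blast
      define c' a' where "c' = c + 4 * m * d1" and "a' = a + 4 * m * b1"
      have "2 * \<bar>c'\<bar> \<le> 4 * \<bar>d1\<bar>" using m by (simp add: c'_def mult_ac abs_mult)
      then have "nat \<bar>c'\<bar> < nat \<bar>c\<bar>" using lt by linarith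
      moreover have "a' * d1 - b1 * c' = 1" using det1 by (simp add: a'_def c'_def algebra_simps)
      moreover have "4 dvd c'" using less.prems(2) by (simp add: c'_def)
      ultimately obtain \<eta> where \<eta>: "\<eta> \<in> {1, - 1}" "\<And>z. z \<in> upper_half_plane \<Longrightarrow>
          (theta (moebius (a', b1, c', d1) z))\<^sup>2 = \<eta> * autfactor (a', b1, c', d1) z * (theta z)\<^sup>2"
        using less.hyps[of c' a' d1 b1] by blast
      have "(theta (moebius (a, b, c, d) z))\<^sup>2 = \<eta> * autfactor (a, b, c, d) z * (theta z)\<^sup>2"
        if z: "z \<in> upper_half_plane" for z
      proof -
        \<comment> \<open>The two reductions are undone on the argument: \<open>w\<close> accounts
          for the translation by \<open>n\<close>, \<open>v\<close> for the lower triangular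
          matrix.\<close>
        define w where "w = z - of_int n"
        define v where "v = w / (4 * of_int (- m) * w + 1)"
        have w: "w \<in> upper_half_plane" using z by (simp add: w_def upper_half_plane_def)
        have v': "v = moebius (1, 0, - 4 * m, 1) w" by (simp add: v_def moebius_def)
        have det: "mat_det (1, 0, - 4 * m, 1) > 0" by (simp add: mat_det_def)
        have v: "v \<in> upper_half_plane" unfolding v' by (rule moebius_upper_half_plane[OF det w])
        have nz: "4 * of_int (- m) * w + 1 \<noteq> 0"
          using autfactor_nonzero[OF det w] by (simp add: autfactor_def)
        have prod: "mat_mult (a', b1, c', d1) (1, 0, - 4 * m, 1) = (a, b1, c, d1)"
          by (simp add: mat_mult_def a'_def c'_def)
        have det': "mat_det (a', b1, c', d1) > 0"
          using \<open>a' * d1 - b1 * c' = 1\<close> by (simp add: mat_det_def)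
        have "moebius (a, b, c, d) z = moebius (a, b1, c, d1) w"
          by (simp add: moebius_def w_def b1_def d1_def algebra_simps)
        then have "moebius (a, b, c, d) z = moebius (a', b1, c', d1) v"
          using moebius_mat_mult(1)[OF det' det w] by (simp only: prod v')
        then have "(theta (moebius (a, b, c, d) z))\<^sup>2 = \<eta> * autfactor (a', b1, c', d1) v * (theta v)\<^sup>2"
          using \<eta>(2)[OF v] by simp
        also have "(theta v)\<^sup>2 = autfactor (1, 0, - 4 * m, 1) w * (theta w)\<^sup>2"
          using theta_square_lower_triangular[OF w, of "- m"] by (simp add: v_def autfactor_def)
        also have "theta w = theta z"
          using theta_add_of_int[of z "- n"] by (simp add: w_def)
        also have "\<eta> * autfactor (a', b1, c', d1) v * (autfactor (1, 0, - 4 * m, 1) w * (theta z)\<^sup>2) =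
            \<eta> * autfactor (a, b1, c, d1) w * (theta z)\<^sup>2"
          using moebius_mat_mult(2)[OF det' det w] by (simp only: prod v' mult.assoc)
        also have "autfactor (a, b1, c, d1) w = autfactor (a, b, c, d) z"
          by (simp add: autfactor_def w_def d1_def algebra_simps)
        finally show ?thesis .
      qed
      with \<eta>(1) show ?thesis by blast
    qed
  qed
  then show ?thesis using assms by (cases \<gamma>) (auto simp: Gamma0_def)
qed

section \<open>The slash operator up to constants of absolute value one\<close>

text \<open>The half-integral power is taken by the principal logarithm, so the operator composes
  only up to a sign. The determinant factor makes positive scalar matrices act trivially.\<close>

definition slash :: "nat \<Rightarrow> (complex \<Rightarrow> complex) \<Rightarrow> mat2 \<Rightarrow> complex \<Rightarrow> complex" where
  "slash k f M z = of_real (real_of_int (mat_det M) powr (real k / 4)) * f (moebius M z) *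
     exp (- (of_nat k / 2) * Ln (autfactor M z))"

text \<open>Equality up to one constant of absolute value one. Multipliers and branch signs are such
  constants, and later only absolute values are compared.\<close>

definition phase_eq :: "(complex \<Rightarrow> complex) \<Rightarrow> (complex \<Rightarrow> complex) \<Rightarrow> bool" where
  "phase_eq f g \<longleftrightarrow> (\<exists>\<zeta>. norm \<zeta> = 1 \<and> (\<forall>z\<in>upper_half_plane. f z = \<zeta> * g z))"

lemma phase_eqE:
  assumes "phase_eq f g"
  obtains \<zeta> where "norm \<zeta> = 1" "\<And>z. z \<in> upper_half_plane \<Longrightarrow> f z = \<zeta> * g z"
  using assms unfolding phase_eq_def by blast

lemma phase_eq_refl: "(\<And>z. z \<in> upper_half_plane \<Longrightarrow> f z = g z) \<Longrightarrow> phase_eq f g"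
  unfolding phase_eq_def by (intro exI[of _ 1]) simp

lemma phase_eq_sym:
  assumes "phase_eq f g"
  shows "phase_eq g f"
proof -
  obtain \<zeta> where \<zeta>: "norm \<zeta> = 1" "\<And>z. z \<in> upper_half_plane \<Longrightarrow> f z = \<zeta> * g z"
    using assms by (rule phase_eqE) blast
  then have "\<zeta> \<noteq> 0" by auto
  with \<zeta> show ?thesis unfolding phase_eq_def by (intro exI[of _ "inverse \<zeta>"]) (simp add: norm_inverse)
qed

lemma phase_eq_trans [trans]:
  assumes "phase_eq f g" "phase_eq g h"
  shows "phase_eq f h"
proof -
  obtain \<zeta> where \<zeta>: "norm \<zeta> = 1" "\<And>z. z \<in> upper_half_plane \<Longrightarrow> f z = \<zeta> * g z"
    using assms(1) by (rule phase_eqE) blast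
  obtain \<xi> where \<xi>: "norm \<xi> = 1" "\<And>z. z \<in> upper_half_plane \<Longrightarrow> g z = \<xi> * h z"
    using assms(2) by (rule phase_eqE) blast
  show ?thesis unfolding phase_eq_def
    by (rule exI[of _ "\<zeta> * \<xi>"]) (simp add: \<zeta> \<xi> norm_mult)
qed

lemma slash_linear:
  "slash k (\<lambda>z. x * f z + y * g z) M z = x * slash k f M z + y * slash k g M z"
  by (simp add: slash_def algebra_simps)

lemma slash_cong:
  assumes "mat_det M > 0" "z \<in> upper_half_plane" "\<And>z. z \<in> upper_half_plane \<Longrightarrow> f z = g z"
  shows "slash k f M z = slash k g M z"
  unfolding slash_def using assms moebius_upper_half_plane by simp

lemma slash_phase_eq:
  assumes "phase_eq f g" "mat_det M > 0"
  shows "phase_eq (slash k f M) (slash k g M)"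
proof -
  obtain \<zeta> where \<zeta>: "norm \<zeta> = 1" "\<And>z. z \<in> upper_half_plane \<Longrightarrow> f z = \<zeta> * g z"
    using assms(1) by (rule phase_eqE) blast
  have "slash k f M z = \<zeta> * slash k g M z" if z: "z \<in> upper_half_plane" for z
    using \<zeta>(2)[OF moebius_upper_half_plane[OF assms(2) z]] by (simp add: slash_def)
  with \<zeta>(1) show ?thesis unfolding phase_eq_def by blast
qed

lemma holomorphic_moebius [holomorphic_intros]:
  assumes "mat_det M > 0"
  shows "moebius M holomorphic_on upper_half_plane"
proof -
  obtain a b c d where M: "M = (a, b, c, d)" by (cases M)
  have "of_int c * z + of_int d \<noteq> 0" if "z \<in> upper_half_plane" for z
    using autfactor_nonzero[OF assms that] by (simp add: M autfactor_def)
  then show ?thesis unfolding M moebius_def by (auto intro!: holomorphic_intros)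
qed

text \<open>For \<open>c \<noteq> 0\<close> the factor is never real on the half-plane and avoids
  the branch cut; for \<open>c = 0\<close> it is constant.\<close>

lemma holomorphic_Ln_autfactor:
  assumes "mat_det M > 0"
  shows "(\<lambda>z. Ln (autfactor M z)) holomorphic_on upper_half_plane"
proof -
  obtain a b c d where M: "M = (a, b, c, d)" by (cases M)
  show ?thesis
  proof (cases "c = 0")
    case True
    then show ?thesis by (simp add: M autfactor_def)
  next
    case False
    have "of_int c * z + of_int d \<notin> \<real>\<^sub>\<le>\<^sub>0" if z: "z \<in> upper_half_plane" for z
    proof
      assume "of_int c * z + of_int d \<in> \<real>\<^sub>\<le>\<^sub>0"
      then have "Im (of_int c * z + of_int d) = 0" by (simp add: complex_nonpos_Reals_iff)
      then show False using z False by (simp add: upper_half_plane_def)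
    qed
    then show ?thesis unfolding M autfactor_def by (auto intro!: holomorphic_intros)
  qed
qed

lemma holomorphic_slash:
  assumes "mat_det M > 0" "f holomorphic_on upper_half_plane"
  shows "slash k f M holomorphic_on upper_half_plane"
proof -
  have "(f \<circ> moebius M) holomorphic_on upper_half_plane"
    using moebius_upper_half_plane[OF assms(1)]
    by (intro holomorphic_on_compose_gen[OF holomorphic_moebius[OF assms(1)] assms(2)]) auto
  then show ?thesis
    unfolding slash_def[abs_def] o_def
    by (intro holomorphic_intros holomorphic_Ln_autfactor assms)
qed

lemma exp_half_Ln_square:
  assumes "w \<noteq> 0"
  shows "(exp (- (of_nat k / 2) * Ln w))\<^sup>2 = inverse (w ^ k)"
proof -
  have "(exp (- (of_nat k / 2) * Ln w))\<^sup>2 = exp (- (of_nat k * Ln w))"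
    by (simp flip: exp_double)
  also have "\<dots> = inverse (exp (Ln w) ^ k)"
    by (simp add: exp_minus exp_of_nat_mult)
  finally show ?thesis using assms by simp
qed

text \<open>The quotient of the two automorphy factors has square 1 by the cocycle relation. It is
  continuous on a connected set, hence a constant sign.\<close>

lemma slash_slash:
  assumes "mat_det M > 0" "mat_det M' > 0"
  shows "phase_eq (slash k (slash k f M) M') (slash k f (mat_mult M M'))"
proof -
  define J where "J M z = exp (- (of_nat k / 2) * Ln (autfactor M z))" for M and z :: complex
  define r where "r z = J M (moebius M' z) * J M' z / J (mat_mult M M') z" for z
  have det: "mat_det (mat_mult M M') > 0" using assms by (simp add: mat_det_mult)
  have J: "J M holomorphic_on upper_half_plane" if "mat_det M > 0" for M
    unfolding J_def by (intro holomorphic_intros holomorphic_Ln_autfactor that)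
  have Jn: "J M z \<noteq> 0" for M z by (simp add: J_def)
  have r2: "(r z)\<^sup>2 = 1" if z: "z \<in> upper_half_plane" for z
  proof -
    have n: "autfactor M (moebius M' z) \<noteq> 0" "autfactor M' z \<noteq> 0"
      using assms z by (simp_all add: autfactor_nonzero moebius_upper_half_plane)
    have "autfactor (mat_mult M M') z \<noteq> 0"
      by (rule autfactor_nonzero[OF det z])
    have "(J M w)\<^sup>2 = inverse (autfactor M w ^ k)" if "autfactor M w \<noteq> 0" for M w
      unfolding J_def by (rule exp_half_Ln_square[OF that])
    then have "(r z)\<^sup>2 = inverse (autfactor M (moebius M' z) ^ k) * inverse (autfactor M' z ^ k) /
        inverse ((autfactor M (moebius M' z) * autfactor M' z) ^ k)"
      using n \<open>autfactor (mat_mult M M') z \<noteq> 0\<close>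
      unfolding r_def power_mult_distrib power_divide moebius_mat_mult(2)[OF assms z, symmetric]
      by simp
    then show ?thesis using n by (simp add: power_mult_distrib)
  qed
  have "(J M \<circ> moebius M') holomorphic_on upper_half_plane"
    using moebius_upper_half_plane[OF assms(2)]
    by (intro holomorphic_on_compose_gen[OF holomorphic_moebius[OF assms(2)] J[OF assms(1)]]) auto
  then have "r holomorphic_on upper_half_plane"
    unfolding r_def o_def by (intro holomorphic_intros J assms det Jn)
  then have cont: "continuous_on upper_half_plane r" by (rule holomorphic_on_imp_continuous_on)
  have "r ` upper_half_plane \<subseteq> {1, -1}"
    using r2 by (auto simp: power2_eq_1_iff)
  then have "finite (r ` upper_half_plane)" by (rule finite_subset) simp
  then have "r constant_on upper_half_plane"
    using continuous_finite_range_constant upper_half_plane_simps(2) cont by blast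
  then obtain \<zeta> where \<zeta>: "\<And>z. z \<in> upper_half_plane \<Longrightarrow> r z = \<zeta>"
    unfolding constant_on_def by blast
  have "\<zeta>\<^sup>2 = 1" using r2[of \<i>] \<zeta>[of \<i>] upper_half_plane_simps by simp
  then have "norm \<zeta> = 1" by (auto simp: power2_eq_1_iff)
  moreover have "slash k (slash k f M) M' z = \<zeta> * slash k f (mat_mult M M') z"
    if z: "z \<in> upper_half_plane" for z
  proof -
    have "J M (moebius M' z) * J M' z = \<zeta> * J (mat_mult M M') z"
      using \<zeta>[OF z] Jn[of "mat_mult M M'" z] by (simp add: r_def field_simps)
    moreover have "slash k (slash k f M) M' z =
        of_real (real_of_int (mat_det M') powr (real k / 4) * real_of_int (mat_det M) powr (real k / 4)) *
        f (moebius M (moebius M' z)) * (J M (moebius M' z) * J M' z)"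
      by (simp add: slash_def J_def)
    moreover have "real_of_int (mat_det M') powr (real k / 4) * real_of_int (mat_det M) powr (real k / 4) =
        real_of_int (mat_det (mat_mult M M')) powr (real k / 4)"
      using assms by (simp add: mat_det_mult powr_mult)
    ultimately show ?thesis
      by (simp add: slash_def moebius_mat_mult(1)[OF assms z] J_def)
  qed
  ultimately show ?thesis unfolding phase_eq_def by blast
qed

text \<open>Where \<open>f\<close> and \<open>g\<close> differ, \<open>f = - g\<close>. That set is
  open, so if it is nonempty the identity theorem spreads the relation over
  \<open>S\<close>.\<close>

lemma holomorphic_square_eq:
  assumes "open S" "connected S" "f holomorphic_on S" "g holomorphic_on S"
    and sq: "\<And>z. z \<in> S \<Longrightarrow> (f z)\<^sup>2 = (g z)\<^sup>2"
  shows "(\<forall>z\<in>S. f z = g z) \<or> (\<forall>z\<in>S. f z = - g z)"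
proof (rule ccontr)
  assume neg: "\<not> ?thesis"
  then obtain w where w: "w \<in> S" "f w \<noteq> g w" by blast
  define U where "U = {z \<in> S. f z - g z \<noteq> 0}"
  have "continuous_on S (\<lambda>z. f z - g z)"
    by (intro holomorphic_on_imp_continuous_on holomorphic_intros assms)
  then have "open (S \<inter> (\<lambda>z. f z - g z) -` (- {0}))"
    using assms(1) by (intro continuous_open_preimage) auto
  moreover have "S \<inter> (\<lambda>z. f z - g z) -` (- {0}) = U" by (auto simp: U_def)
  ultimately have "open U" by simp
  have "f z = - g z" if "z \<in> S" for z
  proof (rule analytic_continuation_open[of U S f "\<lambda>z. - g z", OF \<open>open U\<close> assms(1) _ assms(2)])
    show "U \<noteq> {}" "U \<subseteq> S" using w by (auto simp: U_def)
    show "f holomorphic_on S" "(\<lambda>z. - g z) holomorphic_on S"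
      by (intro holomorphic_intros assms)+
    show "f u = - g u" if "u \<in> U" for u
      using sq[of u] that by (auto simp: U_def power2_eq_iff)
  qed fact
  with neg show False by blast
qed

text \<open>By \<open>theta_square_Gamma0\<close> the square of the slashed form is
  \<open>\<eta> ^ k\<close> times the square of the form, and \<open>holomorphic_square_eq\<close>
  takes the root up to a sign.\<close>

lemma half_cusp_forms'_slash:
  assumes a: "a \<in> half_cusp_forms' (4 * N) k" and "k > 0" and \<gamma>: "\<gamma> \<in> Gamma0 (4 * N)"
  shows "phase_eq (slash k (qser a) \<gamma>) (qser a)"
proof -
  let ?f = "qser a"
  obtain p q r s where pqrs: "\<gamma> = (p, q, r, s)" by (cases \<gamma>)
  have det: "mat_det \<gamma> = 1" "p * s - q * r = 1" and r: "int (4 * N) dvd r"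
    using \<gamma> by (auto simp: Gamma0_def mat_det_def pqrs)
  define \<gamma>' where "\<gamma>' = (s, - q, - r, p)"
  have \<gamma>': "\<gamma>' \<in> Gamma0 (4 * N)" "mat_det \<gamma>' = 1"
    using det r by (auto simp: Gamma0_def mat_det_def \<gamma>'_def algebra_simps)
  have conv: "q_convergent a" and mod: "\<And>\<gamma> z. \<gamma> \<in> Gamma0 (4 * N) \<Longrightarrow> z \<in> upper_half_plane \<Longrightarrow>
      ?f (moebius \<gamma> z) = (theta (moebius \<gamma> z) / theta z) ^ k * ?f z"
    using a by (auto simp: half_cusp_forms'_def)
  have "int 4 dvd r" using r by (auto intro: dvd_trans[rotated])
  then have "\<gamma> \<in> Gamma0 4" using det by (simp add: Gamma0_def pqrs)
  then obtain \<eta> where \<eta>: "\<eta> \<in> {1, - 1}" "\<And>z. z \<in> upper_half_plane \<Longrightarrow>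
      (theta (moebius \<gamma> z))\<^sup>2 = \<eta> * autfactor \<gamma> z * (theta z)\<^sup>2"
    using theta_square_Gamma0 by blast
  define \<epsilon> where "\<epsilon> = csqrt (\<eta> ^ k)"
  have \<epsilon>2: "\<epsilon>\<^sup>2 = \<eta> ^ k" by (simp add: \<epsilon>_def)
  have "norm \<eta> = 1" using \<eta>(1) by auto
  then have n1: "norm \<epsilon> = 1"
    using arg_cong[OF \<epsilon>2, of norm] norm_ge_zero[of \<epsilon>] by (auto simp: norm_power power2_eq_1_iff)
  have hol: "?f holomorphic_on upper_half_plane" using conv by (rule holomorphic_qser)
  have sq: "(slash k ?f \<gamma> z)\<^sup>2 = (\<epsilon> * ?f z)\<^sup>2" if z: "z \<in> upper_half_plane" for z
  proof -
    have dp: "mat_det \<gamma> > 0" using det by simp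
    have n: "autfactor \<gamma> z \<noteq> 0" by (rule autfactor_nonzero[OF dp z])
    have "(?f (moebius \<gamma> z))\<^sup>2 = (\<eta> * autfactor \<gamma> z) ^ k * (?f z)\<^sup>2"
    proof (cases "theta z = 0")
      case False
      have "(?f (moebius \<gamma> z))\<^sup>2 = ((theta (moebius \<gamma> z))\<^sup>2 / (theta z)\<^sup>2) ^ k * (?f z)\<^sup>2"
        unfolding mod[OF \<gamma> z] by (simp add: power_mult_distrib power_divide mult_ac flip: power_mult)
      also have "(theta (moebius \<gamma> z))\<^sup>2 / (theta z)\<^sup>2 = \<eta> * autfactor \<gamma> z"
        using False \<eta>(2)[OF z] by simp
      finally show ?thesis .
    next
      case True
      have wH: "moebius \<gamma> z \<in> upper_half_plane" by (rule moebius_upper_half_plane[OF dp z])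
      \<comment> \<open>A quotient with denominator 0 counts as 0, so at a zero of theta the law
        forces the form to vanish at the image point; the inverse matrix carries this back to
        \<open>z\<close>.\<close>
      have w0: "?f (moebius \<gamma> z) = 0" using mod[OF \<gamma> z] True \<open>k > 0\<close> by simp
      have prod: "mat_mult \<gamma>' \<gamma> = (1, 0, 0, 1)"
        using det by (simp add: mat_mult_def \<gamma>'_def pqrs algebra_simps)
      have "moebius \<gamma>' (moebius \<gamma> z) = moebius (mat_mult \<gamma>' \<gamma>) z"
        using moebius_mat_mult(1)[of \<gamma>' \<gamma> z] \<gamma>'(2) dp z by simp
      also have "\<dots> = z" unfolding prod by (simp add: moebius_def)
      finally have "moebius \<gamma>' (moebius \<gamma> z) = z" .
      then have "?f z = 0" using mod[OF \<gamma>'(1) wH] w0 by simp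
      with w0 show ?thesis by simp
    qed
    moreover have "(slash k ?f \<gamma> z)\<^sup>2 = (?f (moebius \<gamma> z))\<^sup>2 * inverse (autfactor \<gamma> z ^ k)"
      by (simp only: slash_def power_mult_distrib exp_half_Ln_square[OF n]) (simp add: det)
    ultimately show ?thesis using n by (simp add: power_mult_distrib \<epsilon>2)
  qed
  have "slash k ?f \<gamma> holomorphic_on upper_half_plane"
    using det by (intro holomorphic_slash hol) simp
  moreover have "(\<lambda>z. \<epsilon> * ?f z) holomorphic_on upper_half_plane"
    by (intro holomorphic_intros hol)
  ultimately have "(\<forall>z\<in>upper_half_plane. slash k ?f \<gamma> z = \<epsilon> * ?f z) \<or>
      (\<forall>z\<in>upper_half_plane. slash k ?f \<gamma> z = - (\<epsilon> * ?f z))"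
    using holomorphic_square_eq upper_half_plane_simps sq by blast
  then show ?thesis
  proof
    assume "\<forall>z\<in>upper_half_plane. slash k ?f \<gamma> z = \<epsilon> * ?f z"
    then show ?thesis using n1 unfolding phase_eq_def by blast
  next
    assume "\<forall>z\<in>upper_half_plane. slash k ?f \<gamma> z = - (\<epsilon> * ?f z)"
    then show ?thesis using n1 unfolding phase_eq_def by (intro exI[of _ "- \<epsilon>"]) simp
  qed
qed

section \<open>Forms in the plus space that are eigenforms of U4\<close>

text \<open>The automorphy factors are positive reals, whose principal logarithm is real, so these
  formulas are exact and not just up to a phase.\<close>

lemma slash_scaling:
  assumes "m > 0"
  shows "slash k f (of_nat m, s, 0, of_nat m) z = f (z + of_int s / of_nat m)"
    and "slash k f (of_nat m, 0, 0, 1) z = of_real (real m powr (real k / 4)) * f (of_nat m * z)"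
    and "slash k f (1, 0, 0, of_nat m) z = of_real (real m powr - (real k / 4)) * f (z / of_nat m)"
proof -
  have e: "exp (- (of_nat k * Ln (of_nat m) / 2)) = complex_of_real (real m powr - (real k / 2))"
  proof -
    have "- (of_nat k * Ln (of_nat m) / 2) = complex_of_real (- (real k / 2) * ln (real m))"
      using assms by (simp add: Ln_of_nat)
    then show ?thesis using assms by (simp only: exp_of_real) (simp add: powr_def)
  qed
  have "(real m * real m) powr (real k / 4) * real m powr - (real k / 2) = 1"
    using assms by (simp add: powr_mult flip: powr_add)
  then have "complex_of_real ((real m * real m) powr (real k / 4)) * complex_of_real (real m powr - (real k / 2)) = 1"
    by (simp flip: of_real_mult)
  moreover have "moebius (of_nat m, s, 0, of_nat m) z = z + of_int s / of_nat m"
    using assms by (simp add: moebius_def field_simps)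
  ultimately show "slash k f (of_nat m, s, 0, of_nat m) z = f (z + of_int s / of_nat m)"
    by (simp add: slash_def mat_det_def autfactor_def e del: of_real_mult)
  show "slash k f (of_nat m, 0, 0, 1) z = of_real (real m powr (real k / 4)) * f (of_nat m * z)"
    by (simp add: slash_def mat_det_def autfactor_def moebius_def)
  have "real m powr (real k / 4) * real m powr - (real k / 2) = real m powr - (real k / 4)"
    by (simp flip: powr_add)
  then have "complex_of_real (real m powr (real k / 4)) * complex_of_real (real m powr - (real k / 2)) =
      of_real (real m powr - (real k / 4))"
    by (simp flip: of_real_mult)
  then show "slash k f (1, 0, 0, of_nat m) z = of_real (real m powr - (real k / 4)) * f (z / of_nat m)"
    by (simp add: slash_def mat_det_def autfactor_def moebius_def e mult_ac del: of_real_mult)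
qed

lemma q_convergent_sums:
  "q_convergent a \<Longrightarrow> z \<in> upper_half_plane \<Longrightarrow> (\<lambda>n. a n * qpow n z) sums qser a z"
  by (simp add: q_convergent_def qser_def summable_sums)

lemma qser_mult_sums:
  assumes "q_convergent a" "z \<in> upper_half_plane" "m > 0"
  shows "(\<lambda>n. (if m dvd n then a (n div m) else 0) * qpow n z) sums qser a (of_nat m * z)"
proof -
  have "of_nat m * z \<in> upper_half_plane" using assms by (simp add: upper_half_plane_def)
  then have "(\<lambda>n. a n * qpow n (of_nat m * z)) sums qser a (of_nat m * z)"
    using assms(1) by (rule q_convergent_sums[rotated])
  moreover have "qpow n (of_nat m * z) = qpow (m * n) z" for n
    by (simp add: qpow_def mult_ac)
  moreover have "(\<lambda>n. (if m dvd m * n then a (m * n div m) else 0) * qpow (m * n) z) sums c \<longleftrightarrow>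
      (\<lambda>n. (if m dvd n then a (n div m) else 0) * qpow n z) sums c" for c
    by (rule sums_mono_reindex) (use assms in \<open>auto simp: strict_mono_def\<close>)
  ultimately show ?thesis using assms(3) by simp
qed

text \<open>If the form starts at the exponent \<open>n\<close>, its dilates by 4 and 16 start at
  \<open>4 * n\<close> and \<open>16 * n\<close>. As \<open>n > 0\<close>, comparing coefficients at
  these three exponents kills \<open>y\<close>, \<open>x\<close> and \<open>c\<close> in
  turn.\<close>

lemma qser_lin_indep:
  assumes a: "q_convergent a" "a 0 = 0" "a n0 \<noteq> 0"
    and eq: "\<And>z. z \<in> upper_half_plane \<Longrightarrow> c * qser a (16 * z) = x * qser a (4 * z) + y * qser a z"
  shows "c = 0"
proof -
  define b where "b n = c * (if 16 dvd n then a (n div 16) else 0) -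
      (x * (if 4 dvd n then a (n div 4) else 0) + y * a n)" for n
  have b: "(\<lambda>n. b n * qpow n z) sums 0" if z: "z \<in> upper_half_plane" for z
  proof -
    have "(\<lambda>n. c * ((if 16 dvd n then a (n div 16) else 0) * qpow n z) -
        (x * ((if 4 dvd n then a (n div 4) else 0) * qpow n z) + y * (a n * qpow n z))) sums
        (c * qser a (16 * z) - (x * qser a (4 * z) + y * qser a z))"
      using qser_mult_sums[OF a(1) z, of 16] qser_mult_sums[OF a(1) z, of 4] q_convergent_sums[OF a(1) z]
      by (intro sums_diff sums_add sums_mult) simp_all
    then show ?thesis using eq[OF z] by (simp add: b_def algebra_simps)
  qed
  then have "q_convergent b" "\<And>z. z \<in> upper_half_plane \<Longrightarrow> qser b z = 0"
    by (auto simp: q_convergent_def qser_def sums_iff)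
  then have b0: "b n = 0" for n by (rule qser_eq_0_imp)
  define n where "n = (LEAST n. a n \<noteq> 0)"
  have n: "a n \<noteq> 0" unfolding n_def using a(3) by (rule LeastI)
  have less: "a m = 0" if "m < n" for m using that not_less_Least unfolding n_def by blast
  have "n > 0" using n a(2) by (cases n) auto
  have z: "(if m dvd j then a (j div m) else 0) = 0" if "j div m < n" for m j
    using less[OF that] by simp
  have "y = 0"
    using b0[of n] n z[of n 16] z[of n 4] \<open>n > 0\<close> unfolding b_def by simp
  moreover have "x = 0"
    using b0[of "4 * n"] n \<open>y = 0\<close> z[of "4 * n" 16] \<open>n > 0\<close> unfolding b_def by simp
  ultimately show "c = 0" using b0[of "16 * n"] n by (simp add: b_def)
qed

text \<open>The translation multiplies the terms with exponent 3 modulo 4 by \<open>A\<close> and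
  fixes those with exponent divisible by 4. By the eigenvalue relation the latter sum up to
  \<open>l\<close> times the form at \<open>4 * z\<close>.\<close>

lemma qser_quarter_translate:
  fixes s :: int
  assumes a: "q_convergent a" and supp: "\<And>n. n mod 4 = 1 \<or> n mod 4 = 2 \<Longrightarrow> a n = 0"
    and U: "\<And>n. a (4 * n) = l * a n" and z: "z \<in> upper_half_plane"
  defines "A \<equiv> exp (3 * of_int s * of_real pi * \<i> / 2)"
  shows "qser a (z + of_int s / 4) = A * qser a z + (1 - A) * (l * qser a (4 * z))"
proof -
  have "(\<lambda>n. A * (a n * qpow n z) + (1 - A) * (l * ((if 4 dvd n then a (n div 4) else 0) * qpow n z))) sums
      (A * qser a z + (1 - A) * (l * qser a (4 * z)))"
    using qser_mult_sums[OF a z, of 4] q_convergent_sums[OF a z]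
    by (intro sums_add sums_mult) simp_all
  moreover have "A * (a n * qpow n z) + (1 - A) * (l * ((if 4 dvd n then a (n div 4) else 0) * qpow n z)) =
      a n * qpow n (z + of_int s / 4)" for n
  proof -
    define m where "m = n div 4"
    have q: "qpow n (z + of_int s / 4) = qpow n z * exp (of_nat n * of_int s * of_real pi * \<i> / 2)"
      unfolding qpow_def by (simp add: algebra_simps flip: exp_add)
    have p: "exp (2 * of_int j * of_real pi * \<i>) = 1" for j :: int
      using exp_integer_2pi[of "of_int j"] by simp
    consider "n mod 4 = 0" | "n mod 4 = 1 \<or> n mod 4 = 2" | "n mod 4 = 3" by linarith
    then show ?thesis
    proof cases
      case 1
      then have n: "n = 4 * m" unfolding m_def by presburger
      have "of_nat n * of_int s * of_real pi * \<i> / 2 = 2 * of_int (int m * s) * of_real pi * \<i>"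
        by (simp add: n)
      then have "qpow n (z + of_int s / 4) = qpow n z" by (simp only: q p mult_1_right)
      moreover have "a n = l * a (n div 4)" using U[of m] by (simp add: n)
      moreover have "4 dvd n" by (simp add: n)
      ultimately show ?thesis by (simp add: algebra_simps)
    next
      case 2
      then have "\<not> 4 dvd n" by presburger
      then show ?thesis using supp[OF 2] by simp
    next
      case 3
      then have n: "n = 4 * m + 3" unfolding m_def by presburger
      have "of_nat n * of_int s * of_real pi * \<i> / 2 =
          3 * of_int s * of_real pi * \<i> / 2 + 2 * of_int (int m * s) * of_real pi * \<i>"
        by (simp add: n algebra_simps)
      then have "qpow n (z + of_int s / 4) = qpow n z * A"
        by (simp only: q exp_add p mult_1_right A_def)
      moreover have "\<not> 4 dvd n" using 3 by presburger
      ultimately show ?thesis by simp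
    qed
  qed
  ultimately have "(\<lambda>n. a n * qpow n (z + of_int s / 4)) sums
      (A * qser a z + (1 - A) * (l * qser a (4 * z)))" by simp
  then show ?thesis by (simp add: qser_def sums_iff)
qed

section \<open>The eigenvalue of U4 on forms with exponents 0 and 3 modulo 4\<close>

text \<open>With \<open>n\<close> the level and \<sigma> the second factor of the product below, the
  first factor is found by solving \<open>\<delta> * \<sigma> * D = Di * \<sigma>\<close>. Its lower
  left entry is a multiple of \<open>4 * n\<close>.\<close>

lemma matrix_identities:
  fixes n e :: int
  assumes "n * n = 1 - 4 * e"
  shows "(1 - 12 * e\<^sup>2) * (1 + 48 * e\<^sup>2) - (- 3 * e * n * (4 * e + 1)) * (- 12 * e * n) = 1"
    and "mat_mult (1 - 12 * e\<^sup>2, - 3 * e * n * (4 * e + 1), - 12 * e * n, 1 + 48 * e\<^sup>2)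
      (4 * e, - n * (4 * e + 1), n, 4 * e) = (e, - n * (4 * e + 1), n, 16 * e)"
proof -
  have 1: "(- 3 * e * n * (4 * e + 1)) * (- 12 * e * n) = 36 * e\<^sup>2 * (4 * e + 1) * (n * n)"
    by (simp add: algebra_simps power2_eq_square)
  show "(1 - 12 * e\<^sup>2) * (1 + 48 * e\<^sup>2) - (- 3 * e * n * (4 * e + 1)) * (- 12 * e * n) = 1"
    unfolding 1 assms by (simp add: algebra_simps power2_eq_square)
  have 2: "(- 3 * e * n * (4 * e + 1)) * n = - 3 * e * (4 * e + 1) * (n * n)" by simp
  have "(1 - 12 * e\<^sup>2) * (4 * e) + (- 3 * e * n * (4 * e + 1)) * n = e"
    unfolding 2 assms by (simp add: algebra_simps power2_eq_square)
  moreover have 3: "(- 12 * e * n) * (- n * (4 * e + 1)) = 12 * e * (4 * e + 1) * (n * n)" by simp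
  have "(- 12 * e * n) * (- n * (4 * e + 1)) + (1 + 48 * e\<^sup>2) * (4 * e) = 16 * e"
    unfolding 3 assms by (simp add: algebra_simps power2_eq_square)
  moreover have "(1 - 12 * e\<^sup>2) * (- n * (4 * e + 1)) + (- 3 * e * n * (4 * e + 1)) * (4 * e) =
      - n * (4 * e + 1)"
    by (simp add: algebra_simps power2_eq_square)
  moreover have "(- 12 * e * n) * (4 * e) + (1 + 48 * e\<^sup>2) * n = n"
    by (simp add: algebra_simps power2_eq_square)
  ultimately show "mat_mult (1 - 12 * e\<^sup>2, - 3 * e * n * (4 * e + 1), - 12 * e * n, 1 + 48 * e\<^sup>2)
      (4 * e, - n * (4 * e + 1), n, 4 * e) = (e, - n * (4 * e + 1), n, 16 * e)"
    unfolding mat_mult_def prod.case prod.inject by (intro conjI)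
qed

text \<open>In the plane spanned by \<open>f\<close> and \<open>e2\<close> the element \<sigma>
  sends \<open>f\<close> to a multiple of \<open>e2\<close>, since \<open>c1 = 0\<close>, and its
  square is a phase on \<open>f\<close>, which gives \<open>q\<close> absolute value 1. Then
  \<open>p = - q * B\<close> with \<open>p\<close> of absolute value 1 determines the absolute value
  of \<alpha>.\<close>

lemma plus_space_U4_eigenvalue:
  fixes \<alpha> :: complex
  assumes a: "a \<in> half_cusp_forms' (4 * N) k" and k: "k > 0" and N: "odd N"
    and supp: "\<And>n. n mod 4 = 1 \<or> n mod 4 = 2 \<Longrightarrow> a n = 0"
    and U: "\<And>n. a (4 * n) = \<alpha> * of_real (2 powr (real k / 2 - 1)) * a n"
    and \<alpha>: "\<alpha> \<noteq> 0" and a0: "a 0 = 0" and nz: "a n0 \<noteq> 0"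
  shows "norm \<alpha> = sqrt 2"
proof -
  let ?f = "qser a"
  have conv: "q_convergent a" using a by (simp add: half_cusp_forms'_def)
  \<comment> \<open>\<open>D\<close> and \<open>Di\<close> multiply and divide the argument by 4.
    Their product is the scalar matrix 4, so their slash actions are inverse up to phases.\<close>
  define D Di :: mat2 where "D = (4, 0, 0, 1)" and "Di = (1, 0, 0, 4)"
  define e2 e3 where "e2 = slash k ?f Di" and "e3 = slash k ?f D"
  have detD: "mat_det D > 0" "mat_det Di > 0" by (simp_all add: D_def Di_def mat_det_def)
  have e3: "e3 z = of_real (2 powr (real k / 2)) * ?f (4 * z)" for z
    using slash_scaling(2)[of 4 k ?f z] powr_powr[of 2 2 "real k / 4"]
    by (simp add: e3_def D_def)
  have e2: "e2 z = of_real (2 powr - (real k / 2)) * ?f (z / 4)" for z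
    using slash_scaling(3)[of 4 k ?f z] powr_powr[of 2 2 "- (real k / 4)"]
    by (simp add: e2_def Di_def)
  have pw: "complex_of_real (2 powr (real k / 2)) * of_real (2 powr - (real k / 2)) = 1"
    by (simp flip: of_real_mult powr_add)
  have tr: "?f (z + of_int s / 4) = exp (3 * of_int s * of_real pi * \<i> / 2) * ?f z +
      (1 - exp (3 * of_int s * of_real pi * \<i> / 2)) * (\<alpha> / 2) * e3 z"
    if "z \<in> upper_half_plane" for z s
  proof -
    have "complex_of_real (2 powr (real k / 2 - 1)) = of_real (2 powr (real k / 2)) / 2"
      by (simp add: powr_diff)
    then show ?thesis
      using qser_quarter_translate[OF conv supp U that, of s] by (simp only: e3) simp
  qed
  have \<Gamma>: "phase_eq (slash k ?f \<gamma>) ?f" if "\<gamma> \<in> Gamma0 (4 * N)" for \<gamma>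
    by (rule half_cusp_forms'_slash[OF a k that])
  \<comment> \<open>\<open>V\<close> is \<open>L\<close> conjugated by \<open>D\<close>;
    \<open>T2\<close> translates by 1/2 and \<open>Tn\<close> by \<open>- N\<close>;
    \<open>\<gamma>'\<close> is \<open>V\<close> conjugated by \<open>T2\<close> and still lies in
    \<Gamma>0(4N).\<close>
  define V L T2 Tn \<gamma>' :: mat2 where
    "V = (1, 0, 4 * int N, 1)" and "L = (1, 0, int N, 1)" and "T2 = (4, 2, 0, 4)" and
    "Tn = (1, - int N, 0, 1)" and "\<gamma>' = (1 + 2 * int N, - int N, 4 * int N, 1 - 2 * int N)"
  have det: "mat_det V > 0" "mat_det L > 0" "mat_det T2 > 0" "mat_det Tn > 0" "mat_det \<gamma>' > 0"
    by (simp_all add: V_def L_def T2_def Tn_def \<gamma>'_def mat_det_def algebra_simps)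
  have VG: "V \<in> Gamma0 (4 * N)" "\<gamma>' \<in> Gamma0 (4 * N)"
    by (simp_all add: V_def \<gamma>'_def Gamma0_def algebra_simps)

  define g where "g = slash k ?f L"
  have "\<exists>p q. norm p = 1 \<and> (\<forall>z\<in>upper_half_plane. g z = p * ?f z + q * e2 z)"
  proof -
    \<comment> \<open>The translate \<open>F\<close> by 1/2 equals
      \<open>- f + \<alpha> * e3\<close>. Up to phases \<open>V\<close> fixes both \<open>f\<close>
      and \<open>F\<close>, so \<open>e3\<close> slashed with \<open>V\<close> can be solved for, as
      \<alpha> is nonzero; it is \<open>g\<close> slashed with \<open>D\<close>, and
      \<open>Di\<close> then recovers \<open>g\<close>.\<close>
    define F where "F = slash k ?f T2"
    have F: "F z = (-1) * ?f z + \<alpha> * e3 z" if "z \<in> upper_half_plane" for z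
    proof -
      have "exp (3 * of_int 2 * of_real pi * \<i> / 2) = (-1 :: complex)"
      proof -
        have "(3 * of_int 2 * of_real pi * \<i> / 2 :: complex) = of_real pi * \<i> + 2 * of_real pi * \<i>"
          by simp
        then show ?thesis by (simp only: exp_add exp_pi_i exp_two_pi_i mult_1_right)
      qed
      then show ?thesis
        using tr[OF that, of 2] slash_scaling(1)[of 4 k ?f 2 z] by (simp add: F_def T2_def)
    qed
    have "phase_eq (slash k F V) (slash k ?f (mat_mult T2 V))"
      unfolding F_def by (rule slash_slash[OF det(3,1)])
    also have "mat_mult T2 V = mat_mult \<gamma>' T2"
      by (simp add: mat_mult_def T2_def V_def \<gamma>'_def algebra_simps)
    also have "phase_eq (slash k ?f (mat_mult \<gamma>' T2)) (slash k (slash k ?f \<gamma>') T2)"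
      by (rule phase_eq_sym[OF slash_slash[OF det(5,3)]])
    also have "phase_eq (slash k (slash k ?f \<gamma>') T2) F"
      unfolding F_def by (rule slash_phase_eq[OF \<Gamma>[OF VG(2)] det(3)])
    finally obtain u where u: "norm u = 1" "\<And>z. z \<in> upper_half_plane \<Longrightarrow> slash k F V z = u * F z"
      by (rule phase_eqE) blast
    obtain \<zeta> where \<zeta>: "norm \<zeta> = 1" "\<And>z. z \<in> upper_half_plane \<Longrightarrow> slash k ?f V z = \<zeta> * ?f z"
      using \<Gamma>[OF VG(1)] by (rule phase_eqE) blast
    have "phase_eq (slash k e3 V) (slash k ?f (mat_mult D V))"
      unfolding e3_def by (rule slash_slash[OF detD(1) det(1)])
    also have "mat_mult D V = mat_mult L D"
      by (simp add: mat_mult_def D_def V_def L_def)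
    also have "phase_eq (slash k ?f (mat_mult L D)) (slash k g D)"
      unfolding g_def by (rule phase_eq_sym[OF slash_slash[OF det(2) detD(1)]])
    finally obtain u3 where u3: "norm u3 = 1" "\<And>z. z \<in> upper_half_plane \<Longrightarrow> slash k e3 V z = u3 * slash k g D z"
      by (rule phase_eqE) blast
    have u30: "u3 \<noteq> 0" using u3(1) by auto
    define x y where "x = (\<zeta> - u) / (\<alpha> * u3)" and "y = u / u3"
    have gD: "slash k g D z = x * ?f z + y * e3 z" if z: "z \<in> upper_half_plane" for z
    proof -
      have "u * F z = slash k F V z" using u(2)[OF z] by simp
      also have "\<dots> = slash k (\<lambda>z. (-1) * ?f z + \<alpha> * e3 z) V z"
        by (rule slash_cong[OF det(1) z F])
      also have "\<dots> = (-1) * (\<zeta> * ?f z) + \<alpha> * (u3 * slash k g D z)"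
        unfolding slash_linear \<zeta>(2)[OF z] u3(2)[OF z] ..
      finally have "\<alpha> * u3 * slash k g D z = (\<zeta> - u) * ?f z + \<alpha> * u * e3 z"
        unfolding F[OF z] by (simp add: algebra_simps)
      then show ?thesis using \<alpha> u30 by (simp add: x_def y_def field_simps)
    qed
    have four: "slash k h (mat_mult D Di) z = h z" for h z
      using slash_scaling(1)[of 4 k h 0 z] by (simp add: mat_mult_def D_def Di_def)
    obtain v where v: "norm v = 1" "\<And>z. z \<in> upper_half_plane \<Longrightarrow> slash k (slash k g D) Di z = v * slash k g (mat_mult D Di) z"
      using slash_slash[OF detD, of k g] by (rule phase_eqE) blast
    obtain w where w: "norm w = 1" "\<And>z. z \<in> upper_half_plane \<Longrightarrow> slash k e3 Di z = w * slash k ?f (mat_mult D Di) z"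
      using slash_slash[OF detD, of k ?f] unfolding e3_def by (rule phase_eqE) blast
    have v0: "v \<noteq> 0" using v(1) by auto
    have "g z = (y * w / v) * ?f z + (x / v) * e2 z" if z: "z \<in> upper_half_plane" for z
    proof -
      have "v * g z = slash k (slash k g D) Di z" using v(2)[OF z] by (simp add: four)
      also have "\<dots> = slash k (\<lambda>z. x * ?f z + y * e3 z) Di z"
        by (rule slash_cong[OF detD(2) z gD])
      also have "\<dots> = x * e2 z + y * (w * ?f z)"
        unfolding slash_linear w(2)[OF z] four e2_def ..
      finally show ?thesis using v0 by (simp add: field_simps)
    qed
    moreover have "norm (y * w / v) = 1"
      using u(1) u3(1) v(1) w(1) by (simp add: y_def norm_mult norm_divide)
    ultimately show ?thesis by blast
  qed
  then obtain p q where p: "norm p = 1" and g: "\<And>z. z \<in> upper_half_plane \<Longrightarrow> g z = p * ?f z + q * e2 z"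
    by blast

  \<comment> \<open>\<open>Tn\<close> moves \<open>z / 4\<close> by \<open>- N / 4\<close>. Since
    \<open>N\<close> is odd, \<open>A\<close> is a primitive fourth root of unity, whence the
    absolute value \<open>sqrt 2\<close> of \<open>1 - A\<close>.\<close>
  define A where "A = exp (3 * of_int (- int N) * of_real pi * \<i> / 2)"
  have A2: "A\<^sup>2 = -1"
  proof -
    obtain m where m: "N = 2 * m + 1" using N by (elim oddE)
    have "A\<^sup>2 = exp (3 * of_int (- int N) * of_real pi * \<i>)"
      unfolding A_def exp_double[symmetric] by (rule arg_cong[where f = exp]) simp
    also have "3 * of_int (- int N) * of_real pi * \<i> =
        of_real pi * \<i> + 2 * of_int (- 3 * int m - 2) * of_real pi * \<i>"
      by (simp add: m algebra_simps)
    also have "exp \<dots> = -1"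
      using exp_integer_2pi[of "of_int (- 3 * int m - 2)"] by (simp add: exp_add)
    finally show ?thesis .
  qed
  then have A: "A = \<i> \<or> A = - \<i>"
    by (metis (no_types) power2_eq_iff power2_i)
  have nA: "norm A = 1" "norm (1 - A) = sqrt 2"
    using A by (auto simp: cmod_def)
  define B where "B = (1 - A) * (\<alpha> / 2)"
  have fTn: "slash k ?f Tn z = ?f z" for z
    using slash_scaling(1)[of 1 k ?f "- int N" z] qser_add_of_int[of a z "- int N"]
    by (simp add: Tn_def)
  have e2Tn: "slash k e2 Tn z = A * e2 z + B * ?f z" if z: "z \<in> upper_half_plane" for z
  proof -
    have z4: "z / 4 \<in> upper_half_plane" using z by (simp add: upper_half_plane_def)
    have "slash k e2 Tn z = e2 (z + of_int (- int N))"
      using slash_scaling(1)[of 1 k e2 "- int N" z] by (simp add: Tn_def)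
    also have "\<dots> = of_real (2 powr - (real k / 2)) * ?f (z / 4 + of_int (- int N) / 4)"
      unfolding e2 by (simp add: add_divide_distrib diff_divide_distrib)
    also have "?f (z / 4 + of_int (- int N) / 4) = A * ?f (z / 4) + B * e3 (z / 4)"
      unfolding tr[OF z4] A_def B_def ..
    also have "of_real (2 powr - (real k / 2)) * \<dots> = A * e2 z +
        B * (of_real (2 powr (real k / 2)) * of_real (2 powr - (real k / 2)) * ?f z)"
      unfolding e2 e3 by (simp add: algebra_simps)
    finally show ?thesis unfolding pw by simp
  qed

  \<comment> \<open>Odd squares are 1 modulo 4. Through \<open>e\<close> the diagonal entries
    \<open>1 - N\<^sup>2\<close> of \<open>Tn L Tn\<close> become visibly divisible by 4.\<close>
  obtain e :: int where e: "(int N)\<^sup>2 = 1 - 4 * e"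
  proof -
    obtain m where "N = 2 * m + 1" using N by (elim oddE)
    then have "(int N)\<^sup>2 = 1 - 4 * (- ((int m)\<^sup>2 + int m))" by (simp add: power2_eq_square algebra_simps)
    then show ?thesis by (rule that)
  qed
  have NN: "int N * int N = 1 - 4 * e" using e by (simp add: power2_eq_square)
  text \<open>\<open>\<sigma>\<close> is the analogue of \<open>z \<mapsto> -1/z\<close> in \<open>\<Gamma>\<^sub>0(N)\<close>: it interchanges \<open>D\<close> and its inverse up to the
    element \<open>\<delta>\<close> of \<open>\<Gamma>\<^sub>0(4N)\<close>.\<close>
  define \<sigma> \<delta> :: mat2 where "\<sigma> = (4 * e, - int N * (4 * e + 1), int N, 4 * e)" and
    "\<delta> = (1 - 12 * e\<^sup>2, - 3 * e * int N * (4 * e + 1), - 12 * e * int N, 1 + 48 * e\<^sup>2)"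
  have \<sigma>: "mat_mult (mat_mult Tn L) Tn = \<sigma>"
  proof -
    have "mat_mult (mat_mult Tn L) Tn =
        (1 - int N * int N, - int N * (2 - int N * int N), int N, 1 - int N * int N)"
      unfolding mat_mult_def Tn_def L_def by (simp add: algebra_simps)
    then show ?thesis unfolding NN \<sigma>_def by simp
  qed
  have det\<sigma>: "mat_det \<sigma> = 1" using det by (simp add: \<sigma>[symmetric] mat_det_mult) (simp add: Tn_def L_def mat_det_def)
  have \<delta>: "\<delta> \<in> Gamma0 (4 * N)" "mat_det \<delta> = 1"
    using matrix_identities(1)[OF NN] unfolding \<delta>_def Gamma0_def mat_det_def by auto
  have \<delta>\<sigma>: "mat_mult (mat_mult \<delta> \<sigma>) D = mat_mult Di \<sigma>"
    unfolding \<delta>_def \<sigma>_def matrix_identities(2)[OF NN] by (simp add: mat_mult_def D_def Di_def)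
  have \<sigma>\<sigma>: "mat_mult \<sigma> \<sigma> \<in> Gamma0 (4 * N)" "mat_det (mat_mult \<sigma> \<sigma>) > 0"
  proof -
    show "mat_det (mat_mult \<sigma> \<sigma>) > 0" by (simp add: mat_det_mult det\<sigma>)
    have "mat_det (mat_mult \<sigma> \<sigma>) = 1" by (simp add: mat_det_mult det\<sigma>)
    moreover have "int (4 * N) dvd int N * (4 * e) + 4 * e * int N" by simp
    ultimately show "mat_mult \<sigma> \<sigma> \<in> Gamma0 (4 * N)"
      by (simp add: Gamma0_def mat_mult_def \<sigma>_def mat_det_def)
  qed
  have det': "mat_det \<sigma> > 0" "mat_det \<delta> > 0" "mat_det (mat_mult Tn L) > 0" "mat_det (mat_mult \<delta> \<sigma>) > 0"
    using det\<sigma> \<delta>(2) det by (simp_all add: mat_det_mult)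

  have slash_\<sigma>: "phase_eq (slash k h \<sigma>) (slash k (slash k (slash k h Tn) L) Tn)" for h
  proof -
    have "phase_eq (slash k h \<sigma>) (slash k (slash k h (mat_mult Tn L)) Tn)"
      unfolding \<sigma>[symmetric] by (rule phase_eq_sym[OF slash_slash[OF det'(3) det(4)]])
    also have "phase_eq (slash k (slash k h (mat_mult Tn L)) Tn) (slash k (slash k (slash k h Tn) L) Tn)"
      by (rule slash_phase_eq[OF phase_eq_sym[OF slash_slash[OF det(4,2)]] det(4)])
    finally show ?thesis .
  qed
  \<comment> \<open>Up to the phase \<open>u\<close>, \<open>c1\<close> is the coefficient of
    \<open>f\<close> in \<open>f\<close> slashed with \<sigma>: \<open>p\<close> comes directly and
    \<open>q * B\<close> through the translate of \<open>e2\<close>.\<close>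
  define c1 where "c1 = p + q * B"
  have lin_Tn: "slash k h Tn z = x * ?f z + y * (A * e2 z + B * ?f z)"
    if z: "z \<in> upper_half_plane" and h: "\<And>z. z \<in> upper_half_plane \<Longrightarrow> h z = x * ?f z + y * e2 z" for h x y z
  proof -
    have "slash k h Tn z = slash k (\<lambda>z. x * ?f z + y * e2 z) Tn z"
      by (rule slash_cong[OF det(4) z h])
    then show ?thesis by (simp only: slash_linear fTn e2Tn[OF z])
  qed
  obtain u where u: "norm u = 1" "\<And>z. z \<in> upper_half_plane \<Longrightarrow> slash k ?f \<sigma> z = u * slash k g Tn z"
  proof -
    have "phase_eq (slash k ?f \<sigma>) (slash k (slash k (slash k ?f Tn) L) Tn)" by (rule slash_\<sigma>)
    also have "phase_eq \<dots> (slash k g Tn)"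
      unfolding g_def by (rule slash_phase_eq[OF slash_phase_eq[OF phase_eq_refl[OF fTn] det(2)] det(4)])
    finally show ?thesis by (rule phase_eqE) (rule that)
  qed
  have f\<sigma>: "slash k ?f \<sigma> z = u * c1 * ?f z + u * q * A * e2 z" if z: "z \<in> upper_half_plane" for z
    using lin_Tn[OF z g] u(2)[OF z] by (simp add: c1_def algebra_simps)
  have "\<exists>x y. \<forall>z\<in>upper_half_plane. slash k e2 \<sigma> z = x * ?f z + y * e2 z"
  proof -
    \<comment> \<open>Conjugation by \<open>Di\<close> turns \<open>L\<close> into \<open>V\<close>,
      so \<open>L\<close> fixes \<open>e2\<close> up to a phase. This closes the plane under the
      action of \<open>L\<close>.\<close>
    have "phase_eq (slash k e2 L) (slash k ?f (mat_mult Di L))"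
      unfolding e2_def by (rule slash_slash[OF detD(2) det(2)])
    also have "mat_mult Di L = mat_mult V Di"
      by (simp add: mat_mult_def Di_def V_def L_def)
    also have "phase_eq (slash k ?f (mat_mult V Di)) (slash k (slash k ?f V) Di)"
      by (rule phase_eq_sym[OF slash_slash[OF det(1) detD(2)]])
    also have "phase_eq \<dots> e2"
      unfolding e2_def by (rule slash_phase_eq[OF \<Gamma>[OF VG(1)] detD(2)])
    finally obtain u4 where u4: "\<And>z. z \<in> upper_half_plane \<Longrightarrow> slash k e2 L z = u4 * e2 z"
      by (rule phase_eqE) blast
    obtain v where v: "\<And>z. z \<in> upper_half_plane \<Longrightarrow>
        slash k e2 \<sigma> z = v * slash k (slash k (slash k e2 Tn) L) Tn z"
      using slash_\<sigma>[of e2] by (rule phase_eqE) blast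
    have L: "slash k (slash k e2 Tn) L z = (B * p) * ?f z + (A * u4 + B * q) * e2 z"
      if z: "z \<in> upper_half_plane" for z
    proof -
      have "slash k (slash k e2 Tn) L z = slash k (\<lambda>z. A * e2 z + B * ?f z) L z"
        by (rule slash_cong[OF det(2) z e2Tn])
      also have "\<dots> = A * (u4 * e2 z) + B * (p * ?f z + q * e2 z)"
        unfolding slash_linear u4[OF z] g_def[symmetric] g[OF z] ..
      finally show ?thesis by (simp add: algebra_simps)
    qed
    have "slash k e2 \<sigma> z = (v * (B * p + (A * u4 + B * q) * B)) * ?f z + (v * (A * u4 + B * q) * A) * e2 z"
      if z: "z \<in> upper_half_plane" for z
      using lin_Tn[OF z L] v[OF z] by (simp add: algebra_simps)
    then show ?thesis by blast
  qed
  then obtain x y where e2\<sigma>: "\<And>z. z \<in> upper_half_plane \<Longrightarrow> slash k e2 \<sigma> z = x * ?f z + y * e2 z" by blast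
  obtain v where v: "norm v = 1" "\<And>z. z \<in> upper_half_plane \<Longrightarrow> slash k e2 \<sigma> z = v * slash k (slash k ?f \<sigma>) D z"
  proof -
    have "phase_eq (slash k e2 \<sigma>) (slash k ?f (mat_mult Di \<sigma>))"
      unfolding e2_def by (rule slash_slash[OF detD(2) det'(1)])
    also have "mat_mult Di \<sigma> = mat_mult (mat_mult \<delta> \<sigma>) D" by (rule \<delta>\<sigma>[symmetric])
    also have "phase_eq (slash k ?f (mat_mult (mat_mult \<delta> \<sigma>) D)) (slash k (slash k ?f (mat_mult \<delta> \<sigma>)) D)"
      by (rule phase_eq_sym[OF slash_slash[OF det'(4) detD(1)]])
    also have "phase_eq \<dots> (slash k (slash k (slash k ?f \<delta>) \<sigma>) D)"
      by (rule slash_phase_eq[OF phase_eq_sym[OF slash_slash[OF det'(2,1)]] detD(1)])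
    also have "phase_eq \<dots> (slash k (slash k ?f \<sigma>) D)"
      by (rule slash_phase_eq[OF slash_phase_eq[OF \<Gamma>[OF \<delta>(1)] det'(1)] detD(1)])
    finally show ?thesis by (rule phase_eqE) (rule that)
  qed
  obtain w where w: "norm w = 1" "\<And>z. z \<in> upper_half_plane \<Longrightarrow> slash k e2 D z = w * ?f z"
  proof -
    have "phase_eq (slash k e2 D) (slash k ?f (mat_mult Di D))"
      unfolding e2_def by (rule slash_slash[OF detD(2,1)])
    also have "phase_eq \<dots> ?f"
      using slash_scaling(1)[of 4 k ?f 0] by (intro phase_eq_refl) (simp add: mat_mult_def D_def Di_def)
    finally show ?thesis by (rule phase_eqE) (rule that)
  qed
  have f\<sigma>D: "slash k (slash k ?f \<sigma>) D z = u * c1 * e3 z + u * q * A * (w * ?f z)"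
    if z: "z \<in> upper_half_plane" for z
  proof -
    have "slash k (slash k ?f \<sigma>) D z = slash k (\<lambda>z. u * c1 * ?f z + u * q * A * e2 z) D z"
      by (rule slash_cong[OF detD(1) z f\<sigma>])
    then show ?thesis by (simp only: slash_linear w(2)[OF z] e3_def)
  qed
  text \<open>\<open>e2 | \<sigma>\<close> lies in the span of \<open>f\<close> and \<open>e2\<close>, but it is also a multiple of \<open>f | \<sigma> D\<close>, which
    contains \<open>c1 f(4z)\<close>.\<close>
  have "v * u * c1 * of_real (2 powr (real k / 2)) = 0"
  proof (rule qser_lin_indep[OF conv a0 nz])
    fix z assume z: "z \<in> upper_half_plane"
    then have z4: "4 * z \<in> upper_half_plane" by (simp add: upper_half_plane_def)
    have "x * ?f (4 * z) + y * e2 (4 * z) = v * (u * c1 * e3 (4 * z) + u * q * A * (w * ?f (4 * z)))"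
      using e2\<sigma>[OF z4] v(2)[OF z4] f\<sigma>D[OF z4] by simp
    then have "x * ?f (4 * z) + y * of_real (2 powr - (real k / 2)) * ?f z =
        v * u * c1 * of_real (2 powr (real k / 2)) * ?f (16 * z) + v * u * q * A * w * ?f (4 * z)"
      unfolding e2 e3 by (simp add: algebra_simps)
    then show "v * u * c1 * of_real (2 powr (real k / 2)) * ?f (16 * z) =
        (x - v * u * q * A * w) * ?f (4 * z) + y * of_real (2 powr - (real k / 2)) * ?f z"
      by (simp add: algebra_simps)
  qed
  moreover have "v \<noteq> 0" "u \<noteq> 0" using u(1) v(1) by auto
  ultimately have c1: "c1 = 0" by simp

  obtain \<xi> where \<xi>: "norm \<xi> = 1" "\<And>z. z \<in> upper_half_plane \<Longrightarrow> slash k (slash k ?f \<sigma>) \<sigma> z = \<xi> * ?f z"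
  proof -
    have "phase_eq (slash k (slash k ?f \<sigma>) \<sigma>) (slash k ?f (mat_mult \<sigma> \<sigma>))"
      by (rule slash_slash[OF det'(1,1)])
    also have "phase_eq \<dots> ?f" by (rule \<Gamma>[OF \<sigma>\<sigma>(1)])
    finally show ?thesis by (rule phase_eqE) (rule that)
  qed
  have "\<exists>z\<in>upper_half_plane. ?f z \<noteq> 0" using qser_eq_0_imp[OF conv] nz by blast
  then obtain z where z: "z \<in> upper_half_plane" "?f z \<noteq> 0" by blast
  \<comment> \<open>The zero summand brings the expression into the two-term shape of
    \<open>slash_linear\<close>.\<close>
  have "\<xi> * ?f z = slash k (\<lambda>z. (u * q * A) * e2 z + 0 * e2 z) \<sigma> z"
    unfolding \<xi>(2)[OF z(1), symmetric] by (rule slash_cong[OF det'(1) z(1)]) (simp add: f\<sigma> c1)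
  also have "\<dots> = (u * q * A) * slash k e2 \<sigma> z" by (simp only: slash_linear) simp
  also have "slash k e2 \<sigma> z = v * (u * q * A * (w * ?f z))"
    unfolding v(2)[OF z(1)] f\<sigma>D[OF z(1)] by (simp add: c1)
  finally have "\<xi> = (u * q * A) * (v * (u * q * A * w))" using z(2) by simp
  then have "norm \<xi> = norm q * norm q"
    by (simp add: norm_mult u(1) v(1) w(1) nA(1))
  then have q1: "norm q = 1" using \<xi>(1) norm_ge_zero[of q] by (auto simp: power2_eq_1_iff simp flip: power2_eq_square)
  have "p = - (q * B)" using c1 by (simp add: c1_def eq_neg_iff_add_eq_0)
  then have "1 = norm q * (sqrt 2 * (norm \<alpha> / 2))"
    using p by (simp add: B_def norm_mult norm_divide nA(2))
  then have "norm \<alpha> = 2 / sqrt 2" using q1 by (simp add: field_simps)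
  then show ?thesis by (simp add: real_div_sqrt)
qed

section \<open>Waldspurger's local functions\<close>

text \<open>4 is the square of a unit modulo an odd prime; \<open>c\<close> is the inverse of 2 used
  to divide a root by 2.\<close>

lemma Legendre_mult_4:
  fixes a :: int and p :: nat
  assumes "prime p" "p \<noteq> 2"
  shows "Legendre (4 * a) (int p) = Legendre a (int p)"
proof -
  have odd: "odd p" using assms prime_odd_nat by (metis prime_ge_2_nat le_neq_implies_less)
  then have cop: "coprime (int p) 2" by simp
  obtain c where c: "[2 * c = 1] (mod int p)"
    using cong_solve_coprime_int[of 2 "int p"] cop by (auto simp: coprime_commute)
  have "[4 * a = 0] (mod int p) \<longleftrightarrow> [a = 0] (mod int p)"
  proof -
    have "coprime (int p) (2 ^ 2)" by (subst coprime_power_right_iff) (simp add: odd)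
    then have "coprime (int p) 4" by simp
    then show ?thesis by (simp add: cong_0_iff coprime_dvd_mult_right_iff)
  qed
  moreover have "QuadRes (int p) (4 * a) \<longleftrightarrow> QuadRes (int p) a"
  proof
    assume "QuadRes (int p) (4 * a)"
    then obtain y where y: "[y\<^sup>2 = 4 * a] (mod int p)" by (auto simp: QuadRes_def)
    have "[c\<^sup>2 * y\<^sup>2 = c\<^sup>2 * (4 * a)] (mod int p)" using y by (rule cong_scalar_left)
    also have "c\<^sup>2 * (4 * a) = (2 * c)\<^sup>2 * a" by (simp add: power2_eq_square)
    also have "[(2 * c)\<^sup>2 * a = 1\<^sup>2 * a] (mod int p)" using c by (intro cong_scalar_right cong_pow)
    finally have "[(c * y)\<^sup>2 = a] (mod int p)" by (simp add: power_mult_distrib)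
    then show "QuadRes (int p) a" by (auto simp: QuadRes_def)
  next
    assume "QuadRes (int p) a"
    then obtain y where y: "[y\<^sup>2 = a] (mod int p)" by (auto simp: QuadRes_def)
    have "[4 * y\<^sup>2 = 4 * a] (mod int p)" using y by (rule cong_scalar_left)
    then show "QuadRes (int p) (4 * a)"
      unfolding QuadRes_def by (intro exI[of _ "2 * y"]) (simp add: power_mult_distrib)
  qed
  ultimately show ?thesis by (simp add: Legendre_def)
qed

lemma multiplicity_2_mult_4: "n > 0 \<Longrightarrow> multiplicity 2 (4 * n) = multiplicity 2 n + (2::nat)" for n :: nat
proof -
  assume n: "n > 0"
  have "multiplicity 2 (2 ^ 2 * n) = multiplicity 2 (2 ^ 2 :: nat) + multiplicity 2 n"
    using n by (intro prime_elem_multiplicity_mult_distrib) auto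
  moreover have "multiplicity 2 (2 ^ 2 :: nat) = 2" by (rule multiplicity_same_power) auto
  ultimately show ?thesis by simp
qed

lemma multiplicity_odd_prime_mult_4:
  fixes p n :: nat
  assumes "prime p" "p \<noteq> 2"
  shows "multiplicity p (4 * n) = multiplicity p n"
proof (cases "n = 0")
  case False
  have "\<not> p dvd 2 ^ 2" using assms prime_dvd_power two_is_prime_nat primes_dvd_imp_eq by blast
  then have "multiplicity p (2 ^ 2) = 0" by (rule not_dvd_imp_multiplicity_0)
  moreover have "multiplicity p (2 ^ 2 * n) = multiplicity p (2 ^ 2) + multiplicity p n"
    using assms False by (intro prime_elem_multiplicity_mult_distrib) auto
  ultimately show ?thesis by simp
qed simp

lemma odd_prime_dvd_mult_4:
  fixes p n :: nat
  assumes "prime p" "p \<noteq> 2"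
  shows "p dvd 4 * n \<longleftrightarrow> p dvd n"
proof -
  have "\<not> p dvd 2 ^ 2" using assms prime_dvd_power two_is_prime_nat primes_dvd_imp_eq by blast
  then show ?thesis using assms(1) prime_dvd_mult_iff[of p "2 ^ 2" n] by simp
qed

lemma loc_2_mult_4:
  assumes "n > 0"
  shows "loc_h 2 (4 * n) = Suc (loc_h 2 n)" "loc_u 2 (4 * n) = loc_u 2 n"
proof -
  show "loc_h 2 (4 * n) = Suc (loc_h 2 n)"
    by (simp add: loc_h_def multiplicity_2_mult_4[OF assms])
  then show "loc_u 2 (4 * n) = loc_u 2 n"
    by (simp add: loc_u_def)
qed

lemma loc_odd_prime_mult_4:
  assumes "prime p" "p \<noteq> 2"
  shows "loc_h p (4 * n) = loc_h p n" "loc_u p (4 * n) = 4 * loc_u p n"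
proof -
  show h: "loc_h p (4 * n) = loc_h p n"
    by (simp add: loc_h_def multiplicity_odd_prime_mult_4[OF assms])
  have "p ^ (2 * loc_h p n) dvd n"
    unfolding loc_h_def by (rule multiplicity_dvd') simp
  then show "loc_u p (4 * n) = 4 * loc_u p n"
    by (simp add: loc_u_def h div_mult_swap)
qed

lemma c2'_mult_4: "n > 0 \<Longrightarrow> c2' \<delta> (4 * n) = \<delta> * c2' \<delta> n"
  by (simp add: c2'_def Let_def loc_2_mult_4)

lemma cs_mult_4:
  assumes "prime p" "p \<noteq> 2"
  shows "cs p \<delta> (4 * n) = cs p \<delta> n"
  using Legendre_mult_4[OF assms, of "- int (loc_u p n)"]
  by (simp add: cs_def Let_def loc_odd_prime_mult_4[OF assms] multiplicity_odd_prime_mult_4[OF assms])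

lemma c0_mult_4:
  assumes "prime p" "p \<noteq> 2"
  shows "c0 p \<delta> (4 * n) = c0 p \<delta> n"
  using Legendre_mult_4[OF assms, of "- int (loc_u p n)"]
  by (simp add: c0_def Let_def loc_odd_prime_mult_4[OF assms] multiplicity_odd_prime_mult_4[OF assms])

text \<open>As \<open>N\<close> is odd, both products run over odd primes only, where 4 is a unit
  square.\<close>

lemma C_product_mult_4:
  assumes "odd N"
  shows "C_product k N b (4 * n) = C_product k N b n"
proof -
  have "{p. prime p \<and> \<not> p dvd 2 * N \<and> p dvd 4 * n} = {p. prime p \<and> \<not> p dvd 2 * N \<and> p dvd n}"
    using odd_prime_dvd_mult_4 by (metis (lifting) dvd_triv_left)
  then show ?thesis
    unfolding C_product_def
    by (intro arg_cong2[where f = "(*)"] prod.cong) (use assms in \<open>auto intro!: cs_mult_4 c0_mult_4\<close>)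
qed

text \<open>Only the multiplicity at 2 changes, and by 2, while the square-free part depends on the
  parities alone.\<close>

lemma squarefree_part_mult_4: "squarefree_part (4 * n) = squarefree_part (n :: nat)"
proof (cases "n = 0")
  case False
  show ?thesis
  proof (rule multiplicity_eq_nat)
    fix p :: nat assume p: "prime p"
    have "multiplicity p (4 * n) mod 2 = multiplicity p n mod 2"
      using False p by (cases "p = 2") (auto simp: multiplicity_2_mult_4 multiplicity_odd_prime_mult_4)
    then show "multiplicity p (squarefree_part (4 * n)) = multiplicity p (squarefree_part n)"
      by (simp add: prime_multiplicity_squarefree_part[OF p])
  qed (simp_all add: zero_less_iff_neq_zero)
qed simp

lemma squarefree_multiplicity_le_1:
  fixes p t :: nat
  assumes "squarefree t" "prime p"
  shows "multiplicity p t \<le> 1"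
proof (rule ccontr)
  assume "\<not> multiplicity p t \<le> 1"
  then have "p\<^sup>2 dvd t" by (intro multiplicity_dvd') simp
  then have "is_unit p" using assms(1) unfolding squarefree_def by blast
  then show False using assms(2) by simp
qed

lemma squarefree_part_squarefree:
  fixes t :: nat
  assumes "squarefree t"
  shows "squarefree_part t = t"
proof (rule multiplicity_eq_nat)
  fix p :: nat assume p: "prime p"
  have "multiplicity p t \<le> 1"
    by (rule squarefree_multiplicity_le_1[OF assms p])
  then show "multiplicity p (squarefree_part t) = multiplicity p t"
    by (simp add: prime_multiplicity_squarefree_part[OF p])
qed (use assms in \<open>auto intro!: Nat.gr0I\<close>)

section \<open>Values of the local functions at 2 by residue class modulo 4\<close>

lemma loc_trivial:
  assumes "multiplicity p n \<le> 1"
  shows "loc_h p n = 0" "loc_u p n = n"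
  using assms by (simp_all add: loc_h_def loc_u_def)

lemma multiplicity_2_mod_4:
  fixes n :: nat
  shows "odd n \<Longrightarrow> multiplicity 2 n = 0"
    and "n mod 4 = 2 \<Longrightarrow> multiplicity 2 n = 1"
proof -
  show "odd n \<Longrightarrow> multiplicity 2 n = 0" by (rule not_dvd_imp_multiplicity_0)
  assume n: "n mod 4 = 2"
  show "multiplicity 2 n = 1"
  proof (rule multiplicity_eqI)
    show "2 ^ 1 dvd n" using n by (simp, presburger)
    have "\<not> 4 dvd n" using n by presburger
    then show "\<not> 2 ^ Suc 1 dvd n" by simp
  qed
qed

lemma c2'_1_2_mod_4:
  assumes "n mod 4 = 1 \<or> n mod 4 = 2"
  shows "c2' \<delta> n = 1"
proof (cases "n mod 4 = 1")
  case True
  then have "odd n" by presburger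
  then show ?thesis using hilbert_symbol_1_mod_4[OF True]
    by (simp add: c2'_def Let_def loc_trivial multiplicity_2_mod_4(1))
next
  case False
  then have "n mod 4 = 2" using assms by simp
  from multiplicity_2_mod_4(2)[OF this] show ?thesis
    by (simp add: c2'_def Let_def loc_trivial)
qed

text \<open>The symbol of 2 and \<open>n\<close> stays unevaluated: it does not depend on \<delta>
  and cancels in the difference of the values for \<alpha> and \<open>\<alpha>'\<close>.\<close>

lemma c2'_3_mod_4:
  assumes "n mod 4 = 3"
  shows "c2' \<delta> n = \<delta> - of_real (2 powr (-1 / 2)) * of_int (hilbert_symbol 2 2 (of_nat n))"
proof -
  have "odd n" using assms by presburger
  then show ?thesis using hilbert_symbol_3_mod_4[OF assms]
    by (simp add: c2'_def Let_def loc_trivial multiplicity_2_mod_4(1))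
qed

lemma c2''_1_2_mod_4:
  assumes "n mod 4 = 1 \<or> n mod 4 = 2"
  shows "c2'' \<delta> n = 0"
proof (cases "n mod 4 = 1")
  case True
  then have "odd n" by presburger
  then show ?thesis using hilbert_symbol_1_mod_4[OF True]
    by (subst c2''.simps) (simp add: multiplicity_2_mod_4(1))
next
  case False
  then have "n mod 4 = 2" using assms by simp
  from multiplicity_2_mod_4(2)[OF this] show ?thesis
    by (subst c2''.simps) simp
qed

lemma c2''_3_mod_4:
  assumes "n mod 4 = 3"
  shows "c2'' \<delta> n = \<delta>"
proof -
  have "odd n" "n \<noteq> 0" using assms by presburger+
  then show ?thesis using hilbert_symbol_3_mod_4[OF assms]
    by (subst c2''.simps) (simp add: multiplicity_2_mod_4(1))
qed

lemma c2''_mult_4: "n > 0 \<Longrightarrow> c2'' \<delta> (4 * n) = \<delta> * (c2'' \<delta> n + c2' \<delta> n)"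
  by (subst c2''.simps) (simp add: multiplicity_2_mult_4)

section \<open>From Waldspurger's basis to the coefficients of g\<close>

text \<open>This exhibits the form as an eigenform of U4: \<delta> comes from the local function at
  2, the power of 2 from \<open>n\<close> to the power \<open>(k - 2) / 4\<close>, and all other
  factors are unchanged.\<close>

lemma wald_form_mult_4:
  assumes "odd N"
  shows "wald_form k N b (c2' \<delta>) A (4 * n) = \<delta> * of_real (2 powr (real k / 2 - 1)) * wald_form k N b (c2' \<delta>) A n"
proof (cases "n = 0")
  case False
  have "real (4 * n) powr ((real k - 2) / 4) = (2 powr 2) powr ((real k - 2) / 4) * real n powr ((real k - 2) / 4)"
    by (simp add: powr_mult)
  also have "(2 powr 2 :: real) powr ((real k - 2) / 4) = 2 powr (real k / 2 - 1)"
    unfolding powr_powr by (rule arg_cong[where f = "\<lambda>x. 2 powr x"]) (simp add: field_simps)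
  finally have "complex_of_real (real (4 * n) powr ((real k - 2) / 4)) =
      of_real (2 powr (real k / 2 - 1)) * of_real (real n powr ((real k - 2) / 4))" by simp
  then show ?thesis
    using False by (simp only: wald_form_def squarefree_part_mult_4 C_product_mult_4[OF assms]) (simp add: c2'_mult_4)
qed (simp add: wald_form_def)

lemma wald_form_plus_space:
  assumes "odd N" "k > 0" "\<delta> \<noteq> 0"
    and f: "wald_form k N b (c2' \<delta>) A \<in> shimura_space k N b"
    and nz: "wald_form k N b (c2' \<delta>) A \<noteq> (\<lambda>_. 0)"
    and supp: "\<And>n. n mod 4 = 1 \<or> n mod 4 = 2 \<Longrightarrow> wald_form k N b (c2' \<delta>) A n = 0"
  shows "norm \<delta> = sqrt 2"
proof -
  have "wald_form k N b (c2' \<delta>) A \<in> half_cusp_forms' (4 * N) k"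
    using f by (auto simp: shimura_space_def half_cusp_forms_def split: if_splits)
  moreover obtain n where n: "wald_form k N b (c2' \<delta>) A n \<noteq> 0" using nz by (auto simp: fun_eq_iff)
  moreover have "wald_form k N b (c2' \<delta>) A 0 = 0" by (simp add: wald_form_def)
  ultimately show ?thesis
    using plus_space_U4_eigenvalue[of "wald_form k N b (c2' \<delta>) A" N k \<delta> n]
      assms(1-3) supp wald_form_mult_4[OF assms(1)] n by blast
qed

text \<open>The local component 1 at 2 isolates the factor common to all of Waldspurger's forms, and
  \<open>K\<close> is what remains at 2. The index \<open>D\<close> is the absolute discriminant
  when \<open>t\<close> is square-free.\<close>

lemma kohnen_form_coefficient:
  assumes N: "odd N" and k: "k > 0" and \<alpha>: "\<alpha> * \<alpha>' = 1"
    and W: "waldspurger_function k N b \<alpha> \<alpha>' A"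
    and g: "g \<in> kohnen_subspace k N b" "g \<noteq> (\<lambda>_. 0)"
  obtains K where "K \<noteq> 0"
    "\<And>t. t > 0 \<Longrightarrow> t mod 4 \<noteq> 0 \<Longrightarrow> (let D = (if t mod 4 = 3 then t else 4 * t) in
      g D = K * wald_form k N b (\<lambda>_. 1) A D)"
proof -
  have \<alpha>0: "\<alpha> \<noteq> 0" "\<alpha>' \<noteq> 0" using \<alpha> by auto
  have g0: "g n = 0" if "n mod 4 = 1 \<or> n mod 4 = 2" for n
  proof -
    have "(- int n) mod 4 \<in> {2, 3}" using that by (simp; presburger)
    then show ?thesis using g(1) unfolding kohnen_subspace_def by blast
  qed
  have gV: "g \<in> shimura_space k N b" using g(1) by (simp add: kohnen_subspace_def)
  define Y where "Y = wald_form k N b (\<lambda>_. 1) A"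
  have Y: "wald_form k N b c A n = c n * Y n" for c n
    by (simp add: Y_def wald_form_def)
  define f where "f \<delta> = wald_form k N b (c2' \<delta>) A" for \<delta>
  have f12: "f \<delta> n = Y n" if "n mod 4 = 1 \<or> n mod 4 = 2" for n \<delta>
    by (simp add: f_def Y c2'_1_2_mod_4[OF that])
  show ?thesis
  proof (cases "\<alpha> = \<alpha>'")
    case False
    then have basis: "is_basis_pair (shimura_space k N b) (f \<alpha>) (f \<alpha>')"
      using W by (simp add: waldspurger_function_def f_def)
    then have V: "f \<alpha> \<in> shimura_space k N b" "f \<alpha>' \<in> shimura_space k N b"
      and ind: "\<And>x y. (\<forall>n. x * f \<alpha> n + y * f \<alpha>' n = 0) \<Longrightarrow> x = 0 \<and> y = 0"
      unfolding is_basis_pair_def by blast+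
    have nz: "f \<alpha> \<noteq> (\<lambda>_. 0)" "f \<alpha>' \<noteq> (\<lambda>_. 0)"
      using ind[of 1 0] ind[of 0 1] by auto
    obtain x y where xy: "\<And>n. g n = x * f \<alpha> n + y * f \<alpha>' n"
      using basis gV unfolding is_basis_pair_def by blast
    \<comment> \<open>Otherwise the common factor \<open>Y\<close> vanishes at all \<open>n\<close>
      congruent to 1 or 2 modulo 4, and both basis forms fall under
      \<open>wald_form_plus_space\<close>. The product of \<alpha> and \<open>\<alpha>'\<close>
      would then have absolute value 2.\<close>
    have "x + y = 0"
    proof (rule ccontr)
      assume "x + y \<noteq> 0"
      then have "Y n = 0" if "n mod 4 = 1 \<or> n mod 4 = 2" for n
        using xy[of n] g0[OF that] f12[OF that] by (simp flip: distrib_right)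
      then have supp: "f \<delta> n = 0" if "n mod 4 = 1 \<or> n mod 4 = 2" for \<delta> n
        using f12[OF that] that by simp
      have "norm \<alpha> = sqrt 2"
        by (rule wald_form_plus_space[of N k \<alpha> b A, folded f_def, OF N k \<alpha>0(1) V(1) nz(1) supp])
      moreover have "norm \<alpha>' = sqrt 2"
        by (rule wald_form_plus_space[of N k \<alpha>' b A, folded f_def, OF N k \<alpha>0(2) V(2) nz(2) supp])
      ultimately have "norm (\<alpha> * \<alpha>') = 2" by (simp add: norm_mult)
      then show False by (simp add: \<alpha>)
    qed
    then have y: "y = - x" by (simp add: eq_neg_iff_add_eq_0 add.commute)
    have "x \<noteq> 0" using g(2) xy y by (auto simp: fun_eq_iff)
    show ?thesis
    proof (rule that[of "x * (\<alpha> - \<alpha>')"])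
      show "x * (\<alpha> - \<alpha>') \<noteq> 0" using \<open>x \<noteq> 0\<close> False by simp
      fix t :: nat assume t: "t > 0" "t mod 4 \<noteq> 0"
      \<comment> \<open>For \<open>D = t\<close> the Hilbert symbol terms cancel. For
        \<open>D = 4 * t\<close> the two values are \<alpha> and \<open>\<alpha>'\<close>
        themselves.\<close>
      have "c2' \<alpha> D - c2' \<alpha>' D = \<alpha> - \<alpha>'" if D: "D = (if t mod 4 = 3 then t else 4 * t)" for D
      proof (cases "t mod 4 = 3")
        case True
        then show ?thesis by (simp add: D c2'_3_mod_4)
      next
        case False
        then have "t mod 4 = 1 \<or> t mod 4 = 2" using t by linarith
        then show ?thesis using False t by (simp add: D c2'_mult_4 c2'_1_2_mod_4)
      qed
      moreover have "g D = x * (c2' \<alpha> D - c2' \<alpha>' D) * Y D" for D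
        unfolding xy f_def Y y by (simp add: algebra_simps)
      ultimately show "let D = (if t mod 4 = 3 then t else 4 * t) in
          g D = x * (\<alpha> - \<alpha>') * wald_form k N b (\<lambda>_. 1) A D"
        by (simp add: Y_def Let_def)
    qed
  next
    case True
    define f2 where "f2 = wald_form k N b (c2'' \<alpha>) A"
    have basis: "is_basis_pair (shimura_space k N b) (f \<alpha>) f2"
      using W True by (simp add: waldspurger_function_def f_def f2_def)
    then have V: "f \<alpha> \<in> shimura_space k N b"
      and ind: "\<And>x y. (\<forall>n. x * f \<alpha> n + y * f2 n = 0) \<Longrightarrow> x = 0 \<and> y = 0"
      unfolding is_basis_pair_def by blast+
    have nz: "f \<alpha> \<noteq> (\<lambda>_. 0)" using ind[of 1 0] by auto
    obtain x y where xy: "\<And>n. g n = x * f \<alpha> n + y * f2 n"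
      using basis gV unfolding is_basis_pair_def by blast
    have f20: "f2 n = 0" if "n mod 4 = 1 \<or> n mod 4 = 2" for n
      by (simp add: f2_def Y c2''_1_2_mod_4[OF that])
    \<comment> \<open>The second basis form vanishes at \<open>n\<close> congruent to 1 or 2 modulo
      4, so otherwise the first one would vanish there too. Then \<alpha> would have absolute value
      \<open>sqrt 2\<close>, although its square is 1.\<close>
    have x: "x = 0"
    proof (rule ccontr)
      assume "x \<noteq> 0"
      then have supp: "f \<alpha> n = 0" if "n mod 4 = 1 \<or> n mod 4 = 2" for n
        using xy[of n] g0[OF that] f20[OF that] by simp
      have "norm \<alpha> = sqrt 2"
        by (rule wald_form_plus_space[of N k \<alpha> b A, folded f_def, OF N k \<alpha>0(1) V nz supp])
      then have "norm (\<alpha> * \<alpha>') = 2" using True by (simp add: norm_mult)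
      then show False by (simp add: \<alpha>)
    qed
    have "y \<noteq> 0" using g(2) xy x by (auto simp: fun_eq_iff)
    show ?thesis
    proof (rule that[of "y * \<alpha>"])
      show "y * \<alpha> \<noteq> 0" using \<open>y \<noteq> 0\<close> \<alpha>0 by simp
      fix t :: nat assume t: "t > 0" "t mod 4 \<noteq> 0"
      \<comment> \<open>For \<open>D = 4 * t\<close> the recursion yields \<alpha> times
        \<open>0 + 1\<close>.\<close>
      have "c2'' \<alpha> D = \<alpha>" if D: "D = (if t mod 4 = 3 then t else 4 * t)" for D
      proof (cases "t mod 4 = 3")
        case True
        then show ?thesis by (simp add: D c2''_3_mod_4)
      next
        case False
        then have "t mod 4 = 1 \<or> t mod 4 = 2" using t by linarith
        then show ?thesis using False t
          by (simp add: D c2''_mult_4 c2''_1_2_mod_4 c2'_1_2_mod_4)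
      qed
      then show "let D = (if t mod 4 = 3 then t else 4 * t) in
          g D = y * \<alpha> * wald_form k N b (\<lambda>_. 1) A D"
        unfolding xy x f2_def Y by (simp add: Let_def)
    qed
  qed
qed

text \<open>No odd prime divides \<open>D\<close> twice, so \<open>h = 0\<close> throughout. Primes
  dividing \<open>D\<close> contribute 1, in the second product because \<open>loc_beta\<close> is 1
  at 0; at the remaining primes of \<open>N\<close> the Legendre condition selects the value
  \<open>sqrt 2\<close>.\<close>

lemma C_product_fundamental:
  assumes N: "N > 0" "odd N" and t: "t > 0" "squarefree t"
    and D: "D = (if t mod 4 = 3 then t else 4 * t)"
    and leg: "\<And>p. prime p \<Longrightarrow> p dvd N \<Longrightarrow> \<not> p dvd D \<Longrightarrow>
      of_int (Legendre (- int D) (int p)) = - of_real (sqrt (real p)) * hecke_param k b p"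
  shows "C_product k N b D = (\<Prod>p\<in>{p. prime p \<and> p dvd N \<and> \<not> p dvd D}. of_real (sqrt 2))"
proof -
  have D0: "D > 0" using t by (simp add: D)
  have mult: "multiplicity p D \<le> 1" if "prime p" "p \<noteq> 2" for p
  proof -
    have "multiplicity p t \<le> 1" by (rule squarefree_multiplicity_le_1[OF t(2) that(1)])
    then show ?thesis by (simp add: D multiplicity_odd_prime_mult_4[OF that])
  qed
  have mult1: "multiplicity p D = 1" if "prime p" "p \<noteq> 2" "p dvd D" for p
  proof -
    have "multiplicity p D \<noteq> 0"
      using that D0 by (metis not_one_less_zero not_prime_unit multiplicity_eq_zero_iff less_numeral_extra(3))
    then show ?thesis using mult[OF that(1,2)] by simp
  qed
  have cs: "cs p (hecke_param k b p) D = (if p dvd D then 1 else of_real (sqrt 2))"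
    if p: "prime p" "p dvd N" for p
  proof -
    have p2: "p \<noteq> 2" using p N by auto
    note loc = loc_trivial[OF mult[OF p(1) p2]]
    show ?thesis
    proof (cases "p dvd D")
      case True
      then show ?thesis by (simp add: cs_def Let_def loc mult1[OF p(1) p2])
    next
      case False
      then have "multiplicity p D = 0" by (rule not_dvd_imp_multiplicity_0)
      then show ?thesis using False leg[OF p False] by (simp add: cs_def Let_def loc)
    qed
  qed
  have c0: "c0 p \<delta> D = 1" if "prime p" "\<not> p dvd 2 * N" "p dvd D" for p \<delta>
  proof -
    have p2: "p \<noteq> 2" using that by auto
    show ?thesis
      by (simp add: c0_def Let_def loc_trivial[OF mult[OF that(1) p2]] mult1[OF that(1) p2 that(3)] loc_beta_def)
  qed
  have fin: "finite {p. prime p \<and> p dvd N}" using N by (auto intro: finite_subset[OF _ finite_divisors_nat])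
  have "(\<Prod>p\<in>{p. prime p \<and> p dvd N}. cs p (hecke_param k b p) D) =
      (\<Prod>p\<in>{p. prime p \<and> p dvd N}. if p dvd D then 1 else complex_of_real (sqrt 2))"
    by (rule prod.cong) (auto simp: cs)
  also have "\<dots> = (\<Prod>p\<in>{p. prime p \<and> p dvd N \<and> \<not> p dvd D}. of_real (sqrt 2))"
    using fin by (intro prod.mono_neutral_cong_right) auto
  finally show ?thesis by (simp add: C_product_def c0)
qed

theorem theorem3p5:
  fixes k N H :: nat
    and b g A :: "nat \<Rightarrow> complex"
    and \<alpha> \<alpha>' :: complex
    and u v :: rat
    and R :: "rat quat set"
    and I :: "nat \<Rightarrow> rat quat set"
  assumes "k mod 4 = 3"
    and "N > 0" and "odd N" and "squarefree N"
    and "newform N (k - 1) b"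
    and "newform_L k N b (1 / 2) \<noteq> 0"
    and "quaternion_setup u v N
           {p. prime p \<and> p dvd N \<and> atkin_lehner_eigenvalue N (k - 1) b p (-1)} R H I"
    and "theta_construction u v k N b H I g"
    and "g \<in> kohnen_subspace k N b"
    and "g \<noteq> (\<lambda>_. 0)"
    and "\<alpha> + \<alpha>' = hecke_param k b 2" and "\<alpha> * \<alpha>' = 1"
    and "waldspurger_function k N b \<alpha> \<alpha>' A"
  shows "\<exists>r::complex. r \<noteq> 0 \<and>
    (\<forall>t::nat. t > 0 \<and> squarefree t \<and>
       (\<forall>p. prime p \<and> p dvd N \<and> \<not> int p dvd quadratic_disc (- int t) \<longrightarrow>
          of_int (Legendre (quadratic_disc (- int t)) (int p)) =
            - of_real (sqrt (real p)) * hecke_param k b p) \<longrightarrow>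
       A t = r *
         (\<Prod>p\<in>{p. prime p \<and> p dvd N \<and> \<not> int p dvd quadratic_disc (- int t)}.
            of_real (2 powr (-1 / 2))) *
         of_real (real_of_int \<bar>quadratic_disc (- int t)\<bar> powr ((2 - real k) / 4)) *
         g (nat \<bar>quadratic_disc (- int t)\<bar>))"
proof -
  have k: "k > 0" using assms(1) by (cases k) auto
  obtain K where K: "K \<noteq> 0" "\<And>t. t > 0 \<Longrightarrow> t mod 4 \<noteq> 0 \<Longrightarrow>
      (let D = (if t mod 4 = 3 then t else 4 * t) in g D = K * wald_form k N b (\<lambda>_. 1) A D)"
    using kohnen_form_coefficient[OF assms(3) k assms(12,13,9,10)] by blast
  \<comment> \<open>The constant is \<open>r = 1 / K\<close>: the formula for the coefficient of
    \<open>g\<close> at \<open>D\<close> is solved for \<open>A t\<close>.\<close>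
  have "A t = inverse K *
         (\<Prod>p\<in>{p. prime p \<and> p dvd N \<and> \<not> int p dvd quadratic_disc (- int t)}.
            of_real (2 powr (-1 / 2))) *
         of_real (real_of_int \<bar>quadratic_disc (- int t)\<bar> powr ((2 - real k) / 4)) *
         g (nat \<bar>quadratic_disc (- int t)\<bar>)"
    if t: "t > 0" "squarefree t" and leg: "\<And>p. prime p \<Longrightarrow> p dvd N \<Longrightarrow> \<not> int p dvd quadratic_disc (- int t) \<Longrightarrow>
          of_int (Legendre (quadratic_disc (- int t)) (int p)) =
            - of_real (sqrt (real p)) * hecke_param k b p" for t
  proof -
    define D where "D = (if t mod 4 = 3 then t else 4 * t)"
    have "(- int t) mod 4 = 1 \<longleftrightarrow> t mod 4 = 3" by presburger
    then have disc: "quadratic_disc (- int t) = - int D"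
      by (simp add: quadratic_disc_def D_def)
    have D0: "D > 0" using t by (simp add: D_def)
    have "t mod 4 \<noteq> 0"
    proof
      assume "t mod 4 = 0"
      then have "2\<^sup>2 dvd t" by (simp add: dvd_eq_mod_eq_0)
      then have "is_unit (2::nat)" using t(2) unfolding squarefree_def by blast
      then show False by simp
    qed
    then have g: "g D = K * wald_form k N b (\<lambda>_. 1) A D"
      using K(2)[OF t(1)] by (simp add: D_def Let_def)
    have sf: "squarefree_part D = t"
      using squarefree_part_squarefree[OF t(2)] by (simp add: D_def squarefree_part_mult_4)
    define P where "P = {p. prime p \<and> p dvd N \<and> \<not> p dvd D}"
    have C: "C_product k N b D = (\<Prod>p\<in>P. of_real (sqrt 2))"
      unfolding P_def
      by (rule C_product_fundamental[OF assms(2,3) t D_def]) (use leg in \<open>simp add: disc\<close>)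
    have "(2 powr (-1 / 2) :: real) * sqrt 2 = 1"
      by (simp add: powr_half_sqrt[symmetric] flip: powr_add)
    then have "complex_of_real (2 powr (-1 / 2)) * of_real (sqrt 2) = 1"
      by (simp flip: of_real_mult)
    then have prod: "(\<Prod>p\<in>P. complex_of_real (2 powr (-1 / 2))) * (\<Prod>p\<in>P. of_real (sqrt 2)) = 1"
      by (simp flip: prod.distrib power_mult_distrib)
    have "real D powr ((2 - real k) / 4) * real D powr ((real k - 2) / 4) = 1"
      using D0 by (simp flip: powr_add add_divide_distrib)
    then have pw: "complex_of_real (real D powr ((2 - real k) / 4)) * of_real (real D powr ((real k - 2) / 4)) = 1"
      by (simp flip: of_real_mult)
    \<comment> \<open>The square-free part of \<open>D\<close> is \<open>t\<close>, which brings in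
      \<open>A t\<close>. The remaining factors are grouped into pairs that cancel: the constants,
      the powers of 2 over \<open>P\<close>, and the powers of \<open>D\<close>.\<close>
    have "inverse K * (\<Prod>p\<in>P. complex_of_real (2 powr (-1 / 2))) * of_real (real D powr ((2 - real k) / 4)) * g D =
        A t * (inverse K * K) *
        ((\<Prod>p\<in>P. complex_of_real (2 powr (-1 / 2))) * (\<Prod>p\<in>P. of_real (sqrt 2))) *
        (complex_of_real (real D powr ((2 - real k) / 4)) * of_real (real D powr ((real k - 2) / 4)))"
      unfolding g wald_form_def sf C using D0 by simp
    also have "\<dots> = A t" unfolding prod pw using K(1) by simp
    finally show ?thesis by (simp add: disc P_def)
  qed
  with K(1) show ?thesis by (intro exI[of _ "inverse K"]) auto
qed

end
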